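(* Let $q=p^f>5$ with $p$ odd. There is no nontrivial $2$-$(v,k,2)$ design $\mathcal{D}$ with $(v,b,r,k)=\left(\frac{q(q-1)}{2},\,\frac{q(q+1)}{2},\,q+1,\,q-1\right)$ admitting a flag-transitive automorphism group $G$ with $\mathrm{Soc}(G)=T\cong PSL(2,q)$ such that $T_x\cong D_{q+1}$ for a point $x$ and $T_B\cong D_{q-1}$ for a block $B$.
   Context: A $2$-$(v,k,2)$ design: $v$ points, blocks of size $k$, every two distinct points in exactly $2$ blocks; $b$ is the number of blocks, $r$ the number of blocks through a point. Flag-transitive means transitive on incident point-block pairs. $D_n$ is the dihedral group of order $n$. *)

theory Defs
  imports "HOL-Analysis.Determinants" "HOL-Algebra.Group_Action" "HOL-Algebra.Generated_Groups"
    "HOL-Computational_Algebra.Primes"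
begin

section \<open>Designs and their automorphisms\<close>

text \<open>
  Blocks are subsets of the point set, so a design has no repeated blocks.
\<close>

definition two_design :: "'a set \<Rightarrow> 'a set set \<Rightarrow> nat \<Rightarrow> nat \<Rightarrow> nat \<Rightarrow> bool" where
  "two_design P Bs v k l \<longleftrightarrow>
     finite P \<and> card P = v \<and>
     (\<forall>B\<in>Bs. B \<subseteq> P \<and> card B = k) \<and>
     (\<forall>x\<in>P. \<forall>y\<in>P. x \<noteq> y \<longrightarrow> card {B \<in> Bs. x \<in> B \<and> y \<in> B} = l)"

definition nontrivial_two_design :: "'a set \<Rightarrow> 'a set set \<Rightarrow> nat \<Rightarrow> nat \<Rightarrow> nat \<Rightarrow> bool" where
  "nontrivial_two_design P Bs v k l \<longleftrightarrow> two_design P Bs v k l \<and> 2 < k \<and> k < v"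

definition design_aut :: "'a set \<Rightarrow> 'a set set \<Rightarrow> ('a \<Rightarrow> 'a) monoid" where
  "design_aut P Bs = (BijGroup P)\<lparr>carrier := {g \<in> Bij P. (\<lambda>B. g ` B) ` Bs = Bs}\<rparr>"

definition flags :: "'a set \<Rightarrow> 'a set set \<Rightarrow> ('a \<times> 'a set) set" where
  "flags P Bs = {(x, B). x \<in> P \<and> B \<in> Bs \<and> x \<in> B}"

definition flag_transitive :: "('a \<Rightarrow> 'a) set \<Rightarrow> 'a set \<Rightarrow> 'a set set \<Rightarrow> bool" where
  "flag_transitive G P Bs \<longleftrightarrow>
     (\<forall>(x, B) \<in> flags P Bs. \<forall>(y, C) \<in> flags P Bs. \<exists>g\<in>G. g x = y \<and> g ` B = C)"

section \<open>Groups\<close>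

definition minimal_normal :: "'a set \<Rightarrow> ('a, 'b) monoid_scheme \<Rightarrow> bool" where
  "minimal_normal N G \<longleftrightarrow>
     N \<lhd> G \<and> N \<noteq> {\<one>\<^bsub>G\<^esub>} \<and> (\<forall>M. M \<lhd> G \<and> M \<subseteq> N \<longrightarrow> M = {\<one>\<^bsub>G\<^esub>} \<or> M = N)"

definition socle :: "('a, 'b) monoid_scheme \<Rightarrow> 'a set" where
  "socle G = generate G (\<Union>{N. minimal_normal N G})"

definition group_centre :: "('a, 'b) monoid_scheme \<Rightarrow> 'a set" where
  "group_centre G = {z \<in> carrier G. \<forall>g \<in> carrier G. z \<otimes>\<^bsub>G\<^esub> g = g \<otimes>\<^bsub>G\<^esub> z}"

definition SL :: "('k::field ^ 'n ^ 'n) monoid" where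
  "SL = \<lparr>carrier = {A. det A = 1}, mult = (**), one = mat 1\<rparr>"

definition PSL :: "('k::field ^ 'n ^ 'n) set monoid" where
  "PSL = SL Mod group_centre SL"

text \<open>
  The index of \<open>dihedral n\<close> is the order of the group, an even number \<open>n = 2 * m\<close>. The pair
  \<open>(i, s)\<close> stands for \<open>a ^ i * b ^ (if s then 1 else 0)\<close>, where the rotation \<open>a\<close> has order \<open>m\<close>,
  \<open>b\<close> is an involution, and \<open>b * a * b\<close> is the inverse of \<open>a\<close>.
\<close>

definition dihedral :: "nat \<Rightarrow> (int \<times> bool) monoid" where
  "dihedral n =
     \<lparr>carrier = {0..<int (n div 2)} \<times> UNIV,
      mult = (\<lambda>(i, s) (j, t). ((if s then i - j else i + j) mod int (n div 2), s \<noteq> t)),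
      one = (0, False)\<rparr>"

section \<open>The structures defined above are groups\<close>

lemma group_design_aut:
  assumes "\<Union>Bs \<subseteq> P"
  shows "group (design_aut P Bs)"
proof -
  interpret B: group "BijGroup P" by (rule group_BijGroup)
  let ?A = "{g \<in> Bij P. (\<lambda>B. g ` B) ` Bs = Bs}"
  have car: "carrier (BijGroup P) = Bij P"
    by (simp add: BijGroup_def)
  have mult: "g \<otimes>\<^bsub>BijGroup P\<^esub> h = compose P g h" if "g \<in> Bij P" "h \<in> Bij P" for g h
    using that by (simp add: BijGroup_def)
  have sub: "B \<subseteq> P" if "B \<in> Bs" for B
    using that assms by blast
  have img: "compose P g h ` B = g ` (h ` B)" if "B \<in> Bs" for g h :: "'a \<Rightarrow> 'a" and B
    unfolding image_image using sub[OF that] by (intro image_cong) (auto simp: compose_eq)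
  have comp: "(\<lambda>B. compose P g h ` B) ` Bs = (\<lambda>B. g ` B) ` ((\<lambda>B. h ` B) ` Bs)"
    for g h :: "'a \<Rightarrow> 'a"
  proof -
    have "(\<lambda>B. compose P g h ` B) ` Bs = (\<lambda>B. g ` (h ` B)) ` Bs"
      by (rule image_cong) (simp_all only: img)
    then show ?thesis
      by (simp only: image_image[of "\<lambda>B. g ` B" "\<lambda>B. h ` B" Bs])
  qed
  have one: "(\<lambda>B. (\<lambda>x\<in>P. x) ` B) ` Bs = Bs"
  proof -
    have "(\<lambda>x\<in>P. x) ` B = B" if "B \<in> Bs" for B
      using image_cong[of B B "\<lambda>x\<in>P. x" "\<lambda>x. x"] sub[OF that] by (simp add: subset_iff)
    then show ?thesis by (simp cong: image_cong)
  qed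
  have "subgroup ?A (BijGroup P)"
  proof (rule B.subgroupI)
    show "?A \<subseteq> carrier (BijGroup P)" by (auto simp: car)
    show "?A \<noteq> {}" using one id_Bij by blast
  next
    fix g assume g: "g \<in> ?A"
    let ?h = "inv\<^bsub>BijGroup P\<^esub> g"
    have gc: "g \<in> carrier (BijGroup P)" using g by (simp add: car)
    have hB: "?h \<in> Bij P" using B.inv_closed[OF gc] by (simp only: car)
    have gB: "g \<in> Bij P" using g by simp
    have "compose P ?h g = (\<lambda>x\<in>P. x)"
      using B.l_inv[OF gc] unfolding mult[OF hB gB] by (simp only: BijGroup_def monoid.simps)
    moreover have "(\<lambda>B. g ` B) ` Bs = Bs" using g by simp
    ultimately have "(\<lambda>B. ?h ` B) ` Bs = Bs"
      using comp[of ?h g] one by (simp only:)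
    with hB show "?h \<in> ?A" by (simp only: mem_Collect_eq simp_thms)
  next
    fix g h assume "g \<in> ?A" "h \<in> ?A"
    then have "compose P g h \<in> ?A" and gh: "g \<in> Bij P" "h \<in> Bij P"
      using comp[of g h] by (simp_all add: compose_Bij)
    moreover have "g \<otimes>\<^bsub>BijGroup P\<^esub> h = compose P g h"
      using gh by (rule mult)
    ultimately show "g \<otimes>\<^bsub>BijGroup P\<^esub> h \<in> ?A" by (simp only:)
  qed
  then show ?thesis
    unfolding design_aut_def by (rule B.subgroup_imp_group)
qed

lemma group_SL: "group (SL :: ('k::field ^ 'n ^ 'n) monoid)"
proof (rule groupI)
  fix A :: "'k ^ 'n ^ 'n" assume "A \<in> carrier SL"
  hence A: "det A = 1" by (simp add: SL_def)
  then obtain A' where A': "A' ** A = mat 1"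
    using invertible_det_nz[of A] unfolding invertible_def by auto
  hence "det A' * det A = 1" by (metis det_I det_mul)
  with A A' show "\<exists>B\<in>carrier SL. B \<otimes>\<^bsub>SL\<^esub> A = \<one>\<^bsub>SL\<^esub>"
    by (auto simp: SL_def)
qed (auto simp: SL_def det_mul matrix_mul_assoc)

lemma (in group) group_centre_normal: "group_centre G \<lhd> G"
proof -
  have sub: "subgroup (group_centre G) G"
  proof (rule subgroupI)
    fix z assume "z \<in> group_centre G"
    hence z: "z \<in> carrier G" "\<And>g. g \<in> carrier G \<Longrightarrow> z \<otimes> g = g \<otimes> z"
      by (auto simp: group_centre_def)
    have "inv z \<otimes> g = g \<otimes> inv z" if g: "g \<in> carrier G" for g
    proof -
      have "inv z \<otimes> g = inv (inv g \<otimes> z)" using z(1) g by (simp add: inv_mult_group)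
      also have "\<dots> = inv (z \<otimes> inv g)" using z g by simp
      also have "\<dots> = g \<otimes> inv z" using z(1) g by (simp add: inv_mult_group)
      finally show ?thesis .
    qed
    with z(1) show "inv z \<in> group_centre G" by (simp add: group_centre_def)
  next
    fix y z assume "y \<in> group_centre G" "z \<in> group_centre G"
    hence yz: "y \<in> carrier G" "z \<in> carrier G"
        "\<And>g. g \<in> carrier G \<Longrightarrow> y \<otimes> g = g \<otimes> y" "\<And>g. g \<in> carrier G \<Longrightarrow> z \<otimes> g = g \<otimes> z"
      by (auto simp: group_centre_def)
    have "y \<otimes> z \<otimes> g = g \<otimes> (y \<otimes> z)" if g: "g \<in> carrier G" for g
    proof -
      have "y \<otimes> z \<otimes> g = y \<otimes> (g \<otimes> z)" using yz(1,2) yz(4)[OF g] g by (simp add: m_assoc)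
      also have "\<dots> = y \<otimes> g \<otimes> z" using yz(1,2) g by (simp add: m_assoc)
      also have "\<dots> = g \<otimes> (y \<otimes> z)" using yz(1,2) yz(3)[OF g] g by (simp add: m_assoc)
      finally show ?thesis .
    qed
    with yz(1,2) show "y \<otimes> z \<in> group_centre G" by (simp add: group_centre_def)
  qed (auto simp: group_centre_def)
  have "g \<otimes> z \<otimes> inv g \<in> group_centre G"
    if g: "g \<in> carrier G" and z: "z \<in> group_centre G" for g z
  proof -
    have "g \<otimes> z = z \<otimes> g" "z \<in> carrier G" using g z by (auto simp: group_centre_def)
    hence "g \<otimes> z \<otimes> inv g = z" using g by (simp add: m_assoc)
    with z show ?thesis by simp
  qed
  with sub show ?thesis by (simp add: normal_inv_iff)
qed

lemma group_PSL: "group (PSL :: ('k::field ^ 'n ^ 'n) set monoid)"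
  unfolding PSL_def
  by (intro normal.factorgroup_is_group group.group_centre_normal group_SL)

lemma group_dihedral:
  assumes "n \<ge> 2"
  shows "group (dihedral n)"
proof -
  define m where "m = int (n div 2)"
  have m: "m > 0" using assms by (simp add: m_def)
  define f where "f = (\<lambda>(i :: int, s) (j, t). ((if s then i - j else i + j) mod m, s \<noteq> t))"
  have D: "dihedral n = \<lparr>carrier = {0..<m} \<times> UNIV, mult = f, one = (0, False)\<rparr>"
    by (simp only: dihedral_def m_def f_def)
  have f: "f (i, s) (j, t) = ((if s then i - j else i + j) mod m, s \<noteq> t)" for i s j t
    by (simp add: f_def)
  have assoc: "f (f x y) z = f x (f y z)" for x y z
  proof -
    obtain i s j t k u where "x = (i, s)" "y = (j, t)" "z = (k, u)"
      by (metis surj_pair)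
    then show ?thesis
      by (cases s; cases t)
         (simp_all add: f mod_diff_left_eq mod_diff_right_eq mod_add_left_eq mod_add_right_eq
           add.assoc diff_diff_eq diff_diff_eq2 add_diff_eq diff_add_eq)
  qed
  show ?thesis
    unfolding D
  proof (rule groupI; simp only: partial_object.simps monoid.simps)
    fix x y :: "int \<times> bool"
    show "f x y \<in> {0..<m} \<times> UNIV"
      using m by (cases x; cases y) (simp add: f)
  next
    show "(0, False) \<in> {0..<m} \<times> UNIV" using m by simp
  next
    fix x y z :: "int \<times> bool"
    show "f (f x y) z = f x (f y z)" by (rule assoc)
  next
    fix x :: "int \<times> bool" assume x: "x \<in> {0..<m} \<times> UNIV"
    then show "f (0, False) x = x" by (cases x) (simp add: f)
    obtain i s where xis: "x = (i, s)" by (cases x)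
    have "f (if s then x else ((- i) mod m, False)) x = (0, False)"
      by (simp add: xis f mod_add_left_eq)
    moreover have "(if s then x else ((- i) mod m, False)) \<in> {0..<m} \<times> UNIV"
      using x m by simp
    ultimately show "\<exists>y\<in>{0..<m} \<times> UNIV. f y x = (0, False)" by (rule bexI)
  qed
qed

lemma order_dihedral: "even n \<Longrightarrow> order (dihedral n) = n"
  by (auto simp: dihedral_def order_def card_cartesian_product)

end

theory Submission
  imports Defs "HOL-Number_Theory.Residues"
begin

text \<open>
  Lifting \<open>T\<close> to \<open>SL(2, q)\<close>, the stabilisers of a point and of a block become the stabilisers of
  the lines of traceless matrices \<open>e\<close> with \<open>e\<^sup>2 = \<nu>\<close>, for a nonsquare \<open>\<nu>\<close>, and \<open>h\<close> with
  \<open>h\<^sup>2 = 1\<close>. So points and blocks are such \<open>e\<close> and \<open>h\<close> up to sign, and \<open>T\<close> is transitive on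
  both. For the diagonal \<open>h\<close> the block is a union of orbits of the normaliser of the torus on
  \<open>e = (x, a; b, -x)\<close>; these are indexed by \<open>x\<^sup>2\<close>, except that the orbits of a given \<open>x \<noteq> 0\<close> with
  \<open>\<nu> - x\<^sup>2\<close> a square are distinguished by the square class of \<open>a\<close>. As there are \<open>q - 1\<close> points
  in a block, \<open>x\<^sup>2\<close> takes at most two values on it.

  Double counting shows that a block contains exactly \<open>4 (q - 1)\<close> pairs of vectors with given
  scalar product \<open>g \<noteq> \<plusminus>\<nu>\<close>, which amounts to counting the solutions \<open>\<rho>\<close> of a few equations
  \<open>\<rho> + 1 / \<rho> = 2 y\<close>. If \<open>x\<^sup>2\<close> is constant, then \<open>g = 0\<close> gives \<open>\<nu> = 2 x\<^sup>2\<close>, and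
  \<open>g = (u + 1 / u) x\<^sup>2\<close> with \<open>u\<^sup>4 \<noteq> 1\<close> gives a contradiction. If there are two values
  \<open>c\<^sub>1\<^sup>2, c\<^sub>2\<^sup>2\<close>, an element of \<open>G\<close> fixing the block exchanges them; it acts on \<open>T\<close> as a
  semilinear map, so some field automorphism exchanges \<open>c\<^sub>1\<^sup>2 / \<nu>\<close> and \<open>c\<^sub>2\<^sup>2 / \<nu>\<close>. This makes
  \<open>-1\<close> and \<open>2\<close> squares; then \<open>g = 0\<close> gives \<open>c\<^sub>1\<^sup>2 + c\<^sub>2\<^sup>2 = \<nu>\<close>, and \<open>g = c\<^sub>1\<^sup>2 - c\<^sub>2\<^sup>2\<close> gives a
  contradiction.
\<close>

section \<open>Squares and automorphisms of finite fields\<close>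

text \<open>The constant \<open>4 (q - 1)\<close>: each of the \<open>q (q - 1)\<close> vectors
  \<open>e\<close> has \<open>q + 1\<close> partners at scalar product \<open>g\<close>; a pair lies
  in two blocks, that is on four vectors \<open>h\<close>, and the \<open>q (q + 1)\<close> vectors
  \<open>h\<close> share these incidences equally. At \<open>g = \<nu>\<close> and
  \<open>g = - \<nu>\<close> a pair may name a single point, where \<open>\<lambda> = 2\<close> says
  nothing. On one block every summand counts roots of a reciprocal quadratic among the nonzero
  elements, the squares or a coset of these: it is 0 or 2, and 1 only at a double root. At
  \<open>g = 0\<close> symmetry forces a count of 1, which pins an argument to \<open>1\<close> or
  \<open>-1\<close> and so yields an equation. Automorphisms of \<open>PSL(2, q)\<close> have a
  diagonal and a field part. The ratio \<open>x\<^sup>2 / \<nu>\<close> ignores rescaling of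
  \<open>e\<close> and conjugation by diagonal matrices, so only the field part acts on it. If
  \<tau> exchanges two such ratios, it negates their difference, and then all nonzero elements fixed
  by \<tau>, \<open>-1\<close> and \<open>2\<close> among them, are squares.\<close>

lemma card_eq_card_fibre_times_image:
  assumes "finite A" and "\<And>y. y \<in> f ` A \<Longrightarrow> card {x \<in> A. f x = y} = n"
  shows "card A = n * card (f ` A)"
proof -
  have "card A = (\<Sum>y\<in>f ` A. card {x \<in> A. f x = y})"
    using sum.image_gen[OF assms(1), of "\<lambda>_. 1::nat" f] by simp
  then show ?thesis using assms(2) by simp
qed

lemma self_eq_uminus:
  assumes "(2::'k::field) \<noteq> 0"
  shows "(a :: 'k) = - a \<longleftrightarrow> a = 0" "- a = a \<longleftrightarrow> a = 0"
  using assms by (metis add.right_inverse mult_2 mult_eq_0_iff neg_0_equal_iff_equal)+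

lemma card_squares_subgroup:
  fixes S :: "'k::field set"
  assumes two: "(2::'k) \<noteq> 0" and fin: "finite S" and S0: "0 \<notin> S"
    and neg: "\<And>x. x \<in> S \<Longrightarrow> -x \<in> S"
  shows "card S = 2 * card ((\<lambda>x. x\<^sup>2) ` S)"
proof (rule card_eq_card_fibre_times_image[OF fin])
  fix y assume "y \<in> (\<lambda>x. x\<^sup>2) ` S"
  then obtain x where x: "x \<in> S" "y = x\<^sup>2" by auto
  have "{z \<in> S. z\<^sup>2 = y} = {x, -x}"
    using x neg by (auto simp: power2_eq_iff)
  moreover have "x \<noteq> -x" using x S0 self_eq_uminus[OF two] by metis
  ultimately show "card {z \<in> S. z\<^sup>2 = y} = 2" by simp
qed

text \<open>\<open>S\<close> is a finite multiplicative group containing \<open>-1\<close>, so its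
  squares have index two and the coset of \<open>a\<close> is all the rest. It is a subset, not a
  type, since it will be the nonzero part of a fixed field.\<close>

lemma nonsquare_times_nonsquare_subgroup:
  fixes S :: "'k::field set"
  assumes two: "(2::'k) \<noteq> 0" and fin: "finite S" and S0: "0 \<notin> S"
    and neg: "\<And>x. x \<in> S \<Longrightarrow> -x \<in> S"
    and mult: "\<And>x y. x \<in> S \<Longrightarrow> y \<in> S \<Longrightarrow> x * y \<in> S"
    and a: "a \<in> S" "a \<notin> (\<lambda>x. x\<^sup>2) ` S" and b: "b \<in> S" "b \<notin> (\<lambda>x. x\<^sup>2) ` S"
    and div: "\<And>x y. x \<in> S \<Longrightarrow> y \<in> S \<Longrightarrow> x / y \<in> S"
  shows "a * b \<in> (\<lambda>x. x\<^sup>2) ` S"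
proof -
  let ?Q = "(\<lambda>x. x\<^sup>2) ` S"
  let ?aQ = "(*) a ` ?Q"
  have a0: "a \<noteq> 0" using a S0 by auto
  have disj: "?Q \<inter> ?aQ = {}"
  proof -
    have False if "x \<in> S" "y \<in> S" "x\<^sup>2 = a * y\<^sup>2" for x y
    proof -
      have "a = (x / y)\<^sup>2" using that S0 by (auto simp: power_divide)
      with a(2) div[OF that(1,2)] show False by blast
    qed
    then show ?thesis by auto
  qed
  have sub: "?Q \<union> ?aQ \<subseteq> S" using mult a(1) by (auto simp: power2_eq_square)
  have "card ?aQ = card ?Q" using a0 by (intro card_image) (auto simp: inj_on_def)
  then have "card (?Q \<union> ?aQ) = card S"
    using card_squares_subgroup[OF two fin S0 neg] disj fin
    by (simp add: card_Un_disjoint)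
  then have "?Q \<union> ?aQ = S" using card_subset_eq[OF fin sub] by simp
  then obtain y where y: "y \<in> S" "b = a * y\<^sup>2" using b by auto
  then have "a * b = (a * y)\<^sup>2" by (simp add: power2_eq_square)
  with mult[OF a(1) y(1)] show ?thesis by blast
qed

definition nzsq :: "'k::field set" where
  "nzsq = {x\<^sup>2 | x. x \<noteq> 0}"

lemma nzsq_image: "nzsq = (\<lambda>x. x\<^sup>2) ` (- {0})"
  by (auto simp: nzsq_def)

lemma zero_notin_nzsq [simp]: "0 \<notin> nzsq"
  by (auto simp: nzsq_def)

lemma nzsqI: "a = x\<^sup>2 \<Longrightarrow> a \<noteq> 0 \<Longrightarrow> a \<in> nzsq"
  by (auto simp: nzsq_def)

lemma one_in_nzsq [simp]: "1 \<in> nzsq"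
  by (rule nzsqI[of _ 1]) auto

lemma nzsq_mult: "a \<in> nzsq \<Longrightarrow> b \<in> nzsq \<Longrightarrow> a * b \<in> nzsq"
  unfolding nzsq_def by (auto simp: power_mult_distrib[symmetric])

lemma nzsq_inverse: "a \<in> nzsq \<Longrightarrow> inverse a \<in> nzsq"
  unfolding nzsq_def by (auto simp: power_inverse[symmetric])

lemma nzsq_divide: "a \<in> nzsq \<Longrightarrow> b \<in> nzsq \<Longrightarrow> a / b \<in> nzsq"
  by (simp add: divide_inverse nzsq_mult nzsq_inverse)

lemma square_in_nzsq: "x \<noteq> 0 \<Longrightarrow> x\<^sup>2 \<in> nzsq"
  by (rule nzsqI) auto

lemma nzsq_mult_iff: "a \<in> nzsq \<Longrightarrow> a * b \<in> nzsq \<longleftrightarrow> b \<in> nzsq"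
  by (metis nzsq_mult nzsq_divide zero_notin_nzsq nonzero_mult_div_cancel_left)

lemma card_nonzero: "card (- {0 :: 'k::{field,finite}}) = CARD('k) - 1"
  by (simp add: Compl_eq_Diff_UNIV card_Diff_subset)

lemma card_nzsq:
  assumes "(2::'k::{field,finite}) \<noteq> 0"
  shows "2 * card (nzsq :: 'k set) = CARD('k) - 1"
  using card_squares_subgroup[of "- {0::'k}"] assms
  by (simp add: nzsq_image card_nonzero)

text \<open>Pigeonhole: \<open>\<alpha> * x\<^sup>2\<close> and
  \<open>\<gamma> - \<beta> * y\<^sup>2\<close> each take \<open>(q + 1) / 2\<close> values, too
  many to be disjoint.\<close>

lemma binary_form_universal:
  fixes \<alpha> \<beta> \<gamma> :: "'k::{field,finite}"
  assumes two: "(2::'k) \<noteq> 0" and nz: "\<alpha> \<noteq> 0" "\<beta> \<noteq> 0"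
  obtains x y where "\<alpha> * x\<^sup>2 + \<beta> * y\<^sup>2 = \<gamma>"
proof -
  let ?R = "range (\<lambda>x::'k. x\<^sup>2)"
  have "?R = insert 0 nzsq" by (auto simp: nzsq_def)
  then have R: "card ?R = Suc (card (nzsq :: 'k set))" by simp
  have q: "CARD('k) \<ge> 1" by (simp add: Suc_leI)
  have c: "2 * card ?R = CARD('k) + 1" using card_nzsq[OF two] R q by simp
  let ?A = "(*) \<alpha> ` ?R" and ?B = "(\<lambda>t. \<gamma> - \<beta> * t) ` ?R"
  have "card ?A = card ?R" "card ?B = card ?R"
    using nz by (auto intro!: card_image simp: inj_on_def)
  then have "card ?A + card ?B > CARD('k)" using c by simp
  moreover have "card (?A \<union> ?B) \<le> CARD('k)" by (rule card_mono) auto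
  ultimately have "?A \<inter> ?B \<noteq> {}"
    using card_Un_disjoint[of ?A ?B] by auto
  then obtain x y where "\<alpha> * x\<^sup>2 = \<gamma> - \<beta> * y\<^sup>2" by auto
  then have "\<alpha> * x\<^sup>2 + \<beta> * y\<^sup>2 = \<gamma>" by simp
  then show ?thesis by (rule that)
qed

text \<open>Injectivity is automatic, see \<open>field_aut_inj\<close>, and over a finite field it
  gives surjectivity, so this does describe automorphisms.\<close>

definition field_aut :: "('k::field \<Rightarrow> 'k) \<Rightarrow> bool" where
  "field_aut \<tau> \<longleftrightarrow> (\<forall>x y. \<tau> (x + y) = \<tau> x + \<tau> y) \<and> (\<forall>x y. \<tau> (x * y) = \<tau> x * \<tau> y) \<and> \<tau> 1 = 1"

context
  fixes \<tau> :: "'k::field \<Rightarrow> 'k"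
  assumes \<tau>: "field_aut \<tau>"
begin

lemma field_aut_add: "\<tau> (x + y) = \<tau> x + \<tau> y"
  and field_aut_mult: "\<tau> (x * y) = \<tau> x * \<tau> y"
  and field_aut_one: "\<tau> 1 = 1"
  using \<tau> by (auto simp: field_aut_def)

lemma field_aut_zero: "\<tau> 0 = 0"
  using field_aut_add[of 0 0] add_left_cancel[of "\<tau> 0" 0 "\<tau> 0"] by simp

lemma field_aut_uminus: "\<tau> (-x) = - \<tau> x"
  using field_aut_add[of x "-x"] field_aut_zero by (simp add: eq_neg_iff_add_eq_0 add.commute)

lemma field_aut_diff: "\<tau> (x - y) = \<tau> x - \<tau> y"
  using field_aut_add[of x "-y"] by (simp add: field_aut_uminus)

lemma field_aut_power: "\<tau> (x ^ n) = \<tau> x ^ n"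
  by (induction n) (auto simp: field_aut_one field_aut_mult)

lemma field_aut_nonzero: "x \<noteq> 0 \<Longrightarrow> \<tau> x \<noteq> 0"
  using field_aut_mult[of x "inverse x"] field_aut_one by auto

lemma field_aut_divide: "\<tau> (x / y) = \<tau> x / \<tau> y"
proof (cases "y = 0")
  case False
  then show ?thesis using field_aut_mult[of "x / y" y] field_aut_nonzero[OF False]
    by (simp add: field_simps)
qed (simp add: field_aut_zero)

lemma field_aut_inj: "\<tau> x = \<tau> y \<longleftrightarrow> x = y"
  using field_aut_nonzero[of "x - y"] by (auto simp: field_aut_diff)

end

text \<open>
  If \<open>\<tau> u = - u\<close>, then \<open>u\<^sup>2\<close> is a nonsquare of the fixed field of \<open>\<tau>\<close>, so each
  element of the fixed field becomes a square after adjoining \<open>u\<close>.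
\<close>
lemma fixed_by_field_aut_square:
  fixes u a :: "'k::{field,finite}"
  assumes two: "(2::'k) \<noteq> 0" and \<tau>: "field_aut \<tau>"
    and u: "u \<noteq> 0" "\<tau> u = - u" and a: "\<tau> a = a" "a \<noteq> 0"
  shows "a \<in> nzsq"
proof (cases "a \<in> (\<lambda>x. x\<^sup>2) ` {x. \<tau> x = x \<and> x \<noteq> 0}")
  case True
  then show ?thesis by (auto simp: nzsq_def)
next
  case False
  let ?S = "{x. \<tau> x = x \<and> x \<noteq> 0}"
  have w: "u\<^sup>2 \<in> ?S" using u by (simp add: field_aut_power[OF \<tau>])
  have w': "u\<^sup>2 \<notin> (\<lambda>x. x\<^sup>2) ` ?S"
  proof
    assume "u\<^sup>2 \<in> (\<lambda>x. x\<^sup>2) ` ?S"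
    then obtain x where "\<tau> x = x" "u = x \<or> u = -x" by (auto simp: power2_eq_iff)
    then have "\<tau> u = u" by (auto simp: field_aut_uminus[OF \<tau>])
    with u self_eq_uminus[OF two] show False by metis
  qed
  have "a * u\<^sup>2 \<in> (\<lambda>x. x\<^sup>2) ` ?S"
    using False a w w'
    by (intro nonsquare_times_nonsquare_subgroup[OF two])
       (auto simp: field_aut_uminus[OF \<tau>] field_aut_mult[OF \<tau>] field_aut_divide[OF \<tau>])
  then have "a * u\<^sup>2 \<in> nzsq" by (auto simp: nzsq_def)
  then show ?thesis using nzsq_mult_iff[OF square_in_nzsq[OF u(1)]] by (simp add: mult.commute)
qed

section \<open>Equations between sums of reciprocal pairs\<close>

lemma four_neq_zero:
  assumes "(2::'k::field) \<noteq> 0"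
  shows "(4::'k) \<noteq> 0"
proof -
  have "(4::'k) = 2 * 2" by simp
  with assms show ?thesis by (metis mult_eq_0_iff)
qed

text \<open>The quadratic is \<open>\<rho>\<^sup>2 - 2 * y * \<rho> + 1\<close>, of discriminant
  \<open>4 * (y\<^sup>2 - 1)\<close>; the factor 2 puts the double roots at \<open>y = 1\<close> and
  \<open>y = -1\<close>.\<close>

definition rcount :: "'k::field set \<Rightarrow> 'k \<Rightarrow> nat" where
  "rcount C y = card {\<rho> \<in> C. \<rho> + 1 / \<rho> = 2 * y}"

lemma plus_inverse_eq_iff:
  fixes \<rho> \<sigma> :: "'k::field"
  assumes "\<rho> \<noteq> 0" "\<sigma> \<noteq> 0"
  shows "\<sigma> + 1 / \<sigma> = \<rho> + 1 / \<rho> \<longleftrightarrow> \<sigma> = \<rho> \<or> \<sigma> = 1 / \<rho>"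
proof -
  have "\<sigma> + 1 / \<sigma> = \<rho> + 1 / \<rho> \<longleftrightarrow> (\<sigma> - \<rho>) * (\<sigma> * \<rho> - 1) = 0"
  proof -
    have "(\<sigma> + 1 / \<sigma> - (\<rho> + 1 / \<rho>)) * (\<sigma> * \<rho>) = (\<sigma> - \<rho>) * (\<sigma> * \<rho> - 1)"
      using assms by (simp add: field_simps)
    then show ?thesis using assms by (metis eq_iff_diff_eq_0 mult_eq_0_iff)
  qed
  moreover have "\<sigma> * \<rho> - 1 = 0 \<longleftrightarrow> \<sigma> = 1 / \<rho>"
    using assms by (simp add: nonzero_eq_divide_eq)
  ultimately show ?thesis by simp
qed

lemma plus_inverse_eq_two_iff:
  fixes \<rho> :: "'k::field"
  assumes "\<rho> \<noteq> 0"
  shows "\<rho> + 1 / \<rho> = 2 \<longleftrightarrow> \<rho> = 1" and "\<rho> + 1 / \<rho> = -2 \<longleftrightarrow> \<rho> = -1"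
  using plus_inverse_eq_iff[of 1 \<rho>] plus_inverse_eq_iff[of "-1" \<rho>] assms by auto

lemma rcount_one:
  assumes "1 \<in> C" "0 \<notin> C"
  shows "rcount C 1 = 1"
proof -
  have "{\<rho> \<in> C. \<rho> + 1 / \<rho> = 2 * 1} = {1}"
  proof (rule Set.set_eqI)
    fix \<rho> show "\<rho> \<in> {\<rho> \<in> C. \<rho> + 1 / \<rho> = 2 * 1} \<longleftrightarrow> \<rho> \<in> {1}"
      using assms plus_inverse_eq_two_iff(1)[of \<rho>] by (cases "\<rho> = 0") auto
  qed
  then show ?thesis by (simp add: rcount_def)
qed

lemma rcount_minus:
  assumes "\<And>x. x \<in> C \<Longrightarrow> - x \<in> C"
  shows "rcount C (- y) = rcount C y"
proof -
  have "bij_betw uminus {\<rho> \<in> C. \<rho> + 1 / \<rho> = 2 * (- y)} {\<rho> \<in> C. \<rho> + 1 / \<rho> = 2 * y}"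
  proof (rule bij_betwI[of _ _ _ uminus])
    have neg: "- \<rho> + 1 / - \<rho> = - (\<rho> + 1 / \<rho>)" for \<rho> :: 'a by simp
    show "uminus \<in> {\<rho> \<in> C. \<rho> + 1 / \<rho> = 2 * (- y)} \<rightarrow> {\<rho> \<in> C. \<rho> + 1 / \<rho> = 2 * y}"
      "uminus \<in> {\<rho> \<in> C. \<rho> + 1 / \<rho> = 2 * y} \<rightarrow> {\<rho> \<in> C. \<rho> + 1 / \<rho> = 2 * (- y)}"
      using assms unfolding Pi_def mem_Collect_eq neg by simp_all
  qed simp_all
  then show ?thesis by (simp add: rcount_def bij_betw_same_card)
qed

text \<open>The two roots are inverse to each other, so \<open>C\<close> contains both or neither,
  and a root equal to its inverse is \<open>1\<close> or \<open>-1\<close>.\<close>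

lemma rcount_alternatives:
  fixes y :: "'k::field"
  assumes two: "(2::'k) \<noteq> 0" and inv: "\<And>x. x \<in> C \<Longrightarrow> 1 / x \<in> C" and "0 \<notin> C"
    and y: "y \<noteq> 1" "y \<noteq> -1"
  shows "rcount C y = (if \<exists>\<rho>\<in>C. \<rho> + 1 / \<rho> = 2 * y then 2 else 0)"
proof (cases "\<exists>\<rho>\<in>C. \<rho> + 1 / \<rho> = 2 * y")
  case True
  then obtain \<rho> where \<rho>: "\<rho> \<in> C" "\<rho> + 1 / \<rho> = 2 * y" by blast
  then have \<rho>0: "\<rho> \<noteq> 0" using assms by auto
  have "{\<sigma> \<in> C. \<sigma> + 1 / \<sigma> = 2 * y} = {\<rho>, 1 / \<rho>}"
  proof (rule Set.set_eqI)
    fix \<sigma> show "\<sigma> \<in> {\<sigma> \<in> C. \<sigma> + 1 / \<sigma> = 2 * y} \<longleftrightarrow> \<sigma> \<in> {\<rho>, 1 / \<rho>}"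
    proof (cases "\<sigma> \<in> C")
      case True
      then show ?thesis using \<rho> \<rho>0 plus_inverse_eq_iff[of \<rho> \<sigma>] \<open>0 \<notin> C\<close> by auto
    next
      case False
      then show ?thesis using \<rho> inv by auto
    qed
  qed
  moreover have "\<rho> \<noteq> 1 / \<rho>"
  proof
    assume "\<rho> = 1 / \<rho>"
    then have "\<rho>\<^sup>2 = 1" using \<rho>0 by (simp add: power2_eq_square field_simps)
    then have "\<rho> = 1 \<or> \<rho> = -1" using power2_eq_iff[of \<rho> 1] by simp
    then have "2 * y = 2 * 1 \<or> 2 * y = 2 * (-1)" using \<rho>(2) by auto
    then show False using y two by (simp only: mult_cancel_left) blast
  qed
  ultimately have "rcount C y = 2" by (simp add: rcount_def)
  then show ?thesis using True by simp
next
  case False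
  then have "{\<rho> \<in> C. \<rho> + 1 / \<rho> = 2 * y} = {}" by blast
  then have "rcount C y = 0" unfolding rcount_def by (metis card.empty)
  then show ?thesis using False by simp
qed

text \<open>Converts counting into algebra: a count of one can only come from a double root.\<close>

lemma rcount_eq_oneD:
  fixes y :: "'k::field"
  assumes two: "(2::'k) \<noteq> 0" and inv: "\<And>x. x \<in> C \<Longrightarrow> 1 / x \<in> C" and C0: "0 \<notin> C"
    and one: "rcount C y = 1"
  shows "y = 1 \<or> y = -1"
proof (rule ccontr)
  assume "\<not> (y = 1 \<or> y = -1)"
  then have "rcount C y = (if \<exists>\<rho>\<in>C. \<rho> + 1 / \<rho> = 2 * y then 2 else 0)"
    using rcount_alternatives[OF two inv C0] by blast
  then show False unfolding one by (simp split: if_splits)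
qed

lemma rcount_nonzero:
  fixes y :: "'k::field"
  assumes two: "(2::'k) \<noteq> 0" and y: "y \<noteq> 1" "y \<noteq> -1"
  shows "rcount (- {0}) y = (if y\<^sup>2 - 1 \<in> nzsq then 2 else 0)"
proof -
  have "(\<exists>\<rho>\<in>- {0}. \<rho> + 1 / \<rho> = 2 * y) \<longleftrightarrow> y\<^sup>2 - 1 \<in> nzsq"
  proof
    assume "\<exists>\<rho>\<in>- {0}. \<rho> + 1 / \<rho> = 2 * y"
    then obtain \<rho> where \<rho>: "\<rho> \<noteq> 0" "\<rho> + 1 / \<rho> = 2 * y" by auto
    have "\<rho> * (2 * y) = \<rho>\<^sup>2 + 1" using \<rho>(1) unfolding \<rho>(2)[symmetric] by (simp add: field_simps power2_eq_square)
    then have "y\<^sup>2 - 1 = (\<rho> - y)\<^sup>2" by (simp add: power2_eq_square algebra_simps)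
    moreover have "y\<^sup>2 - 1 \<noteq> 0" using y power2_eq_iff[of y 1] by auto
    ultimately show "y\<^sup>2 - 1 \<in> nzsq" by (rule nzsqI)
  next
    assume "y\<^sup>2 - 1 \<in> nzsq"
    then obtain r where r: "y\<^sup>2 - 1 = r\<^sup>2" by (auto simp: nzsq_def)
    have e: "(y + r) * (y - r) = 1" using r by (simp add: algebra_simps power2_eq_square)
    then have nz: "y + r \<noteq> 0" by auto
    with e have "1 / (y + r) = y - r" by (simp add: field_simps)
    with nz show "\<exists>\<rho>\<in>- {0}. \<rho> + 1 / \<rho> = 2 * y" by (intro bexI[of _ "y + r"]) auto
  qed
  then show ?thesis using rcount_alternatives[OF two _ _ y, of "- {0}"] by auto
qed

text \<open>For \<open>\<rho> = \<theta>\<^sup>2\<close> the two quantities are the squares of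
  \<open>\<theta> + 1 / \<theta>\<close> and \<open>\<theta> - 1 / \<theta>\<close>, from which
  \<theta> can be recovered.\<close>

lemma rcount_nzsq:
  fixes y :: "'k::field"
  assumes two: "(2::'k) \<noteq> 0" and y: "y \<noteq> 1" "y \<noteq> -1"
  shows "rcount nzsq y = (if 2 * (y + 1) \<in> nzsq \<and> 2 * (y - 1) \<in> nzsq then 2 else 0)"
proof -
  have "(\<exists>\<rho>\<in>nzsq. \<rho> + 1 / \<rho> = 2 * y) \<longleftrightarrow> 2 * (y + 1) \<in> nzsq \<and> 2 * (y - 1) \<in> nzsq"
  proof
    assume "\<exists>\<rho>\<in>nzsq. \<rho> + 1 / \<rho> = 2 * y"
    then obtain \<theta> where \<theta>: "\<theta> \<noteq> 0" "\<theta>\<^sup>2 + 1 / \<theta>\<^sup>2 = 2 * y" by (auto simp: nzsq_def)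
    have "2 * (y + 1) = (\<theta> + 1 / \<theta>)\<^sup>2" "2 * (y - 1) = (\<theta> - 1 / \<theta>)\<^sup>2"
      using \<theta>(1) unfolding distrib_left right_diff_distrib \<theta>(2)[symmetric]
      by (simp_all add: power2_eq_square field_simps)
    moreover have "2 * (y + 1) \<noteq> 0" "2 * (y - 1) \<noteq> 0"
      using two y unfolding mult_eq_0_iff eq_neg_iff_add_eq_0 by simp_all
    ultimately show "2 * (y + 1) \<in> nzsq \<and> 2 * (y - 1) \<in> nzsq" by (metis nzsqI)
  next
    assume "2 * (y + 1) \<in> nzsq \<and> 2 * (y - 1) \<in> nzsq"
    then obtain s r where s: "2 * (y + 1) = s\<^sup>2" and r: "2 * (y - 1) = r\<^sup>2" by (auto simp: nzsq_def)
    \<comment> \<open>\<open>s\<close> and \<open>r\<close> stand for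
      \<open>\<theta> + 1 / \<theta>\<close> and \<open>\<theta> - 1 / \<theta>\<close>; half their
      sum and half their difference are inverse because
      \<open>s\<^sup>2 - r\<^sup>2 = 4\<close>.\<close>
    let ?\<theta> = "(s + r) / 2" and ?\<eta> = "(s - r) / 2"
    have d: "(s + r) * (s - r) = 2 * 2"
      using arg_cong2[OF s r, of "(-)"] by (simp add: algebra_simps power2_eq_square)
    have e: "?\<theta> * ?\<eta> = 1" unfolding times_divide_times_eq d using four_neq_zero[OF two] by simp
    then have nz: "?\<theta> \<noteq> 0" by (metis mult_zero_left zero_neq_one)
    have "?\<eta> = 1 / ?\<theta>" using e nz by (metis nonzero_eq_divide_eq mult.commute)
    then have "1 / ?\<theta>\<^sup>2 = ?\<eta>\<^sup>2" by (simp only: power_divide power_one)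
    moreover have "?\<theta>\<^sup>2 + ?\<eta>\<^sup>2 = 2 * y"
    proof -
      have "2 * 2 * (?\<theta>\<^sup>2 + ?\<eta>\<^sup>2) = 2 * (s\<^sup>2 + r\<^sup>2)"
        using two four_neq_zero[OF two] by (simp add: power_divide distrib_left) (simp add: power2_eq_square algebra_simps)
      also have "\<dots> = 2 * 2 * (2 * y)" unfolding s[symmetric] r[symmetric] by (simp add: algebra_simps)
      finally show ?thesis using four_neq_zero[OF two] by (simp only: mult_cancel_left) simp
    qed
    ultimately show "\<exists>\<rho>\<in>nzsq. \<rho> + 1 / \<rho> = 2 * y"
      using square_in_nzsq[OF nz] by (intro bexI[of _ "?\<theta>\<^sup>2"]) auto
  qed
  then show ?thesis
    using rcount_alternatives[OF two nzsq_divide[OF one_in_nzsq] zero_notin_nzsq y] by simp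
qed

text \<open>
  A triple \<open>(x, a, b)\<close> stands for the traceless matrix with rows \<open>(x, a)\<close> and \<open>(b, -x)\<close> and
  \<open>bil\<close> for half the trace of the product.
\<close>

type_synonym 'k triple = "'k \<times> 'k \<times> 'k"

fun bil :: "'k::field triple \<Rightarrow> 'k triple \<Rightarrow> 'k" where
  "bil (x, a, b) (x', a', b') = x * x' + (a * b' + b * a') / 2"

text \<open>For each \<open>x\<close> the entry \<open>a\<close> runs through the coset
  \<open>\<kappa> x * C\<close>, and \<open>b\<close> is forced by
  \<open>x\<^sup>2 + a * b = \<nu>\<close>. For nonsquare \<nu>, a stratum with
  \<open>C = nzsq\<close> is one orbit of the diagonal torus, and with \<open>C = - {0}\<close> it
  is every vector of norm \<nu> with that \<open>x\<close>.\<close>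

definition strata :: "'k::field \<Rightarrow> 'k set \<Rightarrow> ('k \<Rightarrow> 'k) \<Rightarrow> 'k set \<Rightarrow> 'k triple set" where
  "strata \<nu> X \<kappa> C = {(x, \<kappa> x * u, (\<nu> - x\<^sup>2) / (\<kappa> x * u)) | x u. x \<in> X \<and> u \<in> C}"

text \<open>Writing the second coset parameter as \<open>u * \<rho>\<close> makes the scalar product
  independent of \<open>u\<close>; the free \<open>u\<close> accounts for the factor
  \<open>card C\<close>.\<close>

lemma card_pairs_strata:
  fixes \<nu> :: "'k::{field,finite}"
  assumes two: "(2::'k) \<noteq> 0"
    and \<kappa>: "\<And>x. x \<in> X \<Longrightarrow> \<kappa> x \<noteq> 0" and C0: "0 \<notin> C"
    and mult: "\<And>u v. u \<in> C \<Longrightarrow> v \<in> C \<Longrightarrow> u * v \<in> C"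
    and div: "\<And>u v. u \<in> C \<Longrightarrow> v \<in> C \<Longrightarrow> u / v \<in> C"
  shows "card {(v, w). v \<in> strata \<nu> X \<kappa> C \<and> w \<in> strata \<nu> X \<kappa> C \<and> bil v w = g}
       = card C * (\<Sum>x\<in>X. \<Sum>x'\<in>X. card {\<rho> \<in> C. \<kappa> x / \<kappa> x' * (\<nu> - x'\<^sup>2) / \<rho>
           + \<kappa> x' / \<kappa> x * (\<nu> - x\<^sup>2) * \<rho> = 2 * (g - x * x')})" (is "card ?L = _ * (\<Sum>x\<in>X. \<Sum>x'\<in>X. card (?R x x'))")
proof -
  let ?p = "\<lambda>x u. (x, \<kappa> x * u, (\<nu> - x\<^sup>2) / (\<kappa> x * u))"
  have form: "bil (?p x u) (?p x' (u * \<rho>)) = g \<longleftrightarrow>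
      \<kappa> x / \<kappa> x' * (\<nu> - x'\<^sup>2) / \<rho> + \<kappa> x' / \<kappa> x * (\<nu> - x\<^sup>2) * \<rho> = 2 * (g - x * x')"
    if "x \<in> X" "x' \<in> X" "u \<in> C" "\<rho> \<in> C" for x x' u \<rho>
  proof -
    have nz: "u \<noteq> 0" "\<rho> \<noteq> 0" "\<kappa> x \<noteq> 0" "\<kappa> x' \<noteq> 0" using that \<kappa> C0 by auto
    have "bil (?p x u) (?p x' (u * \<rho>)) = x * x' + (\<kappa> x / \<kappa> x' * (\<nu> - x'\<^sup>2) / \<rho> + \<kappa> x' / \<kappa> x * (\<nu> - x\<^sup>2) * \<rho>) / 2"
    proof -
      have "(\<kappa> x * u) * ((\<nu> - x'\<^sup>2) / (\<kappa> x' * (u * \<rho>))) = \<kappa> x / \<kappa> x' * (\<nu> - x'\<^sup>2) / \<rho>"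
        "(\<nu> - x\<^sup>2) / (\<kappa> x * u) * (\<kappa> x' * (u * \<rho>)) = \<kappa> x' / \<kappa> x * (\<nu> - x\<^sup>2) * \<rho>"
        using nz by (simp_all add: field_simps)
      then show ?thesis by (simp only: bil.simps)
    qed
    moreover have "z + y / 2 = g \<longleftrightarrow> y = 2 * (g - z)" for z y :: 'k
      using two by (auto simp: field_simps)
    ultimately show ?thesis by (simp only:)
  qed
  let ?m = "\<lambda>(x, x', u, \<rho>). (?p x u, ?p x' (u * \<rho>))"
  let ?S = "SIGMA x:X. SIGMA x':X. C \<times> ?R x x'"
  have inj: "inj_on ?m ?S"
  proof (rule inj_onI)
    fix s t assume st: "s \<in> ?S" "t \<in> ?S" "?m s = ?m t"
    obtain x x' u \<rho> y y' v \<sigma> where eq: "s = (x, x', u, \<rho>)" "t = (y, y', v, \<sigma>)"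
      by (metis prod_cases4)
    have xy: "x = y" "x' = y'" using st(3) by (simp_all add: eq)
    have "\<kappa> x * u = \<kappa> x * v" "\<kappa> x' * (u * \<rho>) = \<kappa> x' * (v * \<sigma>)" "x \<in> X" "x' \<in> X" "u \<noteq> 0"
      using st C0 by (auto simp: eq)
    then show "s = t" using \<kappa> by (auto simp: eq xy)
  qed
  have img: "?m ` ?S = ?L"
  proof (rule Set.set_eqI, rule iffI)
    fix z assume "z \<in> ?m ` ?S"
    then obtain x x' u \<rho> where z: "x \<in> X" "x' \<in> X" "u \<in> C" "\<rho> \<in> ?R x x'" "z = (?p x u, ?p x' (u * \<rho>))"
      by auto
    then have "bil (?p x u) (?p x' (u * \<rho>)) = g" using form[of x x' u \<rho>] by auto
    moreover have "?p x u \<in> strata \<nu> X \<kappa> C" "?p x' (u * \<rho>) \<in> strata \<nu> X \<kappa> C"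
      using z mult unfolding strata_def by blast+
    ultimately show "z \<in> ?L" using z by auto
  next
    fix z assume "z \<in> ?L"
    then obtain x u x' u' where z: "z = (?p x u, ?p x' u')" "x \<in> X" "u \<in> C" "x' \<in> X" "u' \<in> C"
      and g: "bil (?p x u) (?p x' u') = g"
      unfolding strata_def by blast
    have u: "u * (u' / u) = u'" using z C0 by auto
    have d: "u' / u \<in> C" using z div by blast
    have "u' / u \<in> ?R x x'"
      by (rule CollectI, rule conjI[OF d iffD1[OF form[OF z(2,4,3) d, unfolded u] g]])
    then have "(x, x', u, u' / u) \<in> ?S" using z(2-4) by (intro SigmaI)
    moreover have "?m (x, x', u, u' / u) = z" by (simp only: prod.case u z(1))
    ultimately show "z \<in> ?m ` ?S" by (rule rev_image_eqI[OF _ sym])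
  qed
  have "card ?L = card ?S" using card_image[OF inj] unfolding img .
  also have "\<dots> = (\<Sum>x\<in>X. \<Sum>x'\<in>X. card C * card (?R x x'))"
    by (simp add: card_cartesian_product)
  finally show ?thesis by (simp only: sum_distrib_left)
qed

section \<open>Contradictions from one and from two values of \<open>x\<^sup>2\<close>\<close>

lemma exists_fourth_power_neq_one:
  assumes q: "CARD('k::{field,finite}) > 5"
  obtains u :: "'k::{field,finite}" where "u \<noteq> 0" "u\<^sup>2 \<noteq> 1" "u\<^sup>2 \<noteq> -1"
proof -
  obtain j :: 'k where j: "{u. u\<^sup>2 = -1} \<subseteq> {j, -j}"
  proof (cases "\<exists>j::'k. j\<^sup>2 = -1")
    case True
    then obtain j :: 'k where "j\<^sup>2 = -1" ..
    then show ?thesis using power2_eq_iff[of _ j] by (intro that[of j]) auto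
  qed auto
  \<comment> \<open>Zero and the fourth roots of unity are at most five elements, so
    \<open>q > 5\<close> leaves another one.\<close>
  let ?E = "{0, 1, -1, j, -j}"
  have "card ?E \<le> 5" by (simp add: card_insert_if)
  then have "?E \<noteq> UNIV" using q by (metis not_le)
  then obtain u where u: "u \<notin> ?E" by blast
  show ?thesis
  proof (rule that[of u])
    show "u \<noteq> 0" using u by simp
    show "u\<^sup>2 \<noteq> 1" using u power2_eq_iff[of u 1] by simp
    show "u\<^sup>2 \<noteq> -1" using u j by blast
  qed
qed

text \<open>Here \<open>count\<close> is the pair count for \<open>X = {c, -c}\<close> and
  \<open>C = - {0}\<close>, divided by \<open>2 * (q - 1)\<close>.\<close>

lemma single_stratum_contradiction:
  fixes \<nu> c :: "'k::{field,finite}"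
  assumes two: "(2::'k) \<noteq> 0" and q: "CARD('k) > 5" and \<nu>: "\<nu> \<noteq> 0" and c: "c \<noteq> 0" "\<nu> \<noteq> c\<^sup>2"
    and count: "\<And>g. g\<^sup>2 \<noteq> \<nu>\<^sup>2 \<Longrightarrow>
      rcount (- {0}) ((g - c\<^sup>2) / (\<nu> - c\<^sup>2)) + rcount (- {0}) ((g + c\<^sup>2) / (\<nu> - c\<^sup>2)) = 2"
  shows False
proof -
  let ?R = "rcount (- {0::'k})" and ?d = "\<nu> - c\<^sup>2"
  have d0: "?d \<noteq> 0" using c by simp
  have "?R (- (c\<^sup>2 / ?d)) = ?R (c\<^sup>2 / ?d)" by (rule rcount_minus) auto
  then have "?R (c\<^sup>2 / ?d) = 1" using count[of 0] \<nu> by simp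
  then have "c\<^sup>2 / ?d = 1 \<or> c\<^sup>2 / ?d = -1"
    by (intro rcount_eq_oneD[OF two]) auto
  then have "c\<^sup>2 = ?d \<or> c\<^sup>2 = - ?d" using d0 by (auto simp: divide_eq_eq)
  \<comment> \<open>The other sign would mean \<open>\<nu> = 0\<close>.\<close>
  then have d: "?d = c\<^sup>2" using \<nu> by auto
  then have \<nu>2: "\<nu> = 2 * c\<^sup>2" by (simp add: algebra_simps)
  obtain u :: 'k where u: "u \<noteq> 0" "u\<^sup>2 \<noteq> 1" "u\<^sup>2 \<noteq> -1"
    using exists_fourth_power_neq_one[OF q] .
  \<comment> \<open>For \<open>g = y * c\<^sup>2\<close> the arguments become \<open>y - 1\<close>
    and \<open>y + 1\<close>, with discriminants \<open>y * (y - 2)\<close> and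
    \<open>y * (y + 2)\<close> up to squares. Their product is a square, since
    \<open>y\<^sup>2 - 4\<close> is the square of \<open>u - 1 / u\<close>; so the two counts agree
    and add up to 0 or 4, never 2.\<close>
  define y where "y = u + 1 / u"
  have y0: "y \<noteq> 0"
  proof
    assume "y = 0"
    then have "u * y = 0" by simp
    moreover have "u * y = u\<^sup>2 + 1" using u(1) by (simp add: y_def distrib_left power2_eq_square)
    ultimately show False using u(3) by (simp add: eq_neg_iff_add_eq_0)
  qed
  have um: "u - 1 / u \<noteq> 0" using u by (auto simp: field_simps power2_eq_square)
  have sq: "(y - 2) * (y + 2) = (u - 1 / u)\<^sup>2"
    using u(1) by (simp add: y_def field_simps power2_eq_square)
  then have nz: "y - 2 \<noteq> 0" "y + 2 \<noteq> 0" using um by auto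
  have "(y * c\<^sup>2)\<^sup>2 \<noteq> \<nu>\<^sup>2"
  proof
    assume "(y * c\<^sup>2)\<^sup>2 = \<nu>\<^sup>2"
    then have "y * c\<^sup>2 = 2 * c\<^sup>2 \<or> y * c\<^sup>2 = (-2) * c\<^sup>2"
      by (simp only: \<nu>2 power2_eq_iff mult_minus_left)
    then have "y = 2 \<or> y = -2" using c by (simp only: mult_cancel_right) auto
    with nz show False by auto
  qed
  from count[OF this] have sum: "?R (y - 1) + ?R (y + 1) = 2"
    using c unfolding d by (simp add: diff_divide_distrib add_divide_distrib)
  have neq: "y - 1 \<noteq> 1" "y - 1 \<noteq> -1" "y + 1 \<noteq> 1" "y + 1 \<noteq> -1"
    using nz y0 by (auto simp: algebra_simps eq_neg_iff_add_eq_0)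
  have e: "(y - 1)\<^sup>2 - 1 = y * (y - 2)" "(y + 1)\<^sup>2 - 1 = y * (y + 2)"
    by (simp_all add: power2_eq_square algebra_simps)
  have "(y * (y - 2)) * (y * (y + 2)) = (y * (u - 1 / u))\<^sup>2"
    unfolding power_mult_distrib sq[symmetric] by (simp add: power2_eq_square)
  then have "(y * (y - 2)) * (y * (y + 2)) \<in> nzsq"
    by (rule nzsqI) (use y0 nz in simp)
  then have "y * (y - 2) \<in> nzsq \<longleftrightarrow> y * (y + 2) \<in> nzsq"
    by (metis nzsq_mult_iff mult.commute)
  then show False using sum rcount_nonzero[OF two neq(1,2)] rcount_nonzero[OF two neq(3,4)]
    unfolding e by (simp split: if_splits)
qed

text \<open>In \<open>count\<close> the first four terms come from pairs with equal
  \<open>x\<^sup>2\<close>, the doubled bracket from mixed pairs in both orders; \<open>k\<close>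
  records how the cosets of \<open>a\<close> in the two strata compare.\<close>

lemma two_strata_contradiction:
  fixes \<nu> c1 c2 d1 d2 k :: "'k::{field,finite}"
  assumes two: "(2::'k) \<noteq> 0" and \<nu>: "\<nu> \<noteq> 0" "\<nu> \<notin> nzsq" and c: "c1 \<noteq> 0" "c2 \<noteq> 0" "c1\<^sup>2 \<noteq> c2\<^sup>2"
    and d: "\<nu> - c1\<^sup>2 = d1\<^sup>2" "\<nu> - c2\<^sup>2 = d2\<^sup>2" and k: "k \<noteq> 0"
    and sq: "-1 \<in> (nzsq :: 'k set)" "2 \<in> (nzsq :: 'k set)"
    and count: "\<And>g. g\<^sup>2 \<noteq> \<nu>\<^sup>2 \<Longrightarrow>
      rcount nzsq ((g - c1\<^sup>2) / d1\<^sup>2) + rcount nzsq ((g + c1\<^sup>2) / d1\<^sup>2)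
      + rcount nzsq ((g - c2\<^sup>2) / d2\<^sup>2) + rcount nzsq ((g + c2\<^sup>2) / d2\<^sup>2)
      + 2 * (rcount ((*) k ` nzsq) ((g - c1 * c2) / (d1 * d2))
           + rcount ((*) k ` nzsq) ((g + c1 * c2) / (d1 * d2))) = 4"
  shows False
proof -
  let ?R = "rcount (nzsq :: 'k set)" and ?K = "(*) k ` nzsq"
  have d0: "d1 \<noteq> 0" "d2 \<noteq> 0"
  proof -
    have "\<nu> \<noteq> c\<^sup>2" for c using \<nu> square_in_nzsq[of c] by (cases "c = 0") auto
    then show "d1 \<noteq> 0" "d2 \<noteq> 0" using d by auto
  qed
  have neg: "x \<in> nzsq \<Longrightarrow> - x \<in> nzsq" for x :: 'k
    using nzsq_mult[OF sq(1), of x] by simp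
  have Rneg: "?R (- y) = ?R y" for y by (rule rcount_minus) (rule neg)
  have negK: "x \<in> ?K \<Longrightarrow> - x \<in> ?K" for x using neg by force
  have invK: "1 / x \<in> ?K" if x: "x \<in> ?K" for x
  proof -
    obtain r where r: "r \<in> nzsq" "x = k * r" using x by blast
    have "1 / x = k * (1 / (k\<^sup>2 * r))" using k r by (simp add: power2_eq_square)
    moreover have "1 / (k\<^sup>2 * r) \<in> nzsq"
      by (intro nzsq_divide one_in_nzsq nzsq_mult square_in_nzsq r k)
    ultimately show ?thesis by blast
  qed
  have K0: "0 \<notin> ?K" using k by auto
  \<comment> \<open>A square \<open>\<rho>\<close> with \<open>\<rho> + 1 / \<rho> = 2 * y\<close> makes \<open>2 * (y + 1) = 2 * \<nu> / d\<^sup>2\<close> a square.\<close>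
  have R0: "?R (c\<^sup>2 / d\<^sup>2) = 0" if cd: "\<nu> - c\<^sup>2 = d\<^sup>2" "d \<noteq> 0" for c d
  proof -
    have "\<nu> = c\<^sup>2 + d\<^sup>2" using cd(1) by (simp add: algebra_simps)
    then have e: "2 * (c\<^sup>2 / d\<^sup>2 + 1) = (2 / d\<^sup>2) * \<nu>" using cd(2) by (simp add: field_simps)
    have "2 / d\<^sup>2 \<in> nzsq" by (intro nzsq_divide sq square_in_nzsq cd)
    then have ns: "2 * (c\<^sup>2 / d\<^sup>2 + 1) \<notin> nzsq" unfolding e using \<nu> nzsq_mult_iff by blast
    have "c\<^sup>2 / d\<^sup>2 \<noteq> 1"
    proof
      assume "c\<^sup>2 / d\<^sup>2 = 1"
      then have "2 * (c\<^sup>2 / d\<^sup>2 + 1) = 2 * 2" by simp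
      then show False using ns nzsq_mult[OF sq(2) sq(2)] by simp
    qed
    moreover have "c\<^sup>2 / d\<^sup>2 \<noteq> -1"
    proof
      assume "c\<^sup>2 / d\<^sup>2 = -1"
      then have "(2 / d\<^sup>2) * \<nu> = 0" unfolding e[symmetric] by simp
      then show False using two cd \<nu> by simp
    qed
    ultimately show ?thesis using rcount_nzsq[OF two] ns by simp
  qed
  have "?R (- (c1\<^sup>2 / d1\<^sup>2)) = 0" "?R (- (c2\<^sup>2 / d2\<^sup>2)) = 0"
    using R0[OF d(1) d0(1)] R0[OF d(2) d0(2)] by (simp_all only: Rneg)
  moreover have "rcount ?K (- (c1 * c2 / (d1 * d2))) = rcount ?K (c1 * c2 / (d1 * d2))"
    by (rule rcount_minus) (rule negK)
  ultimately have one: "rcount ?K (c1 * c2 / (d1 * d2)) = 1"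
    using count[of 0] R0[OF d(1) d0(1)] R0[OF d(2) d0(2)] \<nu> by simp
  have y1: "c1 * c2 / (d1 * d2) = 1 \<or> c1 * c2 / (d1 * d2) = -1"
    by (rule rcount_eq_oneD[OF two invK K0 one])
  \<comment> \<open>The only root counted in \<open>one\<close> is \<open>1\<close> or
    \<open>-1\<close>; as it lies in the coset of \<open>k\<close>, this coset is the group of
    squares.\<close>
  have "1 \<in> ?K"
  proof -
    have "{\<rho> \<in> ?K. \<rho> + 1 / \<rho> = 2 * (c1 * c2 / (d1 * d2))} \<noteq> {}"
      using one unfolding rcount_def by (metis card.empty zero_neq_one)
    then obtain \<rho> where \<rho>: "\<rho> \<in> ?K" "\<rho> + 1 / \<rho> = 2 * (c1 * c2 / (d1 * d2))" by blast
    then have "\<rho> + 1 / \<rho> = 2 \<or> \<rho> + 1 / \<rho> = -2"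
      using y1 by (metis mult.right_neutral mult_minus_right)
    moreover have "\<rho> \<noteq> 0" using \<rho>(1) K0 by blast
    ultimately have "\<rho> = 1 \<or> \<rho> = -1" using plus_inverse_eq_two_iff[of \<rho>] by blast
    then show ?thesis using \<rho>(1) negK by force
  qed
  then obtain s where s: "s \<in> nzsq" "k * s = 1" by auto
  then have "k = 1 / s" by (metis mult.commute mult_zero_right nonzero_eq_divide_eq zero_neq_one)
  then have "k \<in> nzsq" using nzsq_divide[OF one_in_nzsq s(1)] by simp
  then have K: "?K = nzsq"
  proof (intro Set.set_eqI iffI)
    fix x :: 'k assume "x \<in> nzsq"
    then have "x = k * (s * x)" "s * x \<in> nzsq" using s nzsq_mult by (auto simp: mult.assoc[symmetric])
    then show "x \<in> ?K" by blast
  qed (auto intro: nzsq_mult)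
  have cd: "c1 * c2 = d1 * d2 \<or> c1 * c2 = - (d1 * d2)"
    using y1 d0 by (simp add: divide_eq_eq)
  then have "(c1 * c2)\<^sup>2 = (d1 * d2)\<^sup>2" unfolding power2_eq_iff .
  then have "c1\<^sup>2 * c2\<^sup>2 = (\<nu> - c1\<^sup>2) * (\<nu> - c2\<^sup>2)" unfolding d by (simp add: power_mult_distrib)
  then have "\<nu> * (\<nu> - (c1\<^sup>2 + c2\<^sup>2)) = 0" by (simp add: algebra_simps power2_eq_square)
  then have \<nu>c: "\<nu> = c1\<^sup>2 + c2\<^sup>2" using \<nu> by simp
  have dd: "d1\<^sup>2 = c2\<^sup>2" "d2\<^sup>2 = c1\<^sup>2" using d \<nu>c by auto
  define t where "t = c1 / c2"
  have t0: "t \<noteq> 0" using c by (simp add: t_def)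
  have tt: "t\<^sup>2 \<noteq> 1" using c by (simp add: t_def power_divide)
  have tc: "c1 = t * c2" using c by (simp add: t_def)
  \<comment> \<open>With \<open>d1\<^sup>2 = c2\<^sup>2\<close> and
    \<open>d2\<^sup>2 = c1\<^sup>2\<close> this \<open>g\<close> makes two of the six arguments
    \<open>-1\<close> and \<open>1\<close>, which contribute 2 of the required 4.\<close>
  define g where "g = c1\<^sup>2 - c2\<^sup>2"
  have g: "g\<^sup>2 \<noteq> \<nu>\<^sup>2"
  proof
    assume "g\<^sup>2 = \<nu>\<^sup>2"
    then have "2 * c2\<^sup>2 = 0 \<or> 2 * c1\<^sup>2 = 0"
      unfolding power2_eq_iff g_def \<nu>c by (auto simp: algebra_simps)
    then show False using c two by simp
  qed
  have r1: "(g - c1\<^sup>2) / d1\<^sup>2 = - 1" using c unfolding dd g_def by simp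
  have r2: "(g + c2\<^sup>2) / d2\<^sup>2 = 1" using c unfolding dd g_def by simp
  have r3: "(g + c1\<^sup>2) / d1\<^sup>2 = 2 * t\<^sup>2 - 1"
    using c unfolding dd g_def tc by (simp add: field_simps power2_eq_square)
  have r4: "(g - c2\<^sup>2) / d2\<^sup>2 = - (2 * (1 / t)\<^sup>2 - 1)"
    using c t0 unfolding dd g_def tc by (simp add: field_simps power2_eq_square)
  have cross: "2 * (rcount ?K ((g - c1 * c2) / (d1 * d2)) + rcount ?K ((g + c1 * c2) / (d1 * d2)))
      = 2 * (?R (t - 1 / t - 1) + ?R (t - 1 / t + 1))"
  proof -
    have e: "(g - c1 * c2) / (c1 * c2) = t - 1 / t - 1" "(g + c1 * c2) / (c1 * c2) = t - 1 / t + 1"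
      using c t0 unfolding g_def tc by (simp_all add: field_simps power2_eq_square)
    show ?thesis using cd
    proof
      assume "c1 * c2 = d1 * d2"
      then show ?thesis unfolding K e[symmetric] by simp
    next
      assume dm: "c1 * c2 = - (d1 * d2)"
      then have "d1 * d2 = - (c1 * c2)" by simp
      then have "(g - c1 * c2) / (d1 * d2) = - (t - 1 / t - 1)"
          "(g + c1 * c2) / (d1 * d2) = - (t - 1 / t + 1)"
        unfolding e[symmetric] by simp_all
      then show ?thesis unfolding K by (simp only: Rneg)
    qed
  qed
  have R1: "?R 1 = 1" by (rule rcount_one) auto
  have Rm1: "?R (-1) = 1" using R1 by (simp only: Rneg)
  have quad: "?R (2 * z\<^sup>2 - 1) = (if z\<^sup>2 - 1 \<in> nzsq then 2 else 0)" if z: "z \<noteq> 0" "z\<^sup>2 \<noteq> 1" for z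
  proof -
    have "2 * z\<^sup>2 - 1 \<noteq> 1" "2 * z\<^sup>2 - 1 \<noteq> -1" using z two by (auto simp: algebra_simps)
    moreover have "2 * (2 * z\<^sup>2 - 1 + 1) = (2 * z)\<^sup>2" by (simp add: power_mult_distrib)
    moreover have "(2 * z)\<^sup>2 \<in> nzsq" using z two by (intro square_in_nzsq) simp
    moreover have "2 * (2 * z\<^sup>2 - 1 - 1) = 2\<^sup>2 * (z\<^sup>2 - 1)" by (simp add: algebra_simps)
    ultimately show ?thesis using rcount_nzsq[OF two, of "2 * z\<^sup>2 - 1"]
      nzsq_mult_iff[OF square_in_nzsq[OF two], of "z\<^sup>2 - 1"] by simp
  qed
  \<comment> \<open>As \<open>-1\<close> is a square, passing from \<open>t\<close> to
    \<open>1 / t\<close> keeps the square class of \<open>t\<^sup>2 - 1\<close>, so the two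
    remaining unmixed counts agree.\<close>
  have "(1 / t)\<^sup>2 - 1 = (- (1 / t\<^sup>2)) * (t\<^sup>2 - 1)" using t0 by (simp add: field_simps)
  moreover have "- (1 / t\<^sup>2) \<in> nzsq" using t0 by (intro neg nzsq_divide one_in_nzsq square_in_nzsq)
  ultimately have "(1 / t)\<^sup>2 - 1 \<in> nzsq \<longleftrightarrow> t\<^sup>2 - 1 \<in> nzsq" using nzsq_mult_iff by metis
  then have Rt: "?R (- (2 * (1 / t)\<^sup>2 - 1)) = ?R (2 * t\<^sup>2 - 1)"
    unfolding Rneg using quad[of t] quad[of "1 / t"] t0 tt by (simp add: power_divide)
  let ?m = "t - 1 / t"
  have "2 + 2 * ?R (2 * t\<^sup>2 - 1) + 2 * (?R (?m - 1) + ?R (?m + 1)) = 4"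
    using count[OF g] unfolding r1 r2 r3 r4 cross Rt R1 Rm1 by simp
  moreover have "?R (2 * t\<^sup>2 - 1) \<in> {0, 2}" using quad[OF t0 tt] by simp
  \<comment> \<open>After halving, \<open>?R (2 * t\<^sup>2 - 1)\<close> and the two mixed counts
    add up to 1; the former is even, so it vanishes.\<close>
  ultimately have sum: "?R (?m - 1) + ?R (?m + 1) = 1" by auto
  have m0: "?m \<noteq> 0" using t0 tt by (auto simp: field_simps power2_eq_square)
  \<comment> \<open>An odd sum needs a mixed argument \<open>1\<close> or \<open>-1\<close>; since
    \<open>?m \<noteq> 0\<close>, the other one is then \<open>3\<close> or \<open>-3\<close>, and
    its count 2 is already too large.\<close>
  have R3: "?R 3 = 2"
  proof -
    have "(3::'k) - 1 \<noteq> 0" using two by simp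
    moreover have "(3::'k) + 1 \<noteq> 0" using four_neq_zero[OF two] by simp
    ultimately have "(3::'k) \<noteq> 1" "(3::'k) \<noteq> -1" by (auto simp only: right_minus_eq eq_neg_iff_add_eq_0)
    moreover have "2 * (3 + 1) = (2::'k) * 2\<^sup>2" "2 * (3 - 1) = (2::'k)\<^sup>2" by simp_all
    moreover have "(2::'k) * 2\<^sup>2 \<in> nzsq" "(2::'k)\<^sup>2 \<in> nzsq"
      by (rule nzsq_mult[OF sq(2) square_in_nzsq[OF two]], rule square_in_nzsq[OF two])
    ultimately show ?thesis using rcount_nzsq[OF two, of 3] by simp
  qed
  have m1: "?m - 1 = 1 \<or> ?m - 1 = -1 \<or> ?m + 1 = 1 \<or> ?m + 1 = -1"
  proof (rule ccontr)
    assume "\<not> ?thesis"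
    then have "?R (?m - 1) \<in> {0, 2}" "?R (?m + 1) \<in> {0, 2}"
      using rcount_nzsq[OF two, of "?m - 1"] rcount_nzsq[OF two, of "?m + 1"] by simp_all
    then show False using sum by auto
  qed
  then have "?m = 2 \<or> ?m = -2" using m0 by (auto simp: algebra_simps eq_neg_iff_add_eq_0)
  then show False
  proof
    assume "?m = 2"
    then have "?m - 1 = 1" "?m + 1 = 3" by simp_all
    then have "?R 1 + ?R 3 = 1" using sum by (simp only:)
    then show False using R1 R3 by simp
  next
    assume "?m = -2"
    then have "?m - 1 = - 3" "?m + 1 = -1" by simp_all
    then have "?R (- 3) + ?R (- 1) = 1" using sum by (simp only:)
    then show False using Rm1 R3 Rneg[of 3] by simp
  qed
qed

section \<open>The values of \<open>x\<^sup>2\<close> on a block\<close>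

lemma card_solutions_eq_rcount:
  fixes e s :: "'k::field"
  assumes "e \<noteq> 0" "s \<noteq> 0" "0 \<notin> C"
  shows "card {\<rho> \<in> C. e / s / \<rho> + e * s * \<rho> = 2 * z} = rcount ((*) s ` C) (z / e)"
proof -
  have img: "(*) s ` {\<rho> \<in> C. e / s / \<rho> + e * s * \<rho> = 2 * z} = {\<rho> \<in> (*) s ` C. \<rho> + 1 / \<rho> = 2 * (z / e)}"
  proof -
    \<comment> \<open>The two coefficients have product \<open>e\<^sup>2\<close> and ratio
      \<open>s\<^sup>2\<close>; rescaling \<rho> by \<open>s\<close> makes the equation reciprocal
      and moves its solutions into the coset of \<open>s\<close>.\<close>
    have "e / s / \<rho> + e * s * \<rho> = e * (s * \<rho> + 1 / (s * \<rho>))" for \<rho>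
      by (simp add: algebra_simps)
    moreover have "e * w = 2 * z \<longleftrightarrow> w = 2 * (z / e)" for w
      by (simp add: nonzero_eq_divide_eq[OF assms(1)] mult.commute)
    ultimately have iff: "e / s / \<rho> + e * s * \<rho> = 2 * z \<longleftrightarrow> s * \<rho> + 1 / (s * \<rho>) = 2 * (z / e)" for \<rho>
      by (simp only:)
    have "f ` {\<rho> \<in> C. Q (f \<rho>)} = {\<rho> \<in> f ` C. Q \<rho>}" for f :: "'k \<Rightarrow> 'k" and Q by blast
    then show ?thesis unfolding iff .
  qed
  have "inj_on ((*) s) A" for A using assms(2) by (auto simp: inj_on_def)
  from card_image[OF this] show ?thesis unfolding rcount_def img[symmetric] by (rule sym)
qed

text \<open>\<open>1 / s\<close> and \<open>s\<close> differ by a square factor. Mixed pairs taken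
  in the two orders lead to \<open>k\<close> and \<open>1 / k\<close>.\<close>

lemma inverse_times_nzsq:
  fixes s :: "'k::field"
  assumes "s \<noteq> 0"
  shows "(*) (1 / s) ` nzsq = (*) s ` nzsq"
proof -
  have *: "(*) (1 / t) ` nzsq \<subseteq> (*) t ` nzsq" if "t \<noteq> 0" for t :: 'k
  proof
    fix x assume "x \<in> (*) (1 / t) ` nzsq"
    then obtain r where "r \<in> nzsq" "x = t * (r / t\<^sup>2)" using that by (auto simp: power2_eq_square)
    then show "x \<in> (*) t ` nzsq" using nzsq_divide[OF _ square_in_nzsq[OF that]] by blast
  qed
  show ?thesis using *[OF assms] *[of "1 / s"] assms by auto
qed

lemma strata_eq_image:
  "strata \<nu> X \<kappa> C = (\<lambda>(x, u). (x, \<kappa> x * u, (\<nu> - x\<^sup>2) / (\<kappa> x * u))) ` (X \<times> C)"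
  unfolding strata_def by force

lemma card_strata:
  assumes "finite X" "\<And>x. x \<in> X \<Longrightarrow> \<kappa> x \<noteq> 0"
  shows "card (strata \<nu> X \<kappa> C) = card X * card C"
  unfolding strata_eq_image
  by (subst card_image) (use assms in \<open>auto simp: inj_on_def card_cartesian_product\<close>)

text \<open>\<open>V\<close> holds both signs of every point on the block of the diagonal
  \<open>h\<close>. \<open>scale\<close> and \<open>swap\<close> come from the normaliser of the
  torus, which fixes that block; \<open>pairs\<close> from \<open>\<lambda> = 2\<close>;
  \<open>aut\<close> from flag-transitivity at a fixed block.\<close>

locale block_configuration =
  fixes \<nu> :: "'k::{field,finite}" and V :: "'k triple set"
  assumes two: "(2::'k) \<noteq> 0" and q5: "CARD('k) > 5"
    and nu_nonsquare: "\<nu> \<noteq> 0" "\<nu> \<notin> nzsq"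
    and norm: "(x, a, b) \<in> V \<Longrightarrow> x\<^sup>2 + a * b = \<nu>"
    and card_V: "card V = 2 * (CARD('k) - 1)"
    and scale: "(x, a, b) \<in> V \<Longrightarrow> t \<noteq> 0 \<Longrightarrow> (x, t\<^sup>2 * a, b / t\<^sup>2) \<in> V"
    and neg: "(x, a, b) \<in> V \<Longrightarrow> (- x, - a, - b) \<in> V"
    and swap: "(x, a, b) \<in> V \<Longrightarrow> (x, b, a) \<in> V"
    and pairs: "g\<^sup>2 \<noteq> \<nu>\<^sup>2 \<Longrightarrow> card {(v, w). v \<in> V \<and> w \<in> V \<and> bil v w = g} = 4 * (CARD('k) - 1)"
    and aut: "(x, a, b) \<in> V \<Longrightarrow> (y, c, d) \<in> V \<Longrightarrow> \<exists>\<tau>. field_aut \<tau> \<and> \<tau> (x\<^sup>2 / \<nu>) = y\<^sup>2 / \<nu> \<and>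
      (\<forall>(z, e, f) \<in> V. \<exists>(z', e', f') \<in> V. \<tau> (z\<^sup>2 / \<nu>) = z'\<^sup>2 / \<nu>)"
begin

lemma nu_ne_square: "\<nu> \<noteq> x\<^sup>2"
  using nu_nonsquare square_in_nzsq[of x] by (cases "x = 0") auto

lemma V_cases:
  assumes "(x, a, b) \<in> V"
  shows "a \<noteq> 0" "b \<noteq> 0" "b = (\<nu> - x\<^sup>2) / a"
proof -
  have "a * b = \<nu> - x\<^sup>2" using norm[OF assms] by (simp add: algebra_simps)
  moreover from this have "a * b \<noteq> 0" using nu_ne_square by simp
  ultimately show "a \<noteq> 0" "b \<noteq> 0" "b = (\<nu> - x\<^sup>2) / a" by (auto simp: field_simps)
qed

lemma scale_nzsq: "(x, a, b) \<in> V \<Longrightarrow> u \<in> nzsq \<Longrightarrow> (x, a * u, b / u) \<in> V"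
  using scale by (auto simp: nzsq_def mult.commute)

lemma no_single_norm:
  assumes c: "\<And>x a b. (x, a, b) \<in> V \<Longrightarrow> x\<^sup>2 = c\<^sup>2"
  shows False
proof -
  let ?n = "CARD('k) - 1"
  let ?C = "strata \<nu> {c, -c} (\<lambda>_. 1) (- {0})"
  \<comment> \<open>\<open>?C\<close> is all vectors of norm \<nu> with \<open>x\<close> equal to
    \<open>c\<close> or \<open>-c\<close>. Its size leaves no room: \<open>V\<close> must be all of
    it, and \<open>c\<close> differs from \<open>-c\<close>.\<close>
  have "V \<subseteq> ?C"
  proof
    fix v assume v: "v \<in> V"
    obtain x a b where e: "v = (x, a, b)" by (cases v)
    have "x \<in> {c, -c}" using c v unfolding e power2_eq_iff by blast
    moreover have "v = (x, 1 * a, (\<nu> - x\<^sup>2) / (1 * a))" "a \<in> - {0}"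
      using V_cases[of x a b] v unfolding e by auto
    ultimately show "v \<in> ?C" unfolding strata_def by blast
  qed
  moreover have card_C: "card ?C = card {c, -c} * ?n"
    by (subst card_strata) (auto simp: card_nonzero)
  ultimately have "2 * ?n \<le> card {c, -c} * ?n" using card_mono[of ?C V] card_V by simp
  then have "card {c, -c} = 2" using q5 by (cases "c = -c") (auto simp: card_insert_if)
  then have VC: "V = ?C"
    using card_subset_eq[OF _ \<open>V \<subseteq> ?C\<close>] card_C card_V by simp
  have cc: "c \<noteq> -c"
  proof
    assume "c = -c"
    then have "{c, -c} = {c}" by (metis insert_absorb2)
    then show False using \<open>card {c, -c} = 2\<close> unfolding \<open>{c, -c} = {c}\<close> by simp
  qed
  let ?R = "rcount (- {0::'k})"
  let ?d = "\<nu> - c\<^sup>2"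
  have d: "?d \<noteq> 0" using nu_ne_square by simp
  have "?R ((g - c\<^sup>2) / ?d) + ?R ((g + c\<^sup>2) / ?d) = 2" if g: "g\<^sup>2 \<noteq> \<nu>\<^sup>2" for g
  proof -
    have sol: "card {\<rho> \<in> - {0}. ?d / \<rho> + ?d * \<rho> = 2 * z} = ?R (z / ?d)" for z
      using card_solutions_eq_rcount[OF d, of 1 "- {0}" z] by simp
    have S: "sum F {c, -c} = F c + F (-c)" for F :: "'k \<Rightarrow> nat" using cc by simp
    have "4 * ?n = ?n * (2 * (?R ((g - c\<^sup>2) / ?d) + ?R ((g + c\<^sup>2) / ?d)))"
    proof -
      have sg: "c * - c = - (c * c)" "- c * c = - (c * c)" "- c * - c = c * c" by simp_all
      have "4 * ?n = card (- {0::'k}) * (\<Sum>x\<in>{c, -c}. \<Sum>x'\<in>{c, -c}.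
          card {\<rho> \<in> - {0}. 1 / 1 * (\<nu> - x'\<^sup>2) / \<rho> + 1 / 1 * (\<nu> - x\<^sup>2) * \<rho> = 2 * (g - x * x')})"
        using pairs[OF g] unfolding VC by (subst (asm) card_pairs_strata[OF two]) auto
      then show ?thesis
        unfolding S sg power2_minus div_by_1 mult_1 diff_minus_eq_add sol card_nonzero power2_eq_square[symmetric]
        by (simp only: mult_2 add_ac)
    qed
    then show ?thesis using q5 by simp
  qed
  moreover have "c \<noteq> 0" using cc by auto
  ultimately show False using single_stratum_contradiction[OF two q5 nu_nonsquare(1) _ nu_ne_square] by blast
qed

text \<open>There are two disjoint torus orbits of size \<open>(q - 1) / 2\<close>. For
  \<open>x \<noteq> 0\<close> they belong to the vector and its negative; for \<open>x = 0\<close>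
  to the vector and its transpose, disjoint because \<open>a * b = \<nu>\<close> is a
  nonsquare.\<close>

lemma card_norm_fibre:
  assumes v: "(x, a, b) \<in> V"
  shows "CARD('k) - 1 \<le> card {w \<in> V. (fst w)\<^sup>2 = x\<^sup>2}"
proof -
  note nz = V_cases[OF v]
  let ?f = "\<lambda>u. (x, a * u, b / u)"
  obtain y c d where w: "(y, c, d) \<in> V" "y\<^sup>2 = x\<^sup>2" and disj: "\<And>u u'. u \<in> nzsq \<Longrightarrow> u' \<in> nzsq \<Longrightarrow> (y, c * u', d / u') \<noteq> ?f u"
  proof (cases "x = 0")
    case True
    have "a * u \<noteq> b * u'" if "u \<in> nzsq" "u' \<in> nzsq" for u u'
    proof
      assume au: "a * u = b * u'"
      have "a * b = \<nu>" using norm[OF v] True by simp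
      moreover have "a * a * u = a * b * u'" by (simp only: mult.assoc au)
      ultimately have "a * a * u = \<nu> * u'" by simp
      moreover have "a * a * u \<in> nzsq" using that square_in_nzsq[OF nz(1)]
        by (auto intro: nzsq_mult simp: power2_eq_square)
      ultimately show False using nu_nonsquare nzsq_mult_iff[OF that(2), of \<nu>] by (simp add: mult.commute)
    qed
    then show ?thesis using that[OF swap[OF v]] by force
  next
    case False
    then have "- x \<noteq> x" by (simp add: self_eq_uminus[OF two])
    then show ?thesis using that[OF neg[OF v]] by force
  qed
  let ?h = "\<lambda>u. (y, c * u, d / u)"
  have "?f ` nzsq \<union> ?h ` nzsq \<subseteq> {w \<in> V. (fst w)\<^sup>2 = x\<^sup>2}"
    using scale_nzsq[OF v] scale_nzsq[OF w(1)] w(2) by auto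
  then have "card (?f ` nzsq \<union> ?h ` nzsq) \<le> card {w \<in> V. (fst w)\<^sup>2 = x\<^sup>2}"
    by (intro card_mono) auto
  moreover have "card (?f ` nzsq \<union> ?h ` nzsq) = card (?f ` nzsq) + card (?h ` nzsq)"
  proof (rule card_Un_disjoint)
    show "?f ` nzsq \<inter> ?h ` nzsq = {}"
    proof (rule equals0I)
      fix w assume "w \<in> ?f ` nzsq \<inter> ?h ` nzsq"
      then obtain u u' where "u \<in> nzsq" "u' \<in> nzsq" "w = ?f u" "w = ?h u'" by blast
      then show False using disj[of u u'] by (simp only:)
    qed
  qed simp_all
  moreover have "card (?f ` nzsq) = card (nzsq :: 'k set)"
    using nz by (intro card_image) (auto simp: inj_on_def)
  moreover have "card (?h ` nzsq) = card (nzsq :: 'k set)"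
    using V_cases[OF w(1)] by (intro card_image) (auto simp: inj_on_def)
  ultimately show ?thesis using card_nzsq[OF two] by simp
qed

lemma no_three_norms:
  assumes "(x, a, b) \<in> V" "(y, c, d) \<in> V" "(z, e, f) \<in> V"
    and "x\<^sup>2 \<noteq> y\<^sup>2" "x\<^sup>2 \<noteq> z\<^sup>2" "y\<^sup>2 \<noteq> z\<^sup>2"
  shows False
proof -
  let ?F = "\<lambda>t. {w \<in> V. (fst w)\<^sup>2 = t}"
  have "card (\<Union>t\<in>{x\<^sup>2, y\<^sup>2, z\<^sup>2}. ?F t) = (\<Sum>t\<in>{x\<^sup>2, y\<^sup>2, z\<^sup>2}. card (?F t))"
    by (rule card_UN_disjoint) auto
  also have "\<dots> \<ge> 3 * (CARD('k) - 1)"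
    using card_norm_fibre[OF assms(1)] card_norm_fibre[OF assms(2)] card_norm_fibre[OF assms(3)] assms(4-)
    by simp
  finally have "3 * (CARD('k) - 1) \<le> card (\<Union>t\<in>{x\<^sup>2, y\<^sup>2, z\<^sup>2}. ?F t)" .
  also have "\<dots> \<le> card V" by (rule card_mono) auto
  finally show False using card_V q5 by simp
qed

theorem inconsistent: False
proof -
  let ?n = "CARD('k) - 1"
  have "V \<noteq> {}" using card_V q5 by auto
  then obtain x1 a1 b1 where v1: "(x1, a1, b1) \<in> V" by (metis ex_in_conv prod_cases3)
  obtain x2 a2 b2 where v2: "(x2, a2, b2) \<in> V" and x12: "x2\<^sup>2 \<noteq> x1\<^sup>2"
    using no_single_norm[of x1] by blast
  obtain \<tau> where \<tau>: "field_aut \<tau>" and \<tau>1: "\<tau> (x1\<^sup>2 / \<nu>) = x2\<^sup>2 / \<nu>"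
    and \<tau>V: "\<forall>(z, e, f) \<in> V. \<exists>(z', e', f') \<in> V. \<tau> (z\<^sup>2 / \<nu>) = z'\<^sup>2 / \<nu>"
    using aut[OF v1 v2] by blast
  obtain x3 a3 b3 where v3: "(x3, a3, b3) \<in> V" "\<tau> (x2\<^sup>2 / \<nu>) = x3\<^sup>2 / \<nu>"
    using \<tau>V v2 by fastforce
  have "x3\<^sup>2 \<noteq> x2\<^sup>2"
  proof
    assume "x3\<^sup>2 = x2\<^sup>2"
    then have "x2\<^sup>2 / \<nu> = x1\<^sup>2 / \<nu>" using v3(2) \<tau>1 field_aut_inj[OF \<tau>] by metis
    then show False using x12 nu_nonsquare by simp
  qed
  \<comment> \<open>With only two values available, \<tau> must return the second to the
    first.\<close>
  then have "x3\<^sup>2 = x1\<^sup>2" using no_three_norms[OF v1 v2 v3(1)] x12 by metis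
  then have \<tau>2: "\<tau> (x2\<^sup>2 / \<nu>) = x1\<^sup>2 / \<nu>" using v3(2) by simp
  \<comment> \<open>Zero is fixed by \<tau>, so neither of two exchanged values is zero.\<close>
  have x1: "x1 \<noteq> 0" and x2: "x2 \<noteq> 0"
    using \<tau>1 \<tau>2 x12 nu_nonsquare field_aut_zero[OF \<tau>] by auto
  have sq: "a \<in> nzsq" if "\<tau> a = a" "a \<noteq> 0" for a
  proof (rule fixed_by_field_aut_square[OF two \<tau> _ _ that])
    show "x1\<^sup>2 / \<nu> - x2\<^sup>2 / \<nu> \<noteq> 0" using x12 nu_nonsquare by simp
    show "\<tau> (x1\<^sup>2 / \<nu> - x2\<^sup>2 / \<nu>) = - (x1\<^sup>2 / \<nu> - x2\<^sup>2 / \<nu>)"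
      by (simp add: field_aut_diff[OF \<tau>] \<tau>1 \<tau>2)
  qed
  have sqm: "-1 \<in> (nzsq :: 'k set)"
    by (rule sq) (simp_all add: field_aut_uminus[OF \<tau>] field_aut_one[OF \<tau>])
  have "\<tau> (1 + 1) = 1 + 1" by (simp only: field_aut_add[OF \<tau>] field_aut_one[OF \<tau>])
  then have sq2: "2 \<in> (nzsq :: 'k set)" using two by (intro sq) simp_all
  define X where "X = {x1, -x1, x2, -x2}"
  \<comment> \<open>As \<open>-1\<close> is a square, the vectors at \<open>x\<close> and at
    \<open>-x\<close> use the same coset of squares, so one representative serves both; four orbits
    of size \<open>(q - 1) / 2\<close> then fill \<open>V\<close>.\<close>
  define \<kappa> where "\<kappa> x = (if x\<^sup>2 = x1\<^sup>2 then a1 else a2)" for x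
  have \<kappa>0: "\<kappa> x \<noteq> 0" for x using V_cases(1)[OF v1] V_cases(1)[OF v2] by (simp add: \<kappa>_def)
  have \<kappa>: "\<kappa> x1 = a1" "\<kappa> (-x1) = a1" "\<kappa> x2 = a2" "\<kappa> (-x2) = a2"
    using x12 by (simp_all add: \<kappa>_def)
  have distinct: "x1 \<noteq> -x1" "x2 \<noteq> -x2" "x1 \<noteq> x2" "x1 \<noteq> -x2" "-x1 \<noteq> x2"
  proof -
    show "x1 \<noteq> -x1" "x2 \<noteq> -x2" using x1 x2 by (simp_all add: self_eq_uminus[OF two])
    show "x1 \<noteq> x2" "x1 \<noteq> -x2" "-x1 \<noteq> x2" using x12 by auto
  qed
  have m: "(x, a, b) \<in> V \<Longrightarrow> u \<in> nzsq \<Longrightarrow> (- x, a * u, (\<nu> - x\<^sup>2) / (a * u)) \<in> V" for x a b u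
    using scale_nzsq[OF neg, of x a b "- u"] nzsq_mult[OF sqm, of u] V_cases[of x a b] by simp
  have p: "(x, a, b) \<in> V \<Longrightarrow> u \<in> nzsq \<Longrightarrow> (x, a * u, (\<nu> - x\<^sup>2) / (a * u)) \<in> V" for x a b u
    using scale_nzsq[of x a b u] V_cases[of x a b] by simp
  have sub: "strata \<nu> X \<kappa> nzsq \<subseteq> V"
  proof
    fix w assume "w \<in> strata \<nu> X \<kappa> nzsq"
    then obtain x u where w: "w = (x, \<kappa> x * u, (\<nu> - x\<^sup>2) / (\<kappa> x * u))" "u \<in> nzsq" "x \<in> X"
      unfolding strata_def by blast
    have "x = x1 \<or> x = - x1 \<or> x = x2 \<or> x = - x2" using w(3) by (simp add: X_def)
    then show "w \<in> V"
      using p[OF v1 w(2)] p[OF v2 w(2)] m[OF v1 w(2)] m[OF v2 w(2)]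
      unfolding w(1) by (elim disjE) (simp_all only: \<kappa> power2_minus)
  qed
  have "card X = 4" unfolding X_def using distinct by simp
  then have "card (strata \<nu> X \<kappa> nzsq) = card V"
    using card_strata[of X \<kappa> \<nu> nzsq] \<kappa>0 card_V card_nzsq[OF two] by (simp add: X_def)
  then have VX: "V = strata \<nu> X \<kappa> nzsq" using card_subset_eq[OF _ sub] by simp
  \<comment> \<open>By \<open>swap\<close>, \<open>a\<close> and \<open>b\<close> lie in the same
    coset of squares, so their product \<open>\<nu> - x\<^sup>2\<close> is a square.\<close>
  have dsq: "\<nu> - x\<^sup>2 \<in> nzsq" if v: "(x, a, b) \<in> V" for x a b
  proof -
    have "(x, b, a) \<in> strata \<nu> X \<kappa> nzsq" "(x, a, b) \<in> strata \<nu> X \<kappa> nzsq"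
      using swap[OF v] v VX by simp_all
    then obtain u u' where u: "u \<in> nzsq" "b = \<kappa> x * u" "u' \<in> nzsq" "a = \<kappa> x * u'"
      unfolding strata_def by blast
    have "\<nu> - x\<^sup>2 = (\<kappa> x)\<^sup>2 * (u * u')" using norm[OF v] u by (simp add: algebra_simps power2_eq_square)
    then show ?thesis using u \<kappa>0 by (auto intro!: nzsq_mult square_in_nzsq)
  qed
  obtain d1 where d1: "\<nu> - x1\<^sup>2 = d1\<^sup>2" "d1 \<noteq> 0" using dsq[OF v1] by (auto simp: nzsq_def)
  obtain d2 where d2: "\<nu> - x2\<^sup>2 = d2\<^sup>2" "d2 \<noteq> 0" using dsq[OF v2] by (auto simp: nzsq_def)
  have a0: "a1 \<noteq> 0" "a2 \<noteq> 0" using V_cases v1 v2 by blast+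
  \<comment> \<open>Chosen so that the mixed coefficients are \<open>d1 * d2 / k\<close> and
    \<open>d1 * d2 * k\<close>, the shape treated by
    \<open>card_solutions_eq_rcount\<close>.\<close>
  define k where "k = a2 * d1 / (a1 * d2)"
  have k0: "k \<noteq> 0" using a0 d1 d2 by (simp add: k_def)
  let ?R = "rcount (nzsq :: 'k set)" and ?K = "rcount ((*) k ` nzsq)"
  let ?T = "\<lambda>A B z. card {\<rho> \<in> nzsq. A / \<rho> + B * \<rho> = 2 * z}"
  have T11: "?T (d * d) (d * d) z = ?R (z / d\<^sup>2)" if "d \<noteq> 0" for d z
    using card_solutions_eq_rcount[of "d\<^sup>2" 1 nzsq z] that by (simp add: power2_eq_square)
  have T12: "?T (a1 / a2 * d2\<^sup>2) (a2 / a1 * d1\<^sup>2) z = ?K (z / (d1 * d2))" for z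
  proof -
    have "a1 / a2 * d2\<^sup>2 = d1 * d2 / k" "a2 / a1 * d1\<^sup>2 = d1 * d2 * k"
      using a0 d1 d2 by (simp_all add: k_def field_simps power2_eq_square)
    then show ?thesis using card_solutions_eq_rcount[of "d1 * d2" k nzsq z] d1 d2 k0 by simp
  qed
  have T21: "?T (a2 / a1 * d1\<^sup>2) (a1 / a2 * d2\<^sup>2) z = ?K (z / (d1 * d2))" for z
  proof -
    have "a1 / a2 * d2\<^sup>2 = d1 * d2 * (1 / k)" "a2 / a1 * d1\<^sup>2 = d1 * d2 / (1 / k)"
      using a0 d1 d2 by (simp_all add: k_def field_simps power2_eq_square)
    then show ?thesis
      using card_solutions_eq_rcount[of "d1 * d2" "1 / k" nzsq z] inverse_times_nzsq[OF k0] d1 d2 k0 by simp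
  qed
  have "?R ((g - x1\<^sup>2) / d1\<^sup>2) + ?R ((g + x1\<^sup>2) / d1\<^sup>2) + ?R ((g - x2\<^sup>2) / d2\<^sup>2) + ?R ((g + x2\<^sup>2) / d2\<^sup>2)
      + 2 * (?K ((g - x1 * x2) / (d1 * d2)) + ?K ((g + x1 * x2) / (d1 * d2))) = 4" (is "?S g = 4")
    if g: "g\<^sup>2 \<noteq> \<nu>\<^sup>2" for g
  proof -
    have "4 * ?n = card (nzsq :: 'k set) * (\<Sum>x\<in>X. \<Sum>x'\<in>X.
        ?T (\<kappa> x / \<kappa> x' * (\<nu> - x'\<^sup>2)) (\<kappa> x' / \<kappa> x * (\<nu> - x\<^sup>2)) (g - x * x'))"
      using pairs[OF g] unfolding VX
      by (subst (asm) card_pairs_strata[OF two]) (use \<kappa>0 nzsq_mult nzsq_divide in auto)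
    \<comment> \<open>Negating both \<open>x\<close> and \<open>x'\<close> changes no summand, so
      the sixteen terms pair up.\<close>
    also have "(\<Sum>x\<in>X. \<Sum>x'\<in>X.
        ?T (\<kappa> x / \<kappa> x' * (\<nu> - x'\<^sup>2)) (\<kappa> x' / \<kappa> x * (\<nu> - x\<^sup>2)) (g - x * x')) = 2 * ?S g"
    proof -
      have X: "sum F X = F x1 + F (-x1) + F x2 + F (-x2)" for F :: "'k \<Rightarrow> nat"
        unfolding X_def using distinct by (simp add: add.assoc)
      have aa: "a1 / a1 * z = z" "a2 / a2 * z = z" for z using a0 by simp_all
      have sg: "- x * y = - (x * y)" "x * - y = - (x * y)" "- x * - y = x * y" for x y :: 'k by simp_all
      show ?thesis
        unfolding X \<kappa> power2_minus d1(1) d2(1) aa sg diff_minus_eq_add power2_eq_square[symmetric]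
          T12 T21 T11[OF d1(2), unfolded power2_eq_square[symmetric]] T11[OF d2(2), unfolded power2_eq_square[symmetric]]
        by (simp add: mult.commute[of x2 x1])
    qed
    finally have "4 * ?n = 2 * card (nzsq :: 'k set) * ?S g" by (simp only: mult_ac)
    then have "4 * ?n = ?n * ?S g" unfolding card_nzsq[OF two] .
    then show ?thesis using q5 by simp
  qed
  then show False
    by (rule two_strata_contradiction[OF two nu_nonsquare x1 x2 x12[symmetric] d1(1) d2(1) k0 sqm sq2])
qed

end

section \<open>Conjugation action on traceless matrices\<close>

definition mat2 :: "'k \<Rightarrow> 'k \<Rightarrow> 'k \<Rightarrow> 'k \<Rightarrow> 'k::field ^ 2 ^ 2" where
  "mat2 a b c d = (\<chi> i j. if i = 1 then if j = 1 then a else b else if j = 1 then c else d)"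

lemma mat2_nth [simp]:
  "mat2 a b c d $ 1 $ 1 = a" "mat2 a b c d $ 1 $ 2 = b"
  "mat2 a b c d $ 2 $ 1 = c" "mat2 a b c d $ 2 $ 2 = d"
  by (simp_all add: mat2_def)

lemma mat2_eqI:
  fixes A B :: "'k::field ^ 2 ^ 2"
  assumes "A $ 1 $ 1 = B $ 1 $ 1" "A $ 1 $ 2 = B $ 1 $ 2" "A $ 2 $ 1 = B $ 2 $ 1" "A $ 2 $ 2 = B $ 2 $ 2"
  shows "A = B"
  using assms by (simp add: vec_eq_iff forall_2)

lemma mat2_eq_iff [simp]: "mat2 a b c d = mat2 a' b' c' d' \<longleftrightarrow> a = a' \<and> b = b' \<and> c = c' \<and> d = d'"
  by (metis mat2_nth)

lemma mat2_cases:
  obtains a b c d where "(A :: 'k::field ^ 2 ^ 2) = mat2 a b c d"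
  by (rule that[of "A $ 1 $ 1" "A $ 1 $ 2" "A $ 2 $ 1" "A $ 2 $ 2"]) (rule mat2_eqI; simp)

lemma mat2_mult [simp]:
  "mat2 a b c d ** mat2 a' b' c' d'
     = mat2 (a * a' + b * c') (a * b' + b * d') (c * a' + d * c') (c * b' + d * d')"
  by (rule mat2_eqI) (simp_all add: matrix_matrix_mult_def sum_2)

lemma det_mat2 [simp]: "det (mat2 a b c d) = a * d - b * c"
  by (simp add: det_2)

lemma mat_one_eq_mat2: "mat 1 = mat2 1 0 0 (1 :: 'k::field)"
  by (rule mat2_eqI) (simp_all add: mat_def)

lemma uminus_mat2 [simp]: "- mat2 a b c d = mat2 (-a) (-b) (-c) (-d)"
  by (rule mat2_eqI) simp_all

abbreviation SL2 :: "('k::field ^ 2 ^ 2) set" where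
  "SL2 \<equiv> {A. det A = 1}"

definition adj2 :: "'k::field ^ 2 ^ 2 \<Rightarrow> 'k ^ 2 ^ 2" where
  "adj2 A = mat2 (A $ 2 $ 2) (- A $ 1 $ 2) (- A $ 2 $ 1) (A $ 1 $ 1)"

lemma adj2_mat2 [simp]: "adj2 (mat2 a b c d) = mat2 d (-b) (-c) a"
  by (simp add: adj2_def)

lemma adj2_inverse:
  assumes "g \<in> SL2"
  shows "g ** adj2 g = mat 1" "adj2 g ** g = mat 1" "adj2 g \<in> SL2"
  using assms by (cases g rule: mat2_cases; simp add: mat_one_eq_mat2 algebra_simps)+

lemma SL2_mult: "g \<in> SL2 \<Longrightarrow> h \<in> SL2 \<Longrightarrow> g ** h \<in> SL2"
  by (simp add: det_mul)

lemma SL2_uminus: "(g :: 'k::field ^ 2 ^ 2) \<in> SL2 \<Longrightarrow> - g \<in> SL2"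
  by (cases g rule: mat2_cases) (simp add: algebra_simps)

lemma minus_matrix_mult:
  fixes A B :: "'k::field ^ 2 ^ 2"
  shows "(- A) ** B = - (A ** B)" "A ** (- B) = - (A ** B)"
  by (cases A rule: mat2_cases; cases B rule: mat2_cases; simp)+

fun tmat :: "'k::field triple \<Rightarrow> 'k ^ 2 ^ 2" where
  "tmat (x, a, b) = mat2 x a b (- x)"

text \<open>This is \<open>- det (tmat v)\<close>; the square of \<open>tmat v\<close> is
  \<open>qf v\<close> times the identity.\<close>

fun qf :: "'k::field triple \<Rightarrow> 'k" where
  "qf (x, a, b) = x\<^sup>2 + a * b"

fun tneg :: "'k::field triple \<Rightarrow> 'k triple" where
  "tneg (x, a, b) = (- x, - a, - b)"

text \<open>These are the entries of \<open>g ** tmat v ** adj2 g\<close>, hence of conjugation when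
  \<open>det g = 1\<close>. Being free of division, the formula is multiplicative in
  \<open>g\<close> for arbitrary matrices.\<close>

definition ad :: "'k::field ^ 2 ^ 2 \<Rightarrow> 'k triple \<Rightarrow> 'k triple" where
  "ad g v = (let p = g $ 1 $ 1; q = g $ 1 $ 2; r = g $ 2 $ 1; s = g $ 2 $ 2 in
     case v of (x, a, b) \<Rightarrow>
       ((p * s + q * r) * x - p * r * a + q * s * b,
        - 2 * p * q * x + p\<^sup>2 * a - q\<^sup>2 * b,
        2 * r * s * x - r\<^sup>2 * a + s\<^sup>2 * b))"

lemma ad_mat2 [simp]:
  "ad (mat2 p q r s) (x, a, b) =
     ((p * s + q * r) * x - p * r * a + q * s * b,
      - 2 * p * q * x + p\<^sup>2 * a - q\<^sup>2 * b,
      2 * r * s * x - r\<^sup>2 * a + s\<^sup>2 * b)"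
  by (simp add: ad_def Let_def)

lemma ad_mult: "ad (g ** h) v = ad g (ad h v)"
  by (cases g rule: mat2_cases; cases h rule: mat2_cases; cases v)
     (simp add: algebra_simps power2_eq_square)

lemma ad_one [simp]: "ad (mat 1) v = v"
  by (cases v) (simp add: mat_one_eq_mat2)

lemma ad_uminus [simp]: "ad (- g) v = ad g v"
  by (cases g rule: mat2_cases; cases v) simp

lemma ad_tneg: "ad g (tneg v) = tneg (ad g v)"
  by (cases g rule: mat2_cases; cases v) (simp add: algebra_simps)

lemma tneg_tneg [simp]: "tneg (tneg v) = v"
  by (cases v) simp

lemma tneg_neq:
  fixes v :: "'k::field triple"
  assumes two: "(2::'k) \<noteq> 0" and v: "v \<noteq> (0, 0, 0)"
  shows "tneg v \<noteq> v"
  using v by (cases v) (auto simp: self_eq_uminus[OF two])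

lemma qf_tneg [simp]: "qf (tneg v) = qf v"
  by (cases v) simp

lemma bil_tneg: "bil (tneg v) w = - bil v w" "bil v (tneg w) = - bil v w"
  by (cases v; cases w; simp add: add_divide_distrib diff_divide_distrib)+

lemma ad_adj2:
  assumes "g \<in> SL2"
  shows "ad (adj2 g) (ad g v) = v" "ad g (ad (adj2 g) v) = v"
  using adj2_inverse[OF assms] by (simp_all add: ad_mult[symmetric])

lemma qf_ad_det: "qf (ad g v) = (det g)\<^sup>2 * qf v"
  by (cases g rule: mat2_cases; cases v) (simp add: algebra_simps power2_eq_square)

lemma qf_ad [simp]: "g \<in> SL2 \<Longrightarrow> qf (ad g v) = qf v"
  by (simp add: qf_ad_det)

lemma bil_ad:
  assumes two: "(2::'k::field) \<noteq> 0" and g: "(g :: 'k ^ 2 ^ 2) \<in> SL2"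
  shows "bil (ad g v) (ad g w) = bil v w"
proof -
  have bil2: "2 * bil (x, a, b) (x', a', b') = 2 * x * x' + a * b' + b * a'" for x a b x' a' b' :: 'k
    using two by (simp add: distrib_left)
  have "2 * bil (ad g v) (ad g w) = (det g)\<^sup>2 * (2 * bil v w)"
    by (cases g rule: mat2_cases; cases v; cases w)
      (simp only: ad_mat2 bil2 det_mat2, simp add: algebra_simps power2_eq_square)
  then show ?thesis using two g by simp
qed

lemma tmat_ad: "tmat (ad g v) ** g = g ** tmat v" if "g \<in> SL2" for g :: "'k::field ^ 2 ^ 2"
proof -
  obtain p q r s where g: "g = mat2 p q r s" by (rule mat2_cases)
  obtain x a b where v: "v = (x, a, b)" by (cases v)
  have d: "p * s = 1 + q * r" using that by (simp add: g algebra_simps)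
  have "tmat (ad g v) ** g = mat2 ((p * s - q * r) * (p * x + q * b)) ((p * s - q * r) * (p * a - q * x))
      ((p * s - q * r) * (r * x + s * b)) ((p * s - q * r) * (r * a - s * x))"
    by (simp add: g v algebra_simps power2_eq_square)
  then show ?thesis by (simp add: g v d)
qed

lemma ad_eq_iff_commute:
  assumes "g \<in> SL2"
  shows "ad g v = w \<longleftrightarrow> tmat w ** g = g ** tmat v"
proof
  assume "tmat w ** g = g ** tmat v"
  then have "tmat w ** g = tmat (ad g v) ** g" using tmat_ad[OF assms] by simp
  then have "tmat w ** g ** adj2 g = tmat (ad g v) ** g ** adj2 g" by simp
  then have "tmat w = tmat (ad g v)"
    using adj2_inverse(1)[OF assms] by (simp add: matrix_mul_assoc[symmetric])
  then show "ad g v = w" by (cases w; cases "ad g v") simp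
next
  assume "ad g v = w"
  then show "tmat w ** g = g ** tmat v" using tmat_ad[OF assms, of v] by (simp only:)
qed

text \<open>The element \<open>\<alpha> + \<beta> M\<close> of the algebra generated by
  \<open>M = tmat v\<close>. Its determinant is
  \<open>\<alpha>\<^sup>2 - qf v * \<beta>\<^sup>2\<close>, the norm form of that algebra.\<close>

definition lincomb :: "'k::field triple \<Rightarrow> 'k \<times> 'k \<Rightarrow> 'k ^ 2 ^ 2" where
  "lincomb v = (\<lambda>(\<alpha>, \<beta>). case v of (x, a, b) \<Rightarrow> mat2 (\<alpha> + \<beta> * x) (\<beta> * a) (\<beta> * b) (\<alpha> - \<beta> * x))"

lemma lincomb_simp [simp]:
  "lincomb (x, a, b) (\<alpha>, \<beta>) = mat2 (\<alpha> + \<beta> * x) (\<beta> * a) (\<beta> * b) (\<alpha> - \<beta> * x)"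
  by (simp add: lincomb_def)

definition norm_one :: "'k::field \<Rightarrow> ('k \<times> 'k) set" where
  "norm_one \<Delta> = {(\<alpha>, \<beta>). \<alpha>\<^sup>2 - \<Delta> * \<beta>\<^sup>2 = 1}"

definition stab :: "'k::field triple \<Rightarrow> ('k ^ 2 ^ 2) set" where
  "stab v = {g \<in> SL2. ad g v = v}"

definition stab_pm :: "'k::field triple \<Rightarrow> ('k ^ 2 ^ 2) set" where
  "stab_pm v = {g \<in> SL2. ad g v = v \<or> ad g v = tneg v}"

text \<open>The centraliser of the non-scalar matrix \<open>tmat v\<close> is the algebra it
  generates.\<close>

lemma stab_eq_image:
  assumes two: "(2::'k::field) \<noteq> 0" and v: "(v :: 'k triple) \<noteq> (0, 0, 0)"
  shows "stab v = lincomb v ` norm_one (qf v)"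
proof (rule Set.set_eqI, rule iffI)
  fix g assume "g \<in> lincomb v ` norm_one (qf v)"
  then obtain \<alpha> \<beta> where ab: "\<alpha>\<^sup>2 - qf v * \<beta>\<^sup>2 = 1" "g = lincomb v (\<alpha>, \<beta>)"
    by (auto simp: norm_one_def)
  obtain x a b where e: "v = (x, a, b)" by (cases v)
  have g: "g \<in> SL2" using ab by (simp add: e algebra_simps power2_eq_square)
  then have "ad g v = v" by (simp add: ad_eq_iff_commute) (simp add: ab e algebra_simps)
  then show "g \<in> stab v" using g by (simp add: stab_def)
next
  fix g assume "g \<in> stab v"
  then have g: "g \<in> SL2" "tmat v ** g = g ** tmat v"
    using ad_eq_iff_commute[of g v v] by (auto simp: stab_def)
  obtain p q r s where gm: "g = mat2 p q r s" by (rule mat2_cases)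
  obtain x a b where e: "v = (x, a, b)" by (cases v)
  have c: "a * r = b * q" "2 * q * x = a * (p - s)" "2 * r * x = b * (p - s)"
  proof -
    have h: "x * p + a * r = p * x + q * b" "x * q + a * s = p * a + q * (- x)" "b * p + (- x) * r = r * x + s * b"
      using g(2) by (simp_all only: gm e tmat.simps mat2_mult mat2_eq_iff)
    show "a * r = b * q" using h(1) by (simp add: mult.commute)
    have "2 * q * x = (x * q + a * s) + q * x - a * s" by (simp add: algebra_simps)
    also have "\<dots> = a * (p - s)" unfolding h(2) by (simp add: algebra_simps)
    finally show "2 * q * x = a * (p - s)" .
    have "2 * r * x = r * x + s * b + r * x - s * b" by (simp add: algebra_simps)
    also have "\<dots> = b * (p - s)" unfolding h(3)[symmetric] by (simp add: algebra_simps)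
    finally show "2 * r * x = b * (p - s)" .
  qed
  \<comment> \<open>The relations \<open>c\<close> say that the traceless part of \<open>g\<close>
    is proportional to \<open>v\<close>; the factor is read off at a nonzero coordinate of
    \<open>v\<close>.\<close>
  obtain \<beta> where \<beta>: "q = \<beta> * a" "r = \<beta> * b" "p - s = 2 * \<beta> * x"
  proof (cases "x = 0")
    case False
    then have x2: "2 * x \<noteq> 0" using two by simp
    have "q * (2 * x) = (p - s) * a" "r * (2 * x) = (p - s) * b" using c by (simp_all only: mult_ac)
    then have "q = (p - s) * a / (2 * x)" "r = (p - s) * b / (2 * x)"
      using nonzero_eq_divide_eq[OF x2] by simp_all
    then show ?thesis using x2 False two by (intro that[of "(p - s) / (2 * x)"]) simp_all
  next
    case x: True
    show ?thesis
    proof (cases "a = 0")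
      case False
      then show ?thesis using c x by (intro that[of "q / a"]) (auto simp: field_simps)
    next
      case True
      then have "b \<noteq> 0" using v x e by simp
      then show ?thesis using c x True by (intro that[of "r / b"]) (auto simp: field_simps)
    qed
  qed
  define \<alpha> where "\<alpha> = (p + s) / 2"
  have ps: "p + s = 2 * \<alpha>" using two by (simp add: \<alpha>_def)
  have "2 * p = 2 * (\<alpha> + \<beta> * x)" "2 * s = 2 * (\<alpha> - \<beta> * x)"
    using arg_cong2[OF ps \<beta>(3), of "(+)"] arg_cong2[OF ps \<beta>(3), of "(-)"] by (simp_all add: algebra_simps)
  then have "p = \<alpha> + \<beta> * x" "s = \<alpha> - \<beta> * x" unfolding mult_left_cancel[OF two] .
  then have g': "g = lincomb v (\<alpha>, \<beta>)" using \<beta> by (simp add: gm e)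
  moreover have "\<alpha>\<^sup>2 - qf v * \<beta>\<^sup>2 = 1" using g(1) unfolding g' by (simp add: e algebra_simps power2_eq_square)
  ultimately show "g \<in> lincomb v ` norm_one (qf v)" by (auto simp: norm_one_def)
qed

lemma inj_lincomb:
  assumes two: "(2::'k::field) \<noteq> 0" and v: "(v :: 'k triple) \<noteq> (0, 0, 0)"
  shows "inj (lincomb v)"
proof (rule injI)
  fix s t assume st: "lincomb v s = lincomb v t"
  obtain \<alpha> \<beta> where s: "s = (\<alpha>, \<beta>)" by (cases s)
  obtain \<alpha>' \<beta>' where t: "t = (\<alpha>', \<beta>')" by (cases t)
  obtain x a b where e: "v = (x, a, b)" by (cases v)
  have h: "\<alpha> + \<beta> * x = \<alpha>' + \<beta>' * x" "\<alpha> - \<beta> * x = \<alpha>' - \<beta>' * x" "\<beta> * a = \<beta>' * a" "\<beta> * b = \<beta>' * b"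
    using st by (simp_all add: s t e)
  have "2 * \<alpha> = 2 * \<alpha>'" using arg_cong2[OF h(1,2), of "(+)"] by (simp add: algebra_simps)
  then have "\<alpha> = \<alpha>'" using two by simp
  moreover have "\<beta> = \<beta>'" using h v e \<open>\<alpha> = \<alpha>'\<close> by auto
  ultimately show "s = t" by (simp add: s t)
qed

lemma card_stab:
  fixes v :: "'k::{field,finite} triple"
  assumes two: "(2::'k) \<noteq> 0" and v: "v \<noteq> (0, 0, 0)"
  shows "card (stab v) = card (norm_one (qf v))"
  unfolding stab_eq_image[OF two v] using inj_lincomb[OF two v]
  by (metis card_image inj_on_subset subset_UNIV)

lemma card_norm_one_zero:
  assumes two: "(2::'k::{field,finite}) \<noteq> 0"
  shows "card (norm_one (0::'k)) = 2 * CARD('k)"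
proof -
  have "norm_one (0::'k) = {1, -1} \<times> UNIV"
    using power2_eq_iff[of _ "1::'k"] by (auto simp: norm_one_def)
  moreover have "(1::'k) \<noteq> -1" using two by (simp add: eq_neg_iff_add_eq_0)
  ultimately show ?thesis by (simp add: card_cartesian_product)
qed

text \<open>For \<open>\<Delta> = d\<^sup>2\<close> the norm form splits:
  \<open>u = \<alpha> + d * \<beta>\<close> is an arbitrary nonzero element and
  \<open>\<alpha> - d * \<beta>\<close> is its inverse.\<close>

lemma card_norm_one_nzsq:
  fixes \<Delta> :: "'k::{field,finite}"
  assumes two: "(2::'k) \<noteq> 0" and \<Delta>: "\<Delta> \<in> nzsq"
  shows "card (norm_one \<Delta>) = CARD('k) - 1"
proof -
  obtain d where d: "\<Delta> = d\<^sup>2" "d \<noteq> 0" using \<Delta> by (auto simp: nzsq_def)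
  have "bij_betw (\<lambda>(\<alpha>, \<beta>). \<alpha> + d * \<beta>) (norm_one \<Delta>) (- {0})"
  proof (rule bij_betwI[where g = "\<lambda>u. ((u + 1 / u) / 2, (u - 1 / u) / (2 * d))"])
    have f: "(\<alpha> + d * \<beta>) * (\<alpha> - d * \<beta>) = \<alpha>\<^sup>2 - \<Delta> * \<beta>\<^sup>2" for \<alpha> \<beta>
      by (simp add: d algebra_simps power2_eq_square)
    show "(\<lambda>(\<alpha>, \<beta>). \<alpha> + d * \<beta>) \<in> norm_one \<Delta> \<rightarrow> - {0}"
    proof clarsimp
      fix \<alpha> \<beta> assume "(\<alpha>, \<beta>) \<in> norm_one \<Delta>" "\<alpha> + d * \<beta> = 0"
      then show False using f[of \<alpha> \<beta>] by (simp add: norm_one_def)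
    qed
    have g: "((u + 1 / u) / 2, (u - 1 / u) / (2 * d)) \<in> norm_one \<Delta>" if "u \<noteq> 0" for u
    proof -
      have h: "(u + 1 / u) / 2 + d * ((u - 1 / u) / (2 * d)) = u"
        "(u + 1 / u) / 2 - d * ((u - 1 / u) / (2 * d)) = 1 / u"
        using d two four_neq_zero[OF two] by (simp_all add: field_simps)
      show ?thesis using f[of "(u + 1 / u) / 2" "(u - 1 / u) / (2 * d)"] that
        unfolding h by (simp add: norm_one_def)
    qed
    then show "(\<lambda>u. ((u + 1 / u) / 2, (u - 1 / u) / (2 * d))) \<in> - {0} \<rightarrow> norm_one \<Delta>" by auto
  next
    fix z assume z: "z \<in> norm_one \<Delta>"
    obtain \<alpha> \<beta> where e: "z = (\<alpha>, \<beta>)" by (cases z)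
    have f: "(\<alpha> + d * \<beta>) * (\<alpha> - d * \<beta>) = 1"
      using z by (simp add: norm_one_def e d algebra_simps power2_eq_square)
    then have "\<alpha> + d * \<beta> \<noteq> 0" by auto
    then have i: "1 / (\<alpha> + d * \<beta>) = \<alpha> - d * \<beta>" using f by (simp add: field_simps)
    show "(case case z of (\<alpha>, \<beta>) \<Rightarrow> \<alpha> + d * \<beta> of u \<Rightarrow> ((u + 1 / u) / 2, (u - 1 / u) / (2 * d))) = z"
      unfolding e prod.case i using two four_neq_zero[OF two] d by (simp add: field_simps)
  next
    fix u :: 'k assume "u \<in> - {0}"
    then show "(case ((u + 1 / u) / 2, (u - 1 / u) / (2 * d)) of (\<alpha>, \<beta>) \<Rightarrow> \<alpha> + d * \<beta>) = u"
      using d two four_neq_zero[OF two] by (simp add: field_simps)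
  qed
  then show ?thesis by (simp add: bij_betw_same_card card_nonzero)
qed

lemma norm_one_slope:
  fixes \<Delta> t :: "'k::field"
  assumes "1 - \<Delta> * t\<^sup>2 \<noteq> 0" (is "?d \<noteq> 0")
  shows "((1 + \<Delta> * t\<^sup>2) / ?d, 2 * t / ?d) \<in> norm_one \<Delta>"
proof -
  have "(1 + \<Delta> * t\<^sup>2)\<^sup>2 - \<Delta> * (2 * t)\<^sup>2 = ?d\<^sup>2" by (simp add: power2_eq_square algebra_simps)
  then have "((1 + \<Delta> * t\<^sup>2) / ?d)\<^sup>2 - \<Delta> * (2 * t / ?d)\<^sup>2 = ?d\<^sup>2 / ?d\<^sup>2"
    by (simp only: power_divide times_divide_eq_right diff_divide_distrib[symmetric])
  also have "\<dots> = 1" using assms by simp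
  finally show ?thesis by (simp only: norm_one_def mem_Collect_eq prod.case)
qed

text \<open>The lines of slope \<open>t\<close> through \<open>(-1, 0)\<close> parametrise the conic \<open>\<alpha>\<^sup>2 - \<Delta> \<beta>\<^sup>2 = 1\<close>.\<close>
lemma card_norm_one_nonsquare:
  fixes \<Delta> :: "'k::{field,finite}"
  assumes two: "(2::'k) \<noteq> 0" and \<Delta>: "\<Delta> \<notin> nzsq" "\<Delta> \<noteq> 0"
  shows "card (norm_one \<Delta>) = CARD('k) + 1"
proof -
  have nz: "1 - \<Delta> * t\<^sup>2 \<noteq> 0" for t
  proof
    assume "1 - \<Delta> * t\<^sup>2 = 0"
    then have "t \<noteq> 0" "\<Delta> * t\<^sup>2 = 1" by auto
    then have "t \<noteq> 0" "\<Delta> = (1 / t)\<^sup>2" by (auto simp: power_divide nonzero_eq_divide_eq)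
    then show False using \<Delta> square_in_nzsq[of "1 / t"] by simp
  qed
  let ?f = "\<lambda>t. ((1 + \<Delta> * t\<^sup>2) / (1 - \<Delta> * t\<^sup>2), 2 * t / (1 - \<Delta> * t\<^sup>2))"
  have p1: "(1 + \<Delta> * t\<^sup>2) / (1 - \<Delta> * t\<^sup>2) + 1 = 2 / (1 - \<Delta> * t\<^sup>2)" for t
    using nz[of t] by (simp add: field_simps)
  have "inj ?f"
  proof (rule injI)
    fix s t assume st: "?f s = ?f t"
    then have "2 / (1 - \<Delta> * s\<^sup>2) = 2 / (1 - \<Delta> * t\<^sup>2)" by (metis p1 prod.inject)
    then have "1 - \<Delta> * s\<^sup>2 = 1 - \<Delta> * t\<^sup>2" using two nz by (simp add: frac_eq_eq)
    then have "2 * s / (1 - \<Delta> * t\<^sup>2) = 2 * t / (1 - \<Delta> * t\<^sup>2)" using st by (metis prod.inject)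
    then show "s = t" using two nz[of t] by (simp only: divide_cancel_right mult_cancel_left) blast
  qed
  moreover have "norm_one \<Delta> = insert (-1, 0) (range ?f)"
  proof (rule Set.set_eqI, rule iffI)
    fix z assume z: "z \<in> norm_one \<Delta>"
    obtain \<alpha> \<beta> where e: "z = (\<alpha>, \<beta>)" by (cases z)
    have n: "\<alpha>\<^sup>2 - \<Delta> * \<beta>\<^sup>2 = 1" using z by (simp add: e norm_one_def)
    show "z \<in> insert (-1, 0) (range ?f)"
    proof (cases "\<alpha> = -1")
      case True
      then show ?thesis using n \<Delta> by (simp add: e)
    next
      case False
      then have a1: "\<alpha> + 1 \<noteq> 0" by (simp add: eq_neg_iff_add_eq_0)
      define t where "t = \<beta> / (\<alpha> + 1)"
      have "(1 - \<Delta> * t\<^sup>2) * (\<alpha> + 1)\<^sup>2 = (\<alpha> + 1)\<^sup>2 - \<Delta> * \<beta>\<^sup>2"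
        using a1 by (simp add: t_def power_divide left_diff_distrib)
      also have "\<dots> = 2 * (\<alpha> + 1)" using n by (simp add: power2_eq_square algebra_simps)
      finally have "(1 - \<Delta> * t\<^sup>2) * (\<alpha> + 1) * (\<alpha> + 1) = 2 * (\<alpha> + 1)"
        by (simp only: power2_eq_square mult.assoc)
      then have "(1 - \<Delta> * t\<^sup>2) * (\<alpha> + 1) = 2" unfolding mult_right_cancel[OF a1] .
      then have q: "2 / (1 - \<Delta> * t\<^sup>2) = \<alpha> + 1" using nz[of t] by (simp add: field_simps)
      have "2 * t / (1 - \<Delta> * t\<^sup>2) = t * (2 / (1 - \<Delta> * t\<^sup>2))" by simp
      also have "\<dots> = \<beta>" unfolding q using a1 by (simp add: t_def)
      finally have "\<beta> = 2 * t / (1 - \<Delta> * t\<^sup>2)" ..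
      moreover have "\<alpha> = (1 + \<Delta> * t\<^sup>2) / (1 - \<Delta> * t\<^sup>2)" using p1[of t] unfolding q by simp
      ultimately have "z = ?f t" by (simp add: e)
      then show ?thesis by blast
    qed
  next
    fix z assume "z \<in> insert (-1, 0) (range ?f)"
    then show "z \<in> norm_one \<Delta>"
    proof
      assume "z \<in> range ?f"
      then show ?thesis using norm_one_slope[OF nz] by blast
    qed (simp add: norm_one_def)
  qed
  moreover have "(-1, 0) \<notin> range ?f"
  proof
    assume "(-1, 0) \<in> range ?f"
    then obtain t where "(1 + \<Delta> * t\<^sup>2) / (1 - \<Delta> * t\<^sup>2) = -1" by auto
    then have "2 / (1 - \<Delta> * t\<^sup>2) = 0" using p1[of t] by simp
    then show False using two nz[of t] by simp
  qed
  ultimately show ?thesis by (simp add: card_image)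
qed

lemma card_SL2: "card (SL2 :: ('k::{field,finite} ^ 2 ^ 2) set) = (CARD('k) - 1) * CARD('k) * (CARD('k) + 1)"
proof -
  let ?f = "\<lambda>(p, q, r). mat2 p q r ((1 + q * r) / p) :: 'k ^ 2 ^ 2"
  let ?h = "\<lambda>(q, s). mat2 0 q (- 1 / q) s :: 'k ^ 2 ^ 2"
  let ?A = "(- {0::'k}) \<times> (UNIV :: ('k \<times> 'k) set)" and ?B = "(- {0::'k}) \<times> (UNIV :: 'k set)"
  have "SL2 = ?f ` ?A \<union> ?h ` ?B"
  proof (rule Set.set_eqI, rule iffI)
    fix g :: "'k ^ 2 ^ 2" assume g: "g \<in> SL2"
    obtain p q r s where e: "g = mat2 p q r s" by (rule mat2_cases)
    have d: "p * s - q * r = 1" using g by (simp add: e)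
    show "g \<in> ?f ` ?A \<union> ?h ` ?B"
    proof (cases "p = 0")
      case True
      then have "r * q = - 1" using d by (simp add: minus_equation_iff mult.commute)
      moreover from this have q0: "q \<noteq> 0" by auto
      ultimately have "r = - 1 / q" by (simp only: nonzero_eq_divide_eq[OF q0])
      then have "g = ?h (q, s)" "(q, s) \<in> ?B" using True q0 by (auto simp: e)
      then show ?thesis by blast
    next
      case False
      then have "s = (1 + q * r) / p" using d by (simp add: field_simps)
      then have "g = ?f (p, q, r)" "(p, q, r) \<in> ?A" using False by (auto simp: e)
      then show ?thesis by blast
    qed
  qed (auto split: if_splits)
  moreover have "?f ` ?A \<inter> ?h ` ?B = {}" by auto
  moreover have "card (?f ` ?A) = (CARD('k) - 1) * (CARD('k) * CARD('k))"
    by (subst card_image) (auto simp: inj_on_def card_cartesian_product card_nonzero simp flip: UNIV_Times_UNIV)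
  moreover have "card (?h ` ?B) = (CARD('k) - 1) * CARD('k)"
    by (subst card_image) (auto simp: inj_on_def card_cartesian_product card_nonzero)
  ultimately show ?thesis by (simp add: card_Un_disjoint algebra_simps)
qed

lemma card_qf_nonsquare:
  fixes \<nu> :: "'k::{field,finite}"
  assumes "\<nu> \<notin> nzsq" "\<nu> \<noteq> 0"
  shows "card {v. qf v = \<nu>} = CARD('k) * (CARD('k) - 1)"
proof -
  let ?f = "\<lambda>(x, a). (x, a, (\<nu> - x\<^sup>2) / a)"
  have "{v. qf v = \<nu>} = ?f ` (UNIV \<times> - {0})"
  proof (rule Set.set_eqI, rule iffI)
    fix v assume v: "v \<in> {v. qf v = \<nu>}"
    obtain x a b where e: "v = (x, a, b)" by (cases v)
    have q: "x\<^sup>2 + a * b = \<nu>" using v by (simp add: e)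
    have "a \<noteq> 0"
    proof
      assume "a = 0"
      then have "\<nu> = x\<^sup>2" using q by simp
      then show False using assms square_in_nzsq[of x] by auto
    qed
    moreover from this have "b = (\<nu> - x\<^sup>2) / a" using q by (auto simp: field_simps)
    ultimately show "v \<in> ?f ` (UNIV \<times> - {0})" by (auto simp: e)
  qed (auto split: if_splits)
  moreover have "inj_on ?f (UNIV \<times> - {0})" by (auto simp: inj_on_def)
  ultimately show ?thesis by (simp add: card_image card_cartesian_product card_nonzero)
qed

lemma card_qf_one:
  assumes two: "(2::'k::{field,finite}) \<noteq> 0"
  shows "card {v. qf v = (1::'k)} = CARD('k) * (CARD('k) + 1)"
proof -
  let ?f = "\<lambda>(x, a). (x, a, (1 - x\<^sup>2) / a) :: 'k triple"
  let ?h = "\<lambda>(x, b). (x, 0, b) :: 'k triple"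
  have "{v. qf v = (1::'k)} = ?f ` (UNIV \<times> - {0}) \<union> ?h ` ({1, -1} \<times> UNIV)"
  proof (rule Set.set_eqI, rule iffI)
    fix v assume v: "v \<in> {v. qf v = (1::'k)}"
    obtain x a b where e: "v = (x, a, b)" by (cases v)
    have q: "x\<^sup>2 + a * b = 1" using v by (simp add: e)
    show "v \<in> ?f ` (UNIV \<times> - {0}) \<union> ?h ` ({1, -1} \<times> UNIV)"
    proof (cases "a = 0")
      case True
      then have "x \<in> {1, -1}" using q power2_eq_iff[of x 1] by simp
      then show ?thesis using True by (auto simp: e image_iff)
    next
      case False
      then have "b = (1 - x\<^sup>2) / a" using q by (auto simp: field_simps)
      then show ?thesis using False by (auto simp: e image_iff)
    qed
  qed (auto split: if_splits)
  moreover have "?f ` (UNIV \<times> - {0}) \<inter> ?h ` ({1, -1} \<times> UNIV) = {}" by auto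
  moreover have "card (?f ` (UNIV \<times> - {0})) = CARD('k) * (CARD('k) - 1)"
    by (subst card_image) (auto simp: inj_on_def card_cartesian_product card_nonzero)
  moreover have "(1::'k) \<noteq> -1" using two by (simp add: eq_neg_iff_add_eq_0)
  then have "card (?h ` ({1, -1} \<times> UNIV)) = 2 * CARD('k)"
    by (subst card_image) (auto simp: inj_on_def card_cartesian_product)
  moreover have "CARD('k) \<ge> 1" by (simp add: Suc_leI)
  ultimately show ?thesis by (simp add: card_Un_disjoint algebra_simps)
qed

section \<open>Orbits of \<open>SL(2, q)\<close> and scalar products\<close>

lemma card_stab_nonsquare:
  fixes v :: "'k::{field,finite} triple"
  assumes two: "(2::'k) \<noteq> 0" and v: "qf v \<notin> nzsq" "qf v \<noteq> 0"
  shows "card (stab v) = CARD('k) + 1"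
  using card_norm_one_nonsquare[OF two v] v by (subst card_stab[OF two]) auto

lemma card_stab_nzsq:
  fixes v :: "'k::{field,finite} triple"
  assumes two: "(2::'k) \<noteq> 0" and v: "qf v \<in> nzsq"
  shows "card (stab v) = CARD('k) - 1"
  using card_norm_one_nzsq[OF two v] v by (subst card_stab[OF two]) auto

text \<open>Kept abstract because three actions use it: on triples, on points and on blocks.\<close>

locale SL2_action =
  fixes act :: "'k::{field,finite} ^ 2 ^ 2 \<Rightarrow> 'b \<Rightarrow> 'b" and \<Omega> :: "'b set"
  assumes closed: "g \<in> SL2 \<Longrightarrow> \<omega> \<in> \<Omega> \<Longrightarrow> act g \<omega> \<in> \<Omega>"
    and mult: "g \<in> SL2 \<Longrightarrow> h \<in> SL2 \<Longrightarrow> \<omega> \<in> \<Omega> \<Longrightarrow> act (g ** h) \<omega> = act g (act h \<omega>)"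
    and one: "\<omega> \<in> \<Omega> \<Longrightarrow> act (mat 1) \<omega> = \<omega>"
begin

lemma act_eq_iff:
  assumes "g \<in> SL2" "h \<in> SL2" "\<omega> \<in> \<Omega>"
  shows "act g \<omega> = act h \<omega> \<longleftrightarrow> act (adj2 h ** g) \<omega> = \<omega>"
proof -
  have h: "adj2 h \<in> SL2" by (rule adj2_inverse[OF assms(2)])
  have "act (adj2 h) (act h \<omega>) = \<omega>" "act h (act (adj2 h) (act g \<omega>)) = act g \<omega>"
    using assms h mult[OF h assms(2,3)] mult[OF assms(2) h closed[OF assms(1,3)]]
    by (simp_all add: adj2_inverse one closed)
  then show ?thesis using mult[OF h assms(1,3)] by metis
qed

lemma card_orbit:
  assumes \<omega>: "\<omega> \<in> \<Omega>"
  shows "card (SL2 :: ('k ^ 2 ^ 2) set) = card {g \<in> SL2. act g \<omega> = \<omega>} * card ((\<lambda>g. act g \<omega>) ` SL2)"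
proof (rule card_eq_card_fibre_times_image)
  fix \<eta> assume "\<eta> \<in> (\<lambda>g. act g \<omega>) ` SL2"
  then obtain g where g: "g \<in> SL2" "\<eta> = act g \<omega>" by blast
  have "bij_betw ((**) g) {h \<in> SL2. act h \<omega> = \<omega>} {h \<in> SL2. act h \<omega> = \<eta>}"
  proof (rule bij_betwI[where g = "(**) (adj2 g)"])
    show "(**) g \<in> {h \<in> SL2. act h \<omega> = \<omega>} \<rightarrow> {h \<in> SL2. act h \<omega> = \<eta>}"
      using g \<omega> by (auto simp: mult det_mul)
    show "(**) (adj2 g) \<in> {h \<in> SL2. act h \<omega> = \<eta>} \<rightarrow> {h \<in> SL2. act h \<omega> = \<omega>}"
      using g \<omega> act_eq_iff[OF _ g(1) \<omega>] adj2_inverse(3)[OF g(1)] by (auto simp: det_mul)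
  qed (simp_all add: matrix_mul_assoc adj2_inverse[OF g(1)])
  then show "card {h \<in> SL2. act h \<omega> = \<eta>} = card {h \<in> SL2. act h \<omega> = \<omega>}"
    by (simp add: bij_betw_same_card)
qed simp

end

interpretation ad: SL2_action "ad :: 'k::{field,finite} ^ 2 ^ 2 \<Rightarrow> _" UNIV
  by unfold_locales (simp_all add: ad_mult)

lemma card_SL2_orbit:
  fixes v :: "'k::{field,finite} triple"
  shows "card (SL2 :: ('k ^ 2 ^ 2) set) = card (stab v) * card ((\<lambda>g. ad g v) ` SL2)"
  unfolding stab_def by (rule ad.card_orbit) simp

text \<open>Transitivity by counting: with stabiliser of order \<open>q + 1\<close> an orbit has
  \<open>q (q - 1)\<close> elements, which is the number of all vectors of that norm.\<close>

lemma SL2_transitive_nonsquare: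
  fixes v w :: "'k::{field,finite} triple"
  assumes two: "(2::'k) \<noteq> 0" and v: "qf v \<notin> nzsq" "qf v \<noteq> 0" and w: "qf w = qf v"
  obtains g where "g \<in> SL2" "ad g v = w"
proof -
  let ?O = "(\<lambda>g. ad g v) ` SL2"
  have "(CARD('k) + 1) * card ?O = (CARD('k) + 1) * (CARD('k) * (CARD('k) - 1))"
    using card_SL2_orbit[of v] unfolding card_stab_nonsquare[OF two v] card_SL2 by (simp add: mult_ac)
  then have "card ?O = card {u. qf u = qf v}" 
    unfolding card_qf_nonsquare[OF v] by (subst (asm) nat_mult_eq_cancel1) simp_all
  then have "?O = {u. qf u = qf v}" by (rule card_subset_eq[rotated 2]) (use v in auto)
  then have "w \<in> ?O" using w by simp
  then show ?thesis using that by blast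
qed

lemma SL2_transitive_one:
  fixes v w :: "'k::{field,finite} triple"
  assumes two: "(2::'k) \<noteq> 0" and v: "qf v = 1" and w: "qf w = 1"
  obtains g where "g \<in> SL2" "ad g v = w"
proof -
  let ?O = "(\<lambda>g. ad g v) ` SL2"
  have q: "CARD('k) - 1 > 0" using two by (metis card_nonzero card_gt_0_iff finite ComplI empty_iff singletonD)
  have "(CARD('k) - 1) * card ?O = (CARD('k) - 1) * (CARD('k) * (CARD('k) + 1))"
    using card_SL2_orbit[of v] v unfolding card_SL2 card_stab_nzsq[OF two, of v, unfolded v, OF one_in_nzsq]
    by (simp only: mult_ac)
  then have "card ?O = card {u. qf u = (1::'k)}" unfolding card_qf_one[OF two] 
    unfolding nat_mult_eq_cancel1[OF q] .
  then have "?O = {u. qf u = 1}" by (rule card_subset_eq[rotated 2]) (use v in auto)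
  then have "w \<in> ?O" using w by simp
  then show ?thesis using that by blast
qed

text \<open>With \<open>y = \<nu> * a - g\<close> the conditions become
  \<open>y\<^sup>2 - \<nu> * x\<^sup>2 = N\<close> for \<open>N = g\<^sup>2 - \<nu>\<^sup>2\<close>,
  which is nonzero. The solutions are the elements of norm \<open>N\<close> in the quadratic
  extension, permuted simply transitively by those of norm one.\<close>

lemma card_qf_bil:
  fixes \<nu> g :: "'k::{field,finite}"
  assumes two: "(2::'k) \<noteq> 0" and \<nu>: "\<nu> \<notin> nzsq" "\<nu> \<noteq> 0" and g: "g\<^sup>2 \<noteq> \<nu>\<^sup>2"
  shows "card {w. qf w = \<nu> \<and> bil (0, 1, \<nu>) w = g} = CARD('k) + 1"
proof -
  have "1 \<noteq> (0::'k)" "- \<nu> \<noteq> 0" using \<nu> by auto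
  then obtain z0 x0 where z0: "1 * z0\<^sup>2 + (- \<nu>) * x0\<^sup>2 = g\<^sup>2 - \<nu>\<^sup>2"
    using binary_form_universal[OF two] by metis
  define N where "N = g\<^sup>2 - \<nu>\<^sup>2"
  have N: "z0\<^sup>2 - \<nu> * x0\<^sup>2 = N" "N \<noteq> 0" using z0 g by (simp_all add: N_def)
  \<comment> \<open>With \<open>r\<close> a square root of \<nu>, \<open>?f\<close> multiplies
    \<open>z0 + x0 r\<close> by \<open>\<alpha> + \<beta> r\<close>, and \<open>?h\<close> divides
    \<open>y + x r\<close> by \<open>z0 + x0 r\<close>.\<close>
  let ?f = "\<lambda>(\<alpha>, \<beta>). (\<alpha> * x0 + \<beta> * z0, (\<alpha> * z0 + \<nu> * \<beta> * x0 + g) / \<nu>, g - (\<alpha> * z0 + \<nu> * \<beta> * x0))"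
  let ?h = "\<lambda>(x, a, b). ((z0 * (\<nu> * a - g) - \<nu> * x0 * x) / N, (z0 * x - x0 * (\<nu> * a - g)) / N)"
  let ?W = "{w. qf w = \<nu> \<and> bil (0, 1, \<nu>) w = g}"
  have form: "w \<in> ?W \<longleftrightarrow> (\<exists>x a. w = (x, a, 2 * g - \<nu> * a) \<and> (\<nu> * a - g)\<^sup>2 - \<nu> * x\<^sup>2 = N)" for w
  proof -
    obtain x a b where e: "w = (x, a, b)" by (cases w)
    have "bil (0, 1, \<nu>) w = g \<longleftrightarrow> b = 2 * g - \<nu> * a" using two by (auto simp: e field_simps)
    moreover have "x\<^sup>2 + a * (2 * g - \<nu> * a) = \<nu> \<longleftrightarrow> (\<nu> * a - g)\<^sup>2 - \<nu> * x\<^sup>2 = N"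
    proof -
      have "(\<nu> * a - g)\<^sup>2 - \<nu> * x\<^sup>2 - N = \<nu> * (\<nu> - (x\<^sup>2 + a * (2 * g - \<nu> * a)))"
        by (simp add: N_def algebra_simps power2_eq_square)
      then show ?thesis using \<nu> by (metis eq_iff_diff_eq_0 mult_eq_0_iff)
    qed
    ultimately show ?thesis by (auto simp: e)
  qed
  have "bij_betw ?f (norm_one \<nu>) ?W"
  proof (rule bij_betwI[where g = ?h])
    show "?f \<in> norm_one \<nu> \<rightarrow> ?W"
    proof
      fix z assume z: "z \<in> norm_one \<nu>"
      obtain \<alpha> \<beta> where e: "z = (\<alpha>, \<beta>)" by (cases z)
      let ?a = "(\<alpha> * z0 + \<nu> * \<beta> * x0 + g) / \<nu>"
      have a: "\<nu> * ?a = \<alpha> * z0 + \<nu> * \<beta> * x0 + g" using \<nu> by simp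
      have "(\<alpha> * z0 + \<nu> * \<beta> * x0)\<^sup>2 - \<nu> * (\<alpha> * x0 + \<beta> * z0)\<^sup>2 = (\<alpha>\<^sup>2 - \<nu> * \<beta>\<^sup>2) * (z0\<^sup>2 - \<nu> * x0\<^sup>2)"
        by (simp add: algebra_simps power2_eq_square)
      also have "\<dots> = N" using z N by (simp add: norm_one_def e)
      finally have "(\<nu> * ?a - g)\<^sup>2 - \<nu> * (\<alpha> * x0 + \<beta> * z0)\<^sup>2 = N" unfolding a by simp
      moreover have "?f z = (\<alpha> * x0 + \<beta> * z0, ?a, 2 * g - \<nu> * ?a)" unfolding a by (simp add: e)
      ultimately show "?f z \<in> ?W" unfolding form by blast
    qed
    show "?h \<in> ?W \<rightarrow> norm_one \<nu>"
    proof
      fix w assume "w \<in> ?W"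
      then obtain x a where w: "w = (x, a, 2 * g - \<nu> * a)" "(\<nu> * a - g)\<^sup>2 - \<nu> * x\<^sup>2 = N" unfolding form by blast
      define y where "y = \<nu> * a - g"
      have "(z0 * y - \<nu> * x0 * x)\<^sup>2 - \<nu> * (z0 * x - x0 * y)\<^sup>2 = (z0\<^sup>2 - \<nu> * x0\<^sup>2) * (y\<^sup>2 - \<nu> * x\<^sup>2)"
        by (simp add: algebra_simps power2_eq_square)
      then have "(z0 * y - \<nu> * x0 * x)\<^sup>2 - \<nu> * (z0 * x - x0 * y)\<^sup>2 = N\<^sup>2"
        using w(2) N(1) unfolding y_def by (simp add: power2_eq_square)
      then have "((z0 * y - \<nu> * x0 * x)\<^sup>2 - \<nu> * (z0 * x - x0 * y)\<^sup>2) / N\<^sup>2 = 1" using N(2) by simp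
      then show "?h w \<in> norm_one \<nu>" unfolding w norm_one_def prod.case y_def[symmetric]
        by (simp only: mem_Collect_eq prod.case power_divide times_divide_eq_right diff_divide_distrib[symmetric])
    qed
  next
    fix z assume "z \<in> norm_one \<nu>"
    obtain \<alpha> \<beta> where e: "z = (\<alpha>, \<beta>)" by (cases z)
    have "\<nu> * ((\<alpha> * z0 + \<nu> * \<beta> * x0 + g) / \<nu>) - g = \<alpha> * z0 + \<nu> * \<beta> * x0" using \<nu> by simp
    moreover have "z0 * (\<alpha> * z0 + \<nu> * \<beta> * x0) - \<nu> * x0 * (\<alpha> * x0 + \<beta> * z0) = \<alpha> * N"
      "z0 * (\<alpha> * x0 + \<beta> * z0) - x0 * (\<alpha> * z0 + \<nu> * \<beta> * x0) = \<beta> * N"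
      unfolding N(1)[symmetric] by (simp_all add: algebra_simps power2_eq_square)
    ultimately show "?h (?f z) = z" unfolding e prod.case using N(2) by simp
  next
    fix w assume "w \<in> ?W"
    then obtain x a where w: "w = (x, a, 2 * g - \<nu> * a)" unfolding form by blast
    define y where "y = \<nu> * a - g"
    have a: "a = (y + g) / \<nu>" "2 * g - \<nu> * a = g - y" using \<nu> by (simp_all add: y_def)
    have "(z0 * y - \<nu> * x0 * x) * x0 + (z0 * x - x0 * y) * z0 = x * N"
      "(z0 * y - \<nu> * x0 * x) * z0 + \<nu> * (z0 * x - x0 * y) * x0 = y * N"
      unfolding N(1)[symmetric] by (simp_all add: algebra_simps power2_eq_square)
    then have "(z0 * y - \<nu> * x0 * x) / N * x0 + (z0 * x - x0 * y) / N * z0 = x"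
      "(z0 * y - \<nu> * x0 * x) / N * z0 + \<nu> * ((z0 * x - x0 * y) / N) * x0 = y"
      using N(2) by (simp_all add: add_divide_distrib[symmetric] nonzero_divide_eq_eq mult.commute mult.left_commute)
    then show "?f (?h w) = w" unfolding w prod.case y_def[symmetric] a(2) by (simp add: a(1))
  qed
  then show ?thesis using card_norm_one_nonsquare[OF two \<nu>] by (simp add: bij_betw_same_card)
qed

section \<open>Stabilisers of lines and dihedral subgroups\<close>

text \<open>Equality in \<open>PSL(2, q)\<close>, computed on matrices.\<close>

definition pm :: "'k::field ^ 2 ^ 2 \<Rightarrow> 'k ^ 2 ^ 2 \<Rightarrow> bool" where
  "pm g h \<longleftrightarrow> g = h \<or> g = - h"

lemma pm_refl [simp, intro]: "pm g g"
  by (simp add: pm_def)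

lemma pm_uminus [simp]: "pm (- g) h \<longleftrightarrow> pm g h" "pm g (- h) \<longleftrightarrow> pm g h"
  by (auto simp: pm_def)

lemma pm_sym: "pm g h \<Longrightarrow> pm h g"
  by (auto simp: pm_def)

lemma pm_trans: "pm g h \<Longrightarrow> pm h k \<Longrightarrow> pm g k"
  by (auto simp: pm_def)

lemma pm_mult: "pm g g' \<Longrightarrow> pm h h' \<Longrightarrow> pm (g ** h) (g' ** h')"
  unfolding pm_def by (elim disjE) (simp_all add: minus_matrix_mult)

lemma matrix_neq_uminus:
  assumes two: "(2::'k::field) \<noteq> 0" and g: "(g :: 'k ^ 2 ^ 2) \<in> SL2"
  shows "g \<noteq> - g"
proof
  assume e: "g = - g"
  obtain p q r s where m: "g = mat2 p q r s" by (rule mat2_cases)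
  have "p = 0" "q = 0" using e by (simp_all add: m self_eq_uminus[OF two])
  then show False using g by (simp add: m)
qed

lemma stab_pm_closed:
  assumes "g \<in> stab_pm v" "h \<in> stab_pm v"
  shows "g ** h \<in> stab_pm v" "adj2 g \<in> stab_pm v"
proof -
  have t: "tneg u = w \<longleftrightarrow> u = tneg w" for u w :: "'a triple" by auto
  show "g ** h \<in> stab_pm v" using assms SL2_mult by (auto simp: stab_pm_def ad_mult ad_tneg)
  have g: "g \<in> SL2" using assms(1) by (simp add: stab_pm_def)
  have "ad (adj2 g) v = v \<or> ad (adj2 g) v = tneg v"
    using assms(1) ad_adj2(1)[OF g, of v] by (auto simp: stab_pm_def ad_tneg t)
  then show "adj2 g \<in> stab_pm v" using adj2_inverse(3)[OF g] by (simp add: stab_pm_def)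
qed

lemma stab_pm_one: "mat 1 \<in> stab_pm v"
  by (simp add: stab_pm_def)

lemma stab_pm_uminus: "g \<in> stab_pm v \<Longrightarrow> - g \<in> stab_pm v"
  using SL2_uminus by (auto simp: stab_pm_def)

lemma pm_stab_pm: "pm g h \<Longrightarrow> g \<in> stab_pm v \<Longrightarrow> h \<in> stab_pm v"
  using stab_pm_uminus[of g v] by (auto simp: pm_def)

lemma stab_subset_stab_pm: "stab v \<subseteq> stab_pm v"
  by (auto simp: stab_def stab_pm_def)

text \<open>\<open>stab v\<close> has index one or two in \<open>stab_pm v\<close>. Divisibility
  avoids deciding whether some element sends \<open>v\<close> to its negative.\<close>

lemma card_stab_pm_dvd:
  fixes v :: "'k::{field,finite} triple"
  assumes two: "(2::'k) \<noteq> 0" and v: "v \<noteq> (0, 0, 0)"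
  shows "card (stab_pm v) dvd 2 * card (stab v)"
proof (cases "stab_pm v \<subseteq> stab v")
  case True
  then have "stab_pm v = stab v" using stab_subset_stab_pm by blast
  then show ?thesis by simp
next
  case False
  then obtain h where h: "h \<in> SL2" "ad h v = tneg v" by (auto simp: stab_def stab_pm_def)
  have vn: "tneg v \<noteq> v" by (rule tneg_neq[OF two v])
  have dj: "stab v \<inter> (**) h ` stab v = {}"
    using h vn by (auto simp: stab_def ad_mult)
  have "stab_pm v = stab v \<union> (**) h ` stab v"
  proof
    show "stab v \<union> (**) h ` stab v \<subseteq> stab_pm v"
      using h SL2_mult by (auto simp: stab_def stab_pm_def ad_mult)
    show "stab_pm v \<subseteq> stab v \<union> (**) h ` stab v"
    proof
      fix g assume g: "g \<in> stab_pm v"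
      show "g \<in> stab v \<union> (**) h ` stab v"
      proof (cases "ad g v = v")
        case True
        then show ?thesis using g by (auto simp: stab_def stab_pm_def)
      next
        case False
        then have "ad g v = ad h v" using g h by (auto simp: stab_pm_def)
        then have "adj2 h ** g \<in> stab v"
          using g h(1) SL2_mult adj2_inverse(3)[OF h(1)] ad_adj2(1)[OF h(1), of v]
          by (simp add: stab_def stab_pm_def ad_mult det_mul)
        moreover have "g = h ** (adj2 h ** g)" by (simp add: matrix_mul_assoc adj2_inverse[OF h(1)])
        ultimately show ?thesis by blast
      qed
    qed
  qed
  moreover have "inj_on ((**) h) (stab v)"
  proof (rule inj_onI)
    fix a b assume "h ** a = h ** b"
    then have "adj2 h ** (h ** a) = adj2 h ** (h ** b)" by simp
    then show "a = b" by (simp add: matrix_mul_assoc adj2_inverse[OF h(1)])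
  qed
  ultimately have "card (stab_pm v) = card (stab v) + card (stab v)"
    using dj by (simp add: card_Un_disjoint card_image)
  then show ?thesis by (simp only: mult_2 dvd_refl)
qed

lemma SL_simps [simp]:
  "carrier SL = SL2" "x \<otimes>\<^bsub>SL\<^esub> y = x ** y" "\<one>\<^bsub>SL\<^esub> = mat 1"
  by (simp_all add: SL_def)

lemma SL_inv: "g \<in> SL2 \<Longrightarrow> inv\<^bsub>SL\<^esub> g = adj2 (g :: 'k::field ^ 2 ^ 2)"
  using group.inv_equality[OF group_SL, of "adj2 g" g] adj2_inverse[of g] by simp

lemma subgroup_stab_pm: "subgroup (stab_pm v) (SL :: ('k::field ^ 2 ^ 2) monoid)"
proof (rule group.subgroupI[OF group_SL])
  show "stab_pm v \<subseteq> carrier SL" by (auto simp: stab_pm_def)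
  show "stab_pm v \<noteq> {}" using stab_pm_one by blast
  fix g h :: "'k ^ 2 ^ 2" assume "g \<in> stab_pm v" "h \<in> stab_pm v"
  moreover from this have "g \<in> SL2" by (simp add: stab_pm_def)
  ultimately show "inv\<^bsub>SL\<^esub> g \<in> stab_pm v" "g \<otimes>\<^bsub>SL\<^esub> h \<in> stab_pm v"
    unfolding SL_simps using stab_pm_closed SL_inv[of g] by simp_all
qed

lemma card_subgroup_dvd_stab:
  fixes v :: "'k::{field,finite} triple"
  assumes two: "(2::'k) \<noteq> 0" and v: "v \<noteq> (0, 0, 0)"
    and S: "subgroup S SL" "S \<subseteq> stab_pm v"
  shows "card S dvd 2 * card (stab v)"
proof -
  let ?H = "SL\<lparr>carrier := stab_pm v\<rparr>"
  have "group ?H" by (rule group.subgroup_imp_group[OF group_SL subgroup_stab_pm])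
  moreover have "subgroup S ?H"
    by (rule group.subgroup_incl[OF group_SL S(1) subgroup_stab_pm S(2)])
  ultimately have "card (rcosets\<^bsub>?H\<^esub> S) * card S = order ?H" by (rule group.lagrange)
  then have "card S dvd card (stab_pm v)" 
    using dvd_triv_right[of "card S" "card (rcosets\<^bsub>?H\<^esub> S)"] by (simp add: order_def)
  then show ?thesis using card_stab_pm_dvd[OF two v] by (rule dvd_trans)
qed

text \<open>\<open>card (stab v)\<close> is \<open>q - 1\<close>, \<open>2 q\<close> or
  \<open>q + 1\<close> for square, zero and nonsquare norm; only the last is a multiple of
  \<open>q + 1\<close>.\<close>

lemma stab_pm_type_nonsquare:
  fixes v :: "'k::{field,finite} triple"
  assumes two: "(2::'k) \<noteq> 0" and q: "CARD('k) > 5" and v: "v \<noteq> (0, 0, 0)"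
    and S: "subgroup S SL" "S \<subseteq> stab_pm v" and card_S: "card S = 2 * (CARD('k) + 1)"
  shows "qf v \<notin> nzsq" "qf v \<noteq> 0" "S = stab_pm v"
proof -
  let ?q = "CARD('k)"
  have d: "?q + 1 dvd card (stab v)"
    using card_subgroup_dvd_stab[OF two v S] unfolding card_S nat_mult_dvd_cancel_disj by simp
  show ns: "qf v \<notin> nzsq"
  proof
    assume "qf v \<in> nzsq"
    then have "?q + 1 dvd ?q - 1" using d card_stab_nzsq[OF two] by simp
    then show False using q dvd_imp_le[of "?q + 1" "?q - 1"] by simp
  qed
  show nz: "qf v \<noteq> 0"
  proof
    assume "qf v = 0"
    then have "?q + 1 dvd 2 * ?q" using d card_stab[OF two v] card_norm_one_zero[OF two] by simp
    from dvd_diff_nat[OF dvd_triv_right this] have "?q + 1 dvd 2 * (?q + 1) - 2 * ?q" .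
    then show False using q dvd_imp_le[of "?q + 1" 2] by simp
  qed
  have "card (stab_pm v) \<le> card S"
    using dvd_imp_le[OF card_stab_pm_dvd[OF two v]] card_stab_nonsquare[OF two ns nz] card_S by simp
  then show "S = stab_pm v" by (intro card_seteq S(2)) simp_all
qed

text \<open>For zero or nonsquare norm \<open>q - 1\<close> would divide \<open>2 q\<close> or
  \<open>q + 1\<close>, hence 2.\<close>

lemma stab_pm_type_square:
  fixes v :: "'k::{field,finite} triple"
  assumes two: "(2::'k) \<noteq> 0" and q: "CARD('k) > 5" and v: "v \<noteq> (0, 0, 0)"
    and S: "subgroup S SL" "S \<subseteq> stab_pm v" and card_S: "card S = 2 * (CARD('k) - 1)"
  shows "qf v \<in> nzsq" "S = stab_pm v"
proof -
  let ?q = "CARD('k)"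
  have d: "?q - 1 dvd card (stab v)"
    using card_subgroup_dvd_stab[OF two v S] unfolding card_S nat_mult_dvd_cancel_disj by simp
  have nz: "qf v \<noteq> 0"
  proof
    assume "qf v = 0"
    then have "?q - 1 dvd 2 * ?q" using d card_stab[OF two v] card_norm_one_zero[OF two] by simp
    then have "?q - 1 dvd 2 * ?q - 2 * (?q - 1)" by (intro dvd_diff_nat) simp_all
    moreover have "2 * ?q - 2 * (?q - 1) = 2" using q by simp
    ultimately show False using q dvd_imp_le[of "?q - 1" 2] by simp
  qed
  show sq: "qf v \<in> nzsq"
  proof (rule ccontr)
    assume "qf v \<notin> nzsq"
    then have "?q - 1 dvd ?q + 1" using d card_stab_nonsquare[OF two _ nz] by simp
    from dvd_diff_nat[OF this dvd_refl] have "?q - 1 dvd (?q + 1) - (?q - 1)" .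
    moreover have "(?q + 1) - (?q - 1) = 2" using q by simp
    ultimately show False using q dvd_imp_le[of "?q - 1" 2] by simp
  qed
  have "card (stab_pm v) \<le> card S"
    using dvd_imp_le[OF card_stab_pm_dvd[OF two v]] card_stab_nzsq[OF two sq] card_S q by simp
  then show "S = stab_pm v" by (intro card_seteq S(2)) simp_all
qed

text \<open>The projection along the scalar matrices. It commutes with conjugation, and taking the
  adjugate negates it, so an element conjugating \<open>g\<close> to itself or its inverse, up to
  sign, preserves the line of this vector.\<close>

definition traceless_part :: "'k::field ^ 2 ^ 2 \<Rightarrow> 'k triple" where
  "traceless_part g = ((g $ 1 $ 1 - g $ 2 $ 2) / 2, g $ 1 $ 2, g $ 2 $ 1)"

lemma traceless_part_mat2 [simp]: "traceless_part (mat2 p q r s) = ((p - s) / 2, q, r)"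
  by (simp add: traceless_part_def)

lemma traceless_part_conj:
  assumes two: "(2::'k::field) \<noteq> 0"
  shows "traceless_part (h ** g ** adj2 h) = ad h (traceless_part (g :: 'k ^ 2 ^ 2))"
proof -
  obtain p q r s where h: "h = mat2 p q r s" by (rule mat2_cases)
  obtain a b c d where g: "g = mat2 a b c d" by (rule mat2_cases)
  define x where "x = (a - d) / 2"
  have "2 * x = a - d" unfolding x_def by (simp only: times_divide_eq_right nonzero_mult_div_cancel_left[OF two])
  then have a: "a = d + 2 * x" by simp
  have t: "traceless_part g = (x, b, c)" by (simp add: g x_def)
  show ?thesis unfolding t unfolding g h a using two
    by (simp add: field_simps power2_eq_square)
qed

lemma traceless_part_uminus: "traceless_part (- g) = tneg (traceless_part g)"
  by (cases g rule: mat2_cases) (simp add: diff_divide_distrib)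

lemma traceless_part_adj2: "traceless_part (adj2 g) = tneg (traceless_part g)"
  by (cases g rule: mat2_cases) (simp add: diff_divide_distrib)

lemma traceless_part_eq_zeroD:
  assumes two: "(2::'k::field) \<noteq> 0" and g: "(g :: 'k ^ 2 ^ 2) \<in> SL2" "traceless_part g = (0, 0, 0)"
  shows "pm g (mat 1)"
proof -
  obtain p q r s where m: "g = mat2 p q r s" by (rule mat2_cases)
  have "p = s" "q = 0" "r = 0" using g(2) two by (simp_all add: m)
  then show ?thesis using g(1) power2_eq_iff[of s 1] by (auto simp: pm_def m mat_one_eq_mat2 power2_eq_square)
qed

text \<open>The vector is the traceless part of a lift \<open>g\<close> of the generating rotation:
  every element of the dihedral group conjugates that rotation to itself or to its inverse.\<close>

lemma dihedral_preimage:
  fixes \<theta> :: "'k::{field,finite} ^ 2 ^ 2 \<Rightarrow> int \<times> bool"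
  assumes two: "(2::'k) \<noteq> 0" and n: "even n" "n \<ge> 4"
    and S: "subgroup S SL" and surj: "\<theta> ` S = carrier (dihedral n)"
    and hom: "\<And>g h. g \<in> S \<Longrightarrow> h \<in> S \<Longrightarrow> \<theta> (g ** h) = \<theta> g \<otimes>\<^bsub>dihedral n\<^esub> \<theta> h"
    and ker: "\<And>g h. g \<in> S \<Longrightarrow> h \<in> S \<Longrightarrow> \<theta> g = \<theta> h \<longleftrightarrow> pm g h"
    and neg: "\<And>g. g \<in> S \<Longrightarrow> - g \<in> S"
  shows "card S = 2 * n" "\<exists>v. v \<noteq> (0, 0, 0) \<and> S \<subseteq> stab_pm v"
proof -
  define m where "m = int (n div 2)"
  have m: "m \<ge> 2" using n by (auto simp: m_def)
  have S2: "S \<subseteq> SL2" using subgroup.subset[OF S] by simp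
  have mult: "g \<in> S \<Longrightarrow> h \<in> S \<Longrightarrow> g ** h \<in> S" for g h using subgroup.m_closed[OF S] by simp
  have one: "mat 1 \<in> S" using subgroup.one_closed[OF S] by simp
  have D: "carrier (dihedral n) = {0..<m} \<times> UNIV"
    "\<And>i s j t. (i, s) \<otimes>\<^bsub>dihedral n\<^esub> (j, t) = ((if s then i - j else i + j) mod m, s \<noteq> t)"
    by (simp_all add: dihedral_def m_def)
  have "card S = 2 * card (\<theta> ` S)"
  proof (rule card_eq_card_fibre_times_image)
    fix y assume "y \<in> \<theta> ` S"
    then obtain g where g: "g \<in> S" "y = \<theta> g" by blast
    then have "{h \<in> S. \<theta> h = y} = {g, - g}" using ker neg by (auto simp: pm_def)
    moreover have "g \<noteq> - g" using matrix_neq_uminus[OF two] g S2 by blast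
    ultimately show "card {h \<in> S. \<theta> h = y} = 2" by simp
  qed simp
  then show "card S = 2 * n" using order_dihedral[OF n(1)] by (simp add: surj order_def)
  have "(1, False) \<in> \<theta> ` S" using m by (simp add: surj D)
  then obtain g where g: "g \<in> S" "\<theta> g = (1, False)" by force
  have g2: "g \<in> SL2" using g S2 by blast
  obtain i s where th1: "\<theta> (mat 1) = (i, s)" by fastforce
  have "(i, s) \<otimes>\<^bsub>dihedral n\<^esub> (1, False) = (1, False)"
    using hom[OF one g(1)] by (simp add: th1 g)
  moreover have "(i, s) \<in> carrier (dihedral n)" using one surj th1 by force
  \<comment> \<open>If the two images agreed, then \<open>2 mod m = 1\<close>, impossible for
    \<open>m \<ge> 2\<close>; so \<open>g\<close> is not a scalar.\<close>
  ultimately have "\<theta> (mat 1) \<noteq> \<theta> g" using m by (cases "m = 2") (auto simp: D th1 g)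
  then have "\<not> pm g (mat 1)" using ker[OF g(1) one] by auto
  then have v0: "traceless_part g \<noteq> (0, 0, 0)" using traceless_part_eq_zeroD[OF two g2] by blast
  have "h \<in> stab_pm (traceless_part g)" if h: "h \<in> S" for h
  proof -
    have h2: "h \<in> SL2" using h S2 by blast
    obtain j t where th: "\<theta> h = (j, t)" by fastforce
    have j: "0 \<le> j" "j < m" using h surj th D(1) by force+
    have "pm (h ** g ** adj2 h) g \<or> pm (h ** g ** adj2 h) (adj2 g)"
    proof (cases t)
      case False
      have "\<theta> (h ** g) = \<theta> (g ** h)"
        using h g False by (simp add: hom th D add.commute)
      then have "pm (h ** g) (g ** h)" unfolding ker[OF mult[OF h g(1)] mult[OF g(1) h]] .
      then have "pm (h ** g ** adj2 h) (g ** h ** adj2 h)"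
        using pm_mult[of "h ** g" "g ** h" "adj2 h" "adj2 h"] by blast
      then show ?thesis by (simp add: matrix_mul_assoc[symmetric] adj2_inverse[OF h2])
    next
      case True
      \<comment> \<open>A reflection times a rotation on both sides is unchanged; lifted, this says
        that \<open>h\<close> conjugates \<open>g\<close> to its inverse up to sign.\<close>
      have "\<theta> (g ** (h ** g)) = \<theta> h"
        using h g True j by (simp add: hom mult th D mod_add_right_eq)
      then have "pm (g ** (h ** g)) h" unfolding ker[OF mult[OF g(1) mult[OF h g(1)]] h] .
      then have "pm (adj2 g ** (g ** (h ** g))) (adj2 g ** h)"
        using pm_mult[of "adj2 g" "adj2 g"] by blast
      then have "pm (adj2 g ** (g ** (h ** g)) ** adj2 h) (adj2 g ** h ** adj2 h)"
        using pm_mult[of _ _ "adj2 h" "adj2 h"] by blast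
      moreover have "adj2 g ** (g ** (h ** g)) ** adj2 h = h ** g ** adj2 h"
        by (simp only: matrix_mul_assoc adj2_inverse[OF g2] matrix_mul_lid)
      moreover have "adj2 g ** h ** adj2 h = adj2 g"
        by (simp only: matrix_mul_assoc[symmetric] adj2_inverse[OF h2] matrix_mul_rid)
      ultimately show ?thesis by simp
    qed
    then have "ad h (traceless_part g) = traceless_part g \<or> ad h (traceless_part g) = tneg (traceless_part g)"
      unfolding traceless_part_conj[OF two, symmetric] pm_def
      by (elim disjE) (simp_all add: traceless_part_uminus traceless_part_adj2)
    then show ?thesis using h2 by (simp add: stab_pm_def)
  qed
  then show "\<exists>v. v \<noteq> (0, 0, 0) \<and> S \<subseteq> stab_pm v" using v0 by blast
qed

section \<open>Automorphisms normalising the torus\<close>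

definition U2 :: "'k \<Rightarrow> 'k::field ^ 2 ^ 2" where "U2 x = mat2 1 x 0 1"
definition L2 :: "'k \<Rightarrow> 'k::field ^ 2 ^ 2" where "L2 x = mat2 1 0 x 1"
definition D2 :: "'k \<Rightarrow> 'k::field ^ 2 ^ 2" where "D2 t = mat2 t 0 0 (1 / t)"
definition A2 :: "'k \<Rightarrow> 'k::field ^ 2 ^ 2" where "A2 t = mat2 0 t (- 1 / t) 0"

lemma generators_in_SL2 [simp]:
  "det (U2 x) = 1" "det (L2 x) = 1" "t \<noteq> 0 \<Longrightarrow> det (D2 t) = 1" "t \<noteq> 0 \<Longrightarrow> det (A2 t) = 1"
  by (simp_all add: U2_def L2_def D2_def A2_def)

lemma stab_pm_axis_cases:
  assumes two: "(2::'k::field) \<noteq> 0" and g: "g \<in> stab_pm (1, 0, 0 :: 'k)"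
  obtains t where "t \<noteq> 0" "g = D2 t" | t where "t \<noteq> 0" "g = A2 t"
proof -
  obtain p q r s where m: "g = mat2 p q r s" by (rule mat2_cases)
  have d: "p * s - q * r = 1" using g by (simp add: m stab_pm_def)
  have "p * q = 0" "r * s = 0" using g two by (auto simp: m stab_pm_def)
  show ?thesis
  proof (cases "p = 0")
    case True
    then have qr: "r * q = - 1" using d by (simp add: minus_equation_iff mult.commute)
    then have nz: "q \<noteq> 0" "r \<noteq> 0" by auto
    have "r = - 1 / q" using qr by (simp only: nonzero_eq_divide_eq[OF nz(1)])
    moreover have "s = 0" using nz \<open>r * s = 0\<close> by simp
    ultimately show ?thesis using that(2)[of q] nz True by (simp add: m A2_def)
  next
    case False
    then have "q = 0" using \<open>p * q = 0\<close> by simp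
    then have "s * p = 1" using d by (simp add: mult.commute)
    then have "s = 1 / p" "s \<noteq> 0" using False by (auto simp: nonzero_eq_divide_eq)
    moreover have "r = 0" using \<open>s \<noteq> 0\<close> \<open>r * s = 0\<close> by simp
    ultimately show ?thesis using that(1)[of p] False \<open>q = 0\<close> by (simp add: m D2_def)
  qed
qed

lemma D2_mem_stab_pm: "t \<noteq> 0 \<Longrightarrow> D2 t \<in> stab_pm (1, 0, 0)"
  by (simp add: stab_pm_def) (simp add: D2_def)

lemma A2_mem_stab_pm: "t \<noteq> 0 \<Longrightarrow> A2 t \<in> stab_pm (1, 0, 0)"
  by (simp add: stab_pm_def) (simp add: A2_def)

text \<open>Models an automorphism of \<open>PSL(2, q)\<close> that fixes the base block. Its values
  are chosen lifts, whence the signs, and \<open>axis\<close> says that it preserves the normaliser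
  of the diagonal torus.\<close>

locale pm_endomorphism =
  fixes \<alpha> :: "'k::{field,finite} ^ 2 ^ 2 \<Rightarrow> 'k ^ 2 ^ 2"
  assumes two: "(2::'k) \<noteq> 0" and q5: "CARD('k) > 5"
    and closed: "g \<in> SL2 \<Longrightarrow> \<alpha> g \<in> SL2"
    and hom: "g \<in> SL2 \<Longrightarrow> h \<in> SL2 \<Longrightarrow> pm (\<alpha> (g ** h)) (\<alpha> g ** \<alpha> h)"
    and inj: "g \<in> SL2 \<Longrightarrow> h \<in> SL2 \<Longrightarrow> pm (\<alpha> g) (\<alpha> h) \<Longrightarrow> pm g h"
    and axis: "g \<in> stab_pm (1, 0, 0) \<Longrightarrow> \<alpha> g \<in> stab_pm (1, 0, 0)"
begin

lemma alpha_pm: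
  assumes "g \<in> SL2" "h \<in> SL2" "pm g' (\<alpha> g)" "pm h' (\<alpha> h)"
  shows "pm (\<alpha> (g ** h)) (g' ** h')"
  using pm_trans[OF hom[OF assms(1,2)] pm_sym[OF pm_mult[OF assms(3,4)]]] .

lemma alpha_one: "pm (\<alpha> (mat 1)) (mat 1)"
proof -
  have "pm (\<alpha> (mat 1 ** mat 1)) (\<alpha> (mat 1) ** \<alpha> (mat 1))" by (rule hom) simp_all
  then have "pm (\<alpha> (mat 1)) (\<alpha> (mat 1) ** \<alpha> (mat 1))" by (simp only: matrix_mul_lid)
  then have "pm (\<alpha> (mat 1) ** adj2 (\<alpha> (mat 1))) (\<alpha> (mat 1) ** \<alpha> (mat 1) ** adj2 (\<alpha> (mat 1)))"
    using pm_mult[of _ _ "adj2 (\<alpha> (mat 1))" "adj2 (\<alpha> (mat 1))"] by blast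
  moreover have "\<alpha> (mat 1) \<in> SL2" by (rule closed) simp
  ultimately have "pm (mat 1) (\<alpha> (mat 1))"
    by (simp only: matrix_mul_assoc[symmetric] adj2_inverse(1) matrix_mul_rid)
  then show ?thesis by (rule pm_sym)
qed

text \<open>Antidiagonal matrices of determinant one square to \<open>-1\<close>, so a diagonal
  element whose square is not a sign cannot go to one of them.\<close>

lemma alpha_D2:
  assumes t: "t \<noteq> 0"
  obtains s where "s \<noteq> 0" "pm (\<alpha> (D2 t)) (D2 s)"
proof -
  have main: "\<exists>s. s \<noteq> 0 \<and> \<alpha> (D2 t) = D2 s" if t: "t \<noteq> 0" "t\<^sup>2 \<noteq> 1" "t\<^sup>2 \<noteq> -1" for t
  proof (rule ccontr)
    assume "\<not> ?thesis"
    then obtain s where s: "s \<noteq> 0" "\<alpha> (D2 t) = A2 s"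
      using stab_pm_axis_cases[OF two axis[OF D2_mem_stab_pm[OF t(1)]]] by metis
    have "pm (\<alpha> (D2 t ** D2 t)) (\<alpha> (D2 t) ** \<alpha> (D2 t))" using t by (intro hom) simp_all
    moreover have "A2 s ** A2 s = - mat 1" using s(1) by (simp add: A2_def mat_one_eq_mat2)
    ultimately have "pm (\<alpha> (D2 t ** D2 t)) (mat 1)" unfolding s(2) by simp
    then have "pm (\<alpha> (D2 t ** D2 t)) (\<alpha> (mat 1))" using alpha_one by (metis pm_trans pm_sym)
    then have "pm (D2 t ** D2 t) (mat 1)" using t by - (rule inj, simp_all add: det_mul)
    then show False using t by (auto simp: pm_def D2_def mat_one_eq_mat2 power2_eq_square)
  qed
  show ?thesis
  proof (cases "t\<^sup>2 = 1 \<or> t\<^sup>2 = -1")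
    case False
    then obtain s where "s \<noteq> 0" "\<alpha> (D2 t) = D2 s" using main[OF t] by blast
    then show ?thesis using that[of s] by simp
  next
    case True
    \<comment> \<open>The exceptional \<open>D2 t\<close> is a product of two generic diagonal
      matrices, with parameters \<open>t * u\<close> and \<open>1 / u\<close>.\<close>
    obtain u :: 'k where u: "u \<noteq> 0" "u\<^sup>2 \<noteq> 1" "u\<^sup>2 \<noteq> -1"
      using exists_fourth_power_neq_one[OF q5] .
    have tu: "t * u \<noteq> 0" "(t * u)\<^sup>2 \<noteq> 1" "(t * u)\<^sup>2 \<noteq> -1"
      using t u True by (auto simp: power_mult_distrib minus_equation_iff)
    have iu: "1 / u \<noteq> 0" "(1 / u)\<^sup>2 \<noteq> 1" "(1 / u)\<^sup>2 \<noteq> -1"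
      using u by (auto simp: power_divide divide_eq_eq minus_equation_iff)
    obtain a where a: "a \<noteq> 0" "\<alpha> (D2 (t * u)) = D2 a" using main[OF tu] by blast
    obtain b where b: "b \<noteq> 0" "\<alpha> (D2 (1 / u)) = D2 b" using main[OF iu] by blast
    have "D2 (t * u) ** D2 (1 / u) = D2 t" "D2 a ** D2 b = D2 (a * b)"
      using t u by (simp_all add: D2_def)
    then have "pm (\<alpha> (D2 t)) (D2 (a * b))"
      using hom[of "D2 (t * u)" "D2 (1 / u)"] t u tu a b by simp
    then show ?thesis using a b that[of "a * b"] by simp
  qed
qed

text \<open>Commuting up to sign with a torus conjugate of itself forces the image to be triangular
  with equal diagonal entries. The upper and lower outcomes differ by conjugation with
  \<open>A2 1\<close>, which fixes the axis up to sign.\<close>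

lemma alpha_U2_one:
  obtains y where "y \<noteq> 0" "pm (\<alpha> (U2 1)) (U2 y)" | y where "y \<noteq> 0" "pm (\<alpha> (U2 1)) (L2 y)"
proof -
  obtain u :: 'k where u: "u \<noteq> 0" "u\<^sup>2 \<noteq> 1" "u\<^sup>2 \<noteq> -1"
    using exists_fourth_power_neq_one[OF q5] .
  obtain t where t: "t \<noteq> 0" "pm (\<alpha> (D2 u)) (D2 t)" using alpha_D2[OF u(1)] .
  have dd: "D2 a ** D2 a = D2 (a\<^sup>2)" for a :: 'k by (simp add: D2_def power2_eq_square)
  have t4: "t\<^sup>2 \<noteq> 1" "t\<^sup>2 \<noteq> -1"
  proof -
    have "\<not> pm (D2 (t\<^sup>2)) (mat 1)"
    proof
      assume "pm (D2 (t\<^sup>2)) (mat 1)"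
      moreover have "pm (\<alpha> (D2 u ** D2 u)) (D2 t ** D2 t)" using u t by (intro alpha_pm pm_sym[OF t(2)]) simp_all
      ultimately have "pm (\<alpha> (D2 (u\<^sup>2))) (mat 1)" unfolding dd by (metis pm_trans)
      then have "pm (\<alpha> (D2 (u\<^sup>2))) (\<alpha> (mat 1))" using alpha_one by (metis pm_trans pm_sym)
      then have "pm (D2 (u\<^sup>2)) (mat 1)" using u by - (rule inj, simp_all)
      then show False using u by (auto simp: pm_def D2_def mat_one_eq_mat2)
    qed
    then show "t\<^sup>2 \<noteq> 1" "t\<^sup>2 \<noteq> -1" by (auto simp: pm_def D2_def mat_one_eq_mat2)
  qed
  obtain p q r s where g: "\<alpha> (U2 1) = mat2 p q r s" by (rule mat2_cases)
  let ?M = "mat2 p q r s" and ?N = "mat2 p (t\<^sup>2 * q) (r / t\<^sup>2) s"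
  have det: "p * s - q * r = 1" using closed[of "U2 1"] by (simp add: g)
  \<comment> \<open>A matrix of trace zero and determinant one squares to \<open>-1\<close>, whereas
    the square of \<open>U2 1\<close> is not a sign.\<close>
  have trace: "p + s \<noteq> 0"
  proof
    assume "p + s = 0"
    then have s: "s = - p" by (simp add: eq_neg_iff_add_eq_0 add.commute)
    have "?M ** ?M = - mat 1"
    proof -
      have "p * p + q * r = - (p * s - q * r)" by (simp add: s)
      then have "p * p + q * r = - 1" unfolding det .
      then show ?thesis by (simp add: s mat_one_eq_mat2 mult.commute[of r q] add.commute)
    qed
    moreover have "pm (\<alpha> (U2 1 ** U2 1)) (\<alpha> (U2 1) ** \<alpha> (U2 1))" by (intro hom) simp_all
    ultimately have "pm (\<alpha> (U2 1 ** U2 1)) (mat 1)" unfolding g by (simp only: pm_uminus)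
    then have "pm (\<alpha> (U2 1 ** U2 1)) (\<alpha> (mat 1))" using alpha_one by (metis pm_trans pm_sym)
    then have "pm (U2 1 ** U2 1) (mat 1 :: 'k ^ 2 ^ 2)" by - (rule inj, simp_all add: det_mul)
    then show False using two by (auto simp: pm_def U2_def mat_one_eq_mat2)
  qed
  \<comment> \<open>\<open>U2 1\<close> commutes with its torus conjugate \<open>U2 (u\<^sup>2)\<close>, hence so do their images.\<close>
  have c: "pm (?M ** ?N) (?N ** ?M)"
  proof -
    have UD: "U2 (u\<^sup>2) ** D2 u = D2 u ** U2 1" using u by (simp add: U2_def D2_def power2_eq_square)
    obtain n where n: "\<alpha> (U2 (u\<^sup>2)) = n" by blast
    have "pm (n ** D2 t) (D2 t ** ?M)"
      using alpha_pm[of "U2 (u\<^sup>2)" "D2 u" n "D2 t"] alpha_pm[of "D2 u" "U2 1" "D2 t" "?M"]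
        pm_sym[OF t(2)] u t(1) unfolding UD n g by (simp) (metis pm_sym pm_trans)
    then have "pm (n ** D2 t ** D2 (1 / t)) (D2 t ** ?M ** D2 (1 / t))"
      using pm_mult[of _ _ "D2 (1 / t)" "D2 (1 / t)"] by blast
    moreover have "D2 t ** D2 (1 / t) = mat 1" using t by (simp add: D2_def mat_one_eq_mat2)
    moreover have "D2 t ** ?M ** D2 (1 / t) = ?N"
      using t by (simp add: D2_def power2_eq_square)
    ultimately have pn: "pm (?N) n"
      by (simp add: matrix_mul_assoc[symmetric] pm_sym)
    have "U2 1 ** U2 (u\<^sup>2) = U2 (u\<^sup>2) ** U2 1" by (simp add: U2_def)
    then have nG: "pm (n ** ?M) (?M ** n)"
      using hom[of "U2 1" "U2 (u\<^sup>2)"] hom[of "U2 (u\<^sup>2)" "U2 1"] unfolding n g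
      by simp (metis pm_sym pm_trans)
    show ?thesis
      by (rule pm_trans[OF pm_mult[OF pm_refl pn] pm_trans[OF pm_sym[OF nG] pm_sym[OF pm_mult[OF pn pm_refl]]]])
  qed
  have qr: "q * r = 0" and qps: "q * (p - s) = 0" and rps: "r * (p - s) = 0"
  proof -
    \<comment> \<open>Anticommutation would give \<open>(t\<^sup>2 + 1) * (p + s) * q = 0\<close>,
      so \<open>q = 0\<close> by the trace, and then \<open>p = 0\<close>, against the
      determinant.\<close>
    have "?M ** ?N = ?N ** ?M"
    proof (rule ccontr)
      assume "\<not> ?thesis"
      with c[unfolded pm_def] have n: "?M ** ?N = - (?N ** ?M)"
        by blast
      have e: "p * p + q * (r / t\<^sup>2) = - (p * p + t\<^sup>2 * q * r)"
        "p * (t\<^sup>2 * q) + q * s = - (p * q + t\<^sup>2 * q * s)"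
        "r * p + s * (r / t\<^sup>2) = - (r / t\<^sup>2 * p + s * r)"
        using n by (simp_all only: mat2_mult uminus_mat2 mat2_eq_iff)
      have t1: "t\<^sup>2 + 1 \<noteq> 0" using t4 by (simp add: eq_neg_iff_add_eq_0)
      have "(t\<^sup>2 + 1) * ((p + s) * q) = p * (t\<^sup>2 * q) + q * s + (p * q + t\<^sup>2 * q * s)" by (simp add: algebra_simps)
      also have "\<dots> = 0" unfolding e(2) by simp
      finally have "q = 0" using trace t1 by simp
      then have "2 * p\<^sup>2 = 0" using e(1) by (simp add: power2_eq_square self_eq_uminus[OF two])
      then have "p = 0" using two by simp
      then show False using det \<open>q = 0\<close> by simp
    qed
    then have e: "q * (r / t\<^sup>2) = t\<^sup>2 * q * r" "p * (t\<^sup>2 * q) + q * s = p * q + t\<^sup>2 * q * s"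
      "r * p + s * (r / t\<^sup>2) = r / t\<^sup>2 * p + s * r" by simp_all
    have t1: "t\<^sup>2 + 1 \<noteq> 0" using t4 by (simp add: eq_neg_iff_add_eq_0)
    have t2: "t\<^sup>2 - 1 \<noteq> 0" using t4 by simp
    have "(t\<^sup>2 + 1) * (t\<^sup>2 - 1) * (q * r) = t\<^sup>2 * (t\<^sup>2 * q * r) - q * r" by (simp add: algebra_simps)
    also have "\<dots> = 0" unfolding e(1)[symmetric] using t by simp
    finally show "q * r = 0" using t1 t2 by simp
    have "(t\<^sup>2 - 1) * (q * (p - s)) = p * (t\<^sup>2 * q) + q * s - (p * q + t\<^sup>2 * q * s)" by (simp add: algebra_simps)
    also have "\<dots> = 0" unfolding e(2) by simp
    finally show "q * (p - s) = 0" using t2 by simp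
    have "(t\<^sup>2 - 1) * (r * (p - s)) = t\<^sup>2 * (r * p + s * (r / t\<^sup>2) - (r / t\<^sup>2 * p + s * r))"
      using t by (simp add: algebra_simps)
    also have "\<dots> = 0" unfolding e(3) by simp
    finally show "r * (p - s) = 0" using t2 by simp
  qed
  \<comment> \<open>A diagonal image would commute with the image of \<open>D2 u\<close>, although
    \<open>U2 1\<close> and \<open>D2 u\<close> do not commute even up to sign.\<close>
  have "q \<noteq> 0 \<or> r \<noteq> 0"
  proof (rule ccontr)
    assume "\<not> ?thesis"
    then have z: "q = 0" "r = 0" by auto
    have "\<alpha> (U2 1) ** D2 t = D2 t ** \<alpha> (U2 1)" unfolding g z by (simp add: D2_def)
    moreover have "pm (\<alpha> (U2 1 ** D2 u)) (\<alpha> (U2 1) ** D2 t)" "pm (\<alpha> (D2 u ** U2 1)) (D2 t ** \<alpha> (U2 1))"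
      using u t(1) by (simp_all add: alpha_pm pm_sym[OF t(2)])
    ultimately have "pm (\<alpha> (U2 1 ** D2 u)) (\<alpha> (D2 u ** U2 1))" by (metis pm_sym pm_trans)
    then have "pm (U2 1 ** D2 u) (D2 u ** U2 1)" using u by - (rule inj, simp_all add: det_mul)
    then have "1 / u = u" using u by (auto simp: pm_def U2_def D2_def self_eq_uminus[OF two])
    then show False using u by (simp add: divide_eq_eq power2_eq_square)
  qed
  then have s: "s = p" using qps rps by auto
  then have "p\<^sup>2 = 1\<^sup>2" using det qr by (simp add: power2_eq_square)
  then have p: "p = 1 \<or> p = -1" unfolding power2_eq_iff .
  show ?thesis
  proof (cases "r = 0")
    case True
    then have "q \<noteq> 0" using \<open>q \<noteq> 0 \<or> r \<noteq> 0\<close> by simp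
    moreover have "pm (\<alpha> (U2 1)) (U2 (p * q))" using p s True unfolding g by (auto simp: pm_def U2_def)
    ultimately show ?thesis using that(1)[of "p * q"] p by auto
  next
    case False
    then have "q = 0" using qr by simp
    moreover have "pm (\<alpha> (U2 1)) (L2 (p * r))" using p s \<open>q = 0\<close> unfolding g by (auto simp: pm_def L2_def)
    ultimately show ?thesis using that(2)[of "p * r"] p False by auto
  qed
qed

text \<open>A diagonal image would commute with the images of the torus, but \<open>A2 1\<close>
  inverts \<open>D2 u\<close>, and \<open>u\<^sup>2\<close> is not a sign.\<close>

lemma alpha_axis_swap:
  obtains s where "s \<noteq> 0" "\<alpha> (A2 1) = A2 s"
proof -
  have "\<alpha> (A2 1) \<in> stab_pm (1, 0, 0)" by (intro axis A2_mem_stab_pm) simp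
  then consider (diag) a where "a \<noteq> 0" "\<alpha> (A2 1) = D2 a" | (anti) s where "s \<noteq> 0" "\<alpha> (A2 1) = A2 s"
    using stab_pm_axis_cases[OF two] by metis
  then show ?thesis
  proof cases
    case (diag a)
    obtain u :: 'k where u: "u \<noteq> 0" "u\<^sup>2 \<noteq> 1" "u\<^sup>2 \<noteq> -1"
      using exists_fourth_power_neq_one[OF q5] .
    obtain t where t: "t \<noteq> 0" "pm (\<alpha> (D2 u)) (D2 t)" using alpha_D2[OF u(1)] .
    have "pm (\<alpha> (A2 1 ** D2 u)) (D2 a ** D2 t)" "pm (\<alpha> (D2 u ** A2 1)) (D2 t ** D2 a)"
      using u t(1) diag by (simp_all add: alpha_pm pm_sym[OF t(2)])
    moreover have "D2 a ** D2 t = D2 t ** D2 a" by (simp add: D2_def)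
    ultimately have "pm (\<alpha> (A2 1 ** D2 u)) (\<alpha> (D2 u ** A2 1))" by (metis pm_sym pm_trans)
    then have "pm (A2 1 ** D2 u) (D2 u ** A2 1)" using u by - (rule inj, simp_all add: det_mul)
    then have "1 / u = u \<or> 1 / u = - u" by (auto simp: pm_def A2_def D2_def)
    then show ?thesis using u by (auto simp: divide_eq_eq power2_eq_square minus_equation_iff)
  next
    case (anti s)
    then show ?thesis using that by blast
  qed
qed

text \<open>
  Up to sign, \<open>\<alpha>\<close> is a field automorphism applied entrywise followed by conjugation with a
  diagonal matrix: \<open>\<tau>\<close> is read off the action on the upper unitriangular matrices, and
  conjugation by the torus makes it multiplicative on squares.
\<close>
lemma alpha_semilinear:
  assumes y: "y \<noteq> 0" "pm (\<alpha> (U2 1)) (U2 y)"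
  obtains \<tau> where "field_aut \<tau>"
    and "\<And>p q r s. mat2 p q r s \<in> SL2 \<Longrightarrow> pm (\<alpha> (mat2 p q r s)) (mat2 (\<tau> p) (y * \<tau> q) (\<tau> r / y) (\<tau> s))"
proof -
  have "\<exists>z. pm (\<alpha> (U2 x)) (U2 z)" for x
  proof -
    obtain p q r s where g: "\<alpha> (U2 x) = mat2 p q r s" by (rule mat2_cases)
    have det: "p * s - q * r = 1" using closed[of "U2 x"] by (simp add: g)
    have "U2 1 ** U2 x = U2 x ** U2 1" by (simp add: U2_def add.commute)
    moreover have "pm (\<alpha> (U2 1 ** U2 x)) (U2 y ** mat2 p q r s)" "pm (\<alpha> (U2 x ** U2 1)) (mat2 p q r s ** U2 y)"
      by (simp_all add: alpha_pm pm_sym[OF y(2)] g)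
    ultimately have "pm (U2 y ** mat2 p q r s) (mat2 p q r s ** U2 y)" by (metis pm_sym pm_trans)
    then have "r = 0 \<and> s = p"
      unfolding pm_def
    proof
      assume "U2 y ** mat2 p q r s = mat2 p q r s ** U2 y"
      then show ?thesis using y by (auto simp: pm_def U2_def mult.commute)
    next
      assume e: "U2 y ** mat2 p q r s = - (mat2 p q r s ** U2 y)"
      then have r: "r = 0" by (simp add: U2_def self_eq_uminus[OF two])
      then have "p = 0" using e by (simp add: U2_def self_eq_uminus[OF two])
      then show ?thesis using det r by simp
    qed
    moreover from this have "p\<^sup>2 = 1\<^sup>2" using det by (simp add: power2_eq_square)
    then have "p = 1 \<or> p = -1" unfolding power2_eq_iff .
    ultimately have "pm (\<alpha> (U2 x)) (U2 (p * q))" unfolding g by (auto simp: pm_def U2_def)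
    then show ?thesis by blast
  qed
  then obtain f where f: "\<And>x. pm (\<alpha> (U2 x)) (U2 (f x))" by metis
  have U_inj: "pm (U2 a) (U2 b) \<Longrightarrow> a = b" for a b :: 'k
    using two by (auto simp: pm_def U2_def eq_neg_iff_add_eq_0)
  have f1: "f 1 = y" using U_inj pm_trans[OF pm_sym[OF f] y(2)] by blast
  have fadd: "f (x + z) = f x + f z" for x z
  proof -
    have "pm (\<alpha> (U2 z ** U2 x)) (U2 (f z) ** U2 (f x))" by (intro alpha_pm pm_sym[OF f]) simp_all
    moreover have "U2 z ** U2 x = U2 (x + z)" "U2 (f z) ** U2 (f x) = U2 (f x + f z)" by (simp_all add: U2_def)
    ultimately show ?thesis using U_inj pm_trans[OF pm_sym[OF f]] by metis
  qed
  \<comment> \<open>Conjugating by \<open>D2 t\<close> multiplies \<open>x\<close> by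
    \<open>t\<^sup>2\<close>; on the image side \<open>D2 s\<close> multiplies \<open>f x\<close> by
    \<open>s\<^sup>2\<close>.\<close>
  have "\<exists>c. \<forall>x. f (t\<^sup>2 * x) = c * f x" if t: "t \<noteq> 0" for t
  proof -
    obtain s where s: "s \<noteq> 0" "pm (\<alpha> (D2 t)) (D2 s)" using alpha_D2[OF t] .
    have "f (t\<^sup>2 * x) = s\<^sup>2 * f x" for x
    proof -
      have "pm (\<alpha> (U2 (t\<^sup>2 * x) ** D2 t)) (U2 (f (t\<^sup>2 * x)) ** D2 s)" "pm (\<alpha> (D2 t ** U2 x)) (D2 s ** U2 (f x))"
        using t by (intro alpha_pm pm_sym[OF f] pm_sym[OF s(2)]; simp)+
      moreover have "U2 (t\<^sup>2 * x) ** D2 t = D2 t ** U2 x" using t by (simp add: U2_def D2_def power2_eq_square)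
      ultimately have "pm (U2 (f (t\<^sup>2 * x)) ** D2 s) (D2 s ** U2 (f x))" by (metis pm_sym pm_trans)
      then have "f (t\<^sup>2 * x) / s = s * f x" using s(1) by (auto simp: pm_def U2_def D2_def self_eq_uminus[OF two])
      then show ?thesis using s(1) by (simp add: divide_eq_eq power2_eq_square mult_ac)
    qed
    then show ?thesis by blast
  qed
  then obtain c where c: "\<And>t x. t \<noteq> 0 \<Longrightarrow> f (t\<^sup>2 * x) = c t * f x" by metis
  define \<tau> where "\<tau> x = f x / y" for x
  have f\<tau>: "f x = y * \<tau> x" for x using y by (simp add: \<tau>_def)
  have \<tau>add: "\<tau> (x + z) = \<tau> x + \<tau> z" for x z by (simp add: \<tau>_def fadd add_divide_distrib)
  have \<tau>0: "\<tau> 0 = 0" using \<tau>add[of 0 0] add_left_cancel[of "\<tau> 0" 0 "\<tau> 0"] by simp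
  have \<tau>1: "\<tau> 1 = 1" using y by (simp add: \<tau>_def f1)
  have \<tau>sq: "\<tau> (t\<^sup>2 * x) = \<tau> (t\<^sup>2) * \<tau> x" for t x
  proof (cases "t = 0")
    case False
    show ?thesis using c[OF False, of x] c[OF False, of 1] y by (simp add: \<tau>_def f1)
  qed (simp add: \<tau>0)
  have "\<tau> (x * z) = \<tau> x * \<tau> z" for x z
  proof -
    \<comment> \<open>Every element is a sum of two squares, so additivity carries multiplicativity
      from squares to all elements.\<close>
    obtain a b where "1 * a\<^sup>2 + 1 * b\<^sup>2 = x" using binary_form_universal[OF two one_neq_zero one_neq_zero] by metis
    then have "x = a\<^sup>2 + b\<^sup>2" by simp
    then show ?thesis by (simp add: distrib_right \<tau>add \<tau>sq)
  qed
  then have \<tau>: "field_aut \<tau>" using \<tau>add \<tau>1 by (simp add: field_aut_def)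
  define F where "F g = mat2 (\<tau> (g $ 1 $ 1)) (y * \<tau> (g $ 1 $ 2)) (\<tau> (g $ 2 $ 1) / y) (\<tau> (g $ 2 $ 2))"
    for g :: "'k ^ 2 ^ 2"
  have F [simp]: "F (mat2 p q r s) = mat2 (\<tau> p) (y * \<tau> q) (\<tau> r / y) (\<tau> s)" for p q r s
    by (simp add: F_def)
  have F_mult: "F (g ** h) = F g ** F h" for g h
    using y by (cases g rule: mat2_cases; cases h rule: mat2_cases)
      (simp add: field_aut_add[OF \<tau>] field_aut_mult[OF \<tau>] add_divide_distrib distrib_left)
  have FU: "pm (\<alpha> (U2 x)) (F (U2 x))" for x
    using f[of x] by (simp add: U2_def f\<tau> \<tau>0 \<tau>1)
  obtain s where s: "s \<noteq> 0" "\<alpha> (A2 1) = A2 s" using alpha_axis_swap .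
  have L: "pm (\<alpha> (L2 (- x))) (L2 (- f x / s\<^sup>2))" for x
  proof -
    have "pm (\<alpha> (L2 (- x) ** A2 1)) (\<alpha> (L2 (- x)) ** A2 s)" using s by (intro alpha_pm) simp_all
    moreover have "pm (\<alpha> (A2 1 ** U2 x)) (A2 s ** U2 (f x))" using s by (intro alpha_pm pm_sym[OF f]) simp_all
    moreover have "L2 (- x) ** A2 1 = A2 1 ** U2 x" by (simp add: L2_def A2_def U2_def)
    ultimately have "pm (\<alpha> (L2 (- x)) ** A2 s) (A2 s ** U2 (f x))" by (metis pm_sym pm_trans)
    then have "pm (\<alpha> (L2 (- x)) ** A2 s ** A2 (- s)) (A2 s ** U2 (f x) ** A2 (- s))"
      using pm_mult[of _ _ "A2 (- s)" "A2 (- s)"] by blast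
    moreover have "A2 s ** A2 (- s) = mat 1" using s by (simp add: A2_def mat_one_eq_mat2)
    moreover have "A2 s ** U2 (f x) ** A2 (- s) = L2 (- f x / s\<^sup>2)"
      using s by (simp add: A2_def U2_def L2_def power2_eq_square)
    ultimately show ?thesis by (simp only: matrix_mul_assoc[symmetric] matrix_mul_rid)
  qed
  \<comment> \<open>The word \<open>U2 1 ** L2 (- 1) ** U2 1\<close> equals \<open>A2 1\<close>; the
    diagonal of its image must vanish, which ties \<open>s\<close> to \<open>y\<close>.\<close>
  have "s\<^sup>2 = y\<^sup>2"
  proof -
    have "pm (\<alpha> (U2 1 ** L2 (- 1) ** U2 1)) (U2 y ** L2 (- y / s\<^sup>2) ** U2 y)"
      using pm_sym[OF L[of 1]] pm_sym[OF y(2)] unfolding f1 by (intro alpha_pm pm_sym[OF alpha_pm]) (simp_all add: det_mul)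
    moreover have "U2 1 ** L2 (- 1) ** U2 1 = (A2 1 :: 'k ^ 2 ^ 2)" by (simp add: U2_def L2_def A2_def)
    ultimately have "pm (A2 s) (U2 y ** L2 (- y / s\<^sup>2) ** U2 y)" using s by simp
    then have "1 - y * y / s\<^sup>2 = 0" by (auto simp: pm_def U2_def L2_def A2_def)
    then show ?thesis using s by (simp add: power2_eq_square)
  qed
  then have FL: "pm (\<alpha> (L2 x)) (F (L2 x))" for x
    using L[of "- x"] y by (simp add: L2_def f\<tau> \<tau>0 \<tau>1 field_aut_uminus[OF \<tau>] power2_eq_square)
  \<comment> \<open>A nonzero lower left entry allows a factorisation upper, lower, upper
    unitriangular; the other matrices are reached afterwards by multiplying with
    \<open>L2 1\<close>.\<close>
  have F1: "pm (\<alpha> g) (F g)" if "g \<in> SL2" "g $ 2 $ 1 \<noteq> 0" for g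
  proof -
    obtain p q r s where g: "g = mat2 p q r s" by (rule mat2_cases)
    have r: "r \<noteq> 0" using that g by simp
    have det: "p * s - q * r = 1" using that by (simp add: g)
    then have "(p * s - 1) / r = q" using r by (simp add: divide_eq_eq algebra_simps)
    then have "g = U2 ((p - 1) / r) ** L2 r ** U2 ((s - 1) / r)"
      using r by (simp add: g U2_def L2_def field_simps)
    moreover have "pm (\<alpha> (U2 ((p - 1) / r) ** L2 r ** U2 ((s - 1) / r)))
        (F (U2 ((p - 1) / r)) ** F (L2 r) ** F (U2 ((s - 1) / r)))"
      by (intro alpha_pm pm_sym[OF alpha_pm] pm_sym[OF FU] pm_sym[OF FL]) (simp_all add: det_mul)
    ultimately show ?thesis by (simp only: F_mult)
  qed
  have F2: "pm (\<alpha> g) (F g)" if gS: "g \<in> SL2" for g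
  proof (cases "g $ 2 $ 1 = 0")
    case True
    obtain p q r s where g: "g = mat2 p q r s" by (rule mat2_cases)
    have "s \<noteq> 0" "r = 0" using True gS g by auto
    then have "(g ** L2 1) $ 2 $ 1 \<noteq> 0" by (simp add: g L2_def)
    then have "pm (\<alpha> (g ** L2 1)) (F (g ** L2 1))" using gS by (intro F1) (simp_all add: det_mul)
    then have "pm (\<alpha> (g ** L2 1 ** L2 (- 1))) (F (g ** L2 1) ** F (L2 (- 1)))"
      using gS by - (rule alpha_pm[OF _ _ pm_sym pm_sym[OF FL]], simp_all add: det_mul)
    moreover have "g ** L2 1 ** L2 (- 1) = g" by (simp add: g L2_def)
    ultimately show ?thesis by (simp only: F_mult[symmetric])
  qed (use F1 gS in blast)
  show ?thesis
  proof (rule that[OF \<tau>])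
    fix p q r s assume "mat2 p q r s \<in> (SL2 :: ('k ^ 2 ^ 2) set)"
    from F2[OF this] show "pm (\<alpha> (mat2 p q r s)) (mat2 (\<tau> p) (y * \<tau> q) (\<tau> r / y) (\<tau> s))" by simp
  qed
qed

end

section \<open>The norm ratio under automorphisms\<close>

lemma lincomb_in_stab_pmD:
  fixes w v :: "'k::field triple"
  assumes two: "(2::'k) \<noteq> 0" and g: "lincomb v (A, B) \<in> stab_pm w"
    and nz: "A \<noteq> 0" "B \<noteq> 0" "w \<noteq> (0, 0, 0)"
  shows "(fst w)\<^sup>2 * qf v = (fst v)\<^sup>2 * qf w"
proof -
  obtain x a b where w: "w = (x, a, b)" by (cases w)
  obtain x' a' b' where v: "v = (x', a', b')" by (cases v)
  let ?g = "lincomb v (A, B)"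
  have S: "?g \<in> SL2" and pm: "ad ?g w = w \<or> ad ?g w = tneg w" using g by (auto simp: stab_pm_def)
  from pm show ?thesis
  proof
    assume "ad ?g w = w"
    \<comment> \<open>As \<open>B \<noteq> 0\<close>, commuting with the combination means commuting
      with \<open>tmat v\<close>, which makes \<open>w\<close> proportional to
      \<open>v\<close>.\<close>
    then have "tmat w ** ?g = ?g ** tmat w" using ad_eq_iff_commute[OF S] by blast
    then have e: "x * (B * a') + a * (A - B * x') = (A + B * x') * a + B * a' * (- x)"
      "b * (A + B * x') + - x * (B * b') = B * b' * x + (A - B * x') * b"
      by (simp_all only: w v tmat.simps lincomb_simp mat2_mult mat2_eq_iff)
    have "(2 * B) * (x * a' - a * x') = x * (B * a') + a * (A - B * x') - ((A + B * x') * a + B * a' * (- x))"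
      by (simp add: algebra_simps)
    also have "\<dots> = 0" unfolding e(1) by simp
    finally have a: "x * a' = a * x'" using two nz by simp
    have "(2 * B) * (b * x' - x * b') = b * (A + B * x') + - x * (B * b') - (B * b' * x + (A - B * x') * b)"
      by (simp add: algebra_simps)
    also have "\<dots> = 0" unfolding e(2) by simp
    finally have b: "x * b' = b * x'" using two nz by simp
    have "x\<^sup>2 * (x'\<^sup>2 + a' * b') = x\<^sup>2 * x'\<^sup>2 + (x * a') * (x * b')"
      by (simp add: algebra_simps power2_eq_square)
    also have "\<dots> = x'\<^sup>2 * (x\<^sup>2 + a * b)" unfolding a b by (simp add: algebra_simps power2_eq_square)
    finally show ?thesis by (simp add: w v)
  next
    assume "ad ?g w = tneg w"
    \<comment> \<open>Anticommuting would make \<open>2 * A\<close> times the traceless matrix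
      \<open>tmat w\<close> scalar, so \<open>w = 0\<close> because
      \<open>A \<noteq> 0\<close>.\<close>
    then have "tmat (tneg w) ** ?g = ?g ** tmat w" using ad_eq_iff_commute[OF S] by blast
    then have e: "- x * (A + B * x') + - a * (B * b') = (A + B * x') * x + B * a' * b"
      "- x * (B * a') + - a * (A - B * x') = (A + B * x') * a + B * a' * (- x)"
      "- b * (A + B * x') + - (- x) * (B * b') = B * b' * x + (A - B * x') * b"
      "- b * (B * a') + - (- x) * (A - B * x') = B * b' * a + (A - B * x') * (- x)"
      by (simp_all only: w v tneg.simps tmat.simps lincomb_simp mat2_mult mat2_eq_iff)
    have "(2 * A) * a = (A + B * x') * a + B * a' * (- x) - (- x * (B * a') + - a * (A - B * x'))"
      by (simp add: algebra_simps)
    also have "\<dots> = 0" unfolding e(2) by simp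
    finally have a: "a = 0" using two nz by simp
    have "(2 * A) * b = B * b' * x + (A - B * x') * b - (- b * (A + B * x') + - (- x) * (B * b'))"
      by (simp add: algebra_simps)
    also have "\<dots> = 0" unfolding e(3) by simp
    finally have b: "b = 0" using two nz by simp
    have "(2 * 2 * A) * x = (A + B * x') * x + B * a' * b - (- x * (A + B * x') + - a * (B * b'))
        - (B * b' * a + (A - B * x') * (- x) - (- b * (B * a') + - (- x) * (A - B * x')))"
      unfolding a b by (simp add: algebra_simps)
    also have "\<dots> = 0" unfolding e(1) e(4) by simp
    finally have "x = 0" using two nz four_neq_zero[OF two] by simp
    then show ?thesis using a b nz w by simp
  qed
qed

lemma norm_one_generic_point:
  fixes \<nu> :: "'k::{field,finite}"
  assumes two: "(2::'k) \<noteq> 0" and q: "CARD('k) > 5" and \<nu>: "\<nu> \<notin> nzsq" "\<nu> \<noteq> 0"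
  obtains A B where "(A, B) \<in> norm_one \<nu>" "A \<noteq> 0" "B \<noteq> 0"
proof -
  obtain u :: 'k where u: "u \<noteq> 0" "u\<^sup>2 \<noteq> 1" "u\<^sup>2 \<noteq> -1" using exists_fourth_power_neq_one[OF q] .
  \<comment> \<open>The numerator of \<open>?A\<close> is \<open>1 + \<nu> * t\<^sup>2\<close>.
    Slope 1 serves unless \<open>\<nu> = -1\<close>, and then \<open>u\<close> does, its square not
    being \<open>1\<close>.\<close>
  obtain t where t: "t \<noteq> 0" "\<nu> * t\<^sup>2 \<noteq> - 1"
    using u by (cases "\<nu> = -1") (auto intro: that[of u] that[of 1])
  have d: "1 - \<nu> * t\<^sup>2 \<noteq> 0"
  proof
    assume "1 - \<nu> * t\<^sup>2 = 0"
    then have "t\<^sup>2 * \<nu> = 1" by (simp add: mult.commute)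
    then show False using nzsq_mult_iff[OF square_in_nzsq[OF t(1)], of \<nu>] \<nu> by simp
  qed
  let ?A = "(1 + \<nu> * t\<^sup>2) / (1 - \<nu> * t\<^sup>2)" and ?B = "2 * t / (1 - \<nu> * t\<^sup>2)"
  have "(?A, ?B) \<in> norm_one \<nu>" by (rule norm_one_slope[OF d])
  moreover have "1 + \<nu> * t\<^sup>2 \<noteq> 0" using t(2) by (metis add.commute eq_neg_iff_add_eq_0)
  then have "?A \<noteq> 0" using d by simp
  moreover have "?B \<noteq> 0" using d t two by simp
  ultimately show ?thesis by (rule that)
qed

text \<open>\<open>(fst v)\<^sup>2 / qf v\<close> is the squared scalar product of \<open>v\<close>
  with \<open>(1, 0, 0)\<close>, normalised so as to depend only on the line of \<open>v\<close>.
  The inclusion of stabilisers says in group terms that the line of \<open>v\<close> goes to that of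
  \<open>w\<close>.\<close>

definition norm_ratio_aut :: "('k::field ^ 2 ^ 2 \<Rightarrow> 'k ^ 2 ^ 2) \<Rightarrow> ('k \<Rightarrow> 'k) \<Rightarrow> bool" where
  "norm_ratio_aut \<alpha> \<tau> \<longleftrightarrow> field_aut \<tau> \<and> (\<forall>v w. qf w = qf v \<longrightarrow> qf v \<notin> nzsq \<longrightarrow> qf v \<noteq> 0 \<longrightarrow>
     \<alpha> ` stab v \<subseteq> stab_pm w \<longrightarrow> \<tau> ((fst v)\<^sup>2 / qf v) = (fst w)\<^sup>2 / qf v)"

lemma (in pm_endomorphism) norm_ratio_aut_upper:
  assumes y: "y \<noteq> 0" "pm (\<alpha> (U2 1)) (U2 y)"
  shows "\<exists>\<tau>. norm_ratio_aut \<alpha> \<tau>"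
proof -
  obtain \<tau> where \<tau>: "field_aut \<tau>"
    and sem: "\<And>p q r s. mat2 p q r s \<in> SL2 \<Longrightarrow> pm (\<alpha> (mat2 p q r s)) (mat2 (\<tau> p) (y * \<tau> q) (\<tau> r / y) (\<tau> s))"
    using alpha_semilinear[OF y] by metis
  have "\<tau> ((fst v)\<^sup>2 / qf v) = (fst w)\<^sup>2 / qf v"
    if \<nu>: "qf w = qf v" "qf v \<notin> nzsq" "qf v \<noteq> 0" and st: "\<alpha> ` stab v \<subseteq> stab_pm w" for v w
  proof -
    obtain x a b where v: "v = (x, a, b)" by (cases v)
    obtain A B where AB: "(A, B) \<in> norm_one (qf v)" "A \<noteq> 0" "B \<noteq> 0"
      using norm_one_generic_point[OF two q5 \<nu>(2,3)] .
    \<comment> \<open>The semilinear image of \<open>v\<close>. Its norm is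
      \<open>\<tau> (qf v)\<close> and need not equal \<open>qf v\<close>, which is why ratios are
      compared.\<close>
    let ?v = "(\<tau> x, y * \<tau> a, \<tau> b / y)"
    have nz: "v \<noteq> (0, 0, 0)" "w \<noteq> (0, 0, 0)" using \<nu> by auto
    have g: "lincomb v (A, B) \<in> stab v" unfolding stab_eq_image[OF two nz(1)] using AB by blast
    have "pm (\<alpha> (lincomb v (A, B))) (lincomb ?v (\<tau> A, \<tau> B))"
      using sem[of "A + B * x" "B * a" "B * b" "A - B * x"] g
      by (simp add: v stab_def field_aut_add[OF \<tau>] field_aut_mult[OF \<tau>] field_aut_diff[OF \<tau>] mult_ac)
    then have "lincomb ?v (\<tau> A, \<tau> B) \<in> stab_pm w" using st g pm_stab_pm by blast
    then have "(fst w)\<^sup>2 * qf ?v = (fst ?v)\<^sup>2 * qf w"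
      by (rule lincomb_in_stab_pmD[OF two]) (use AB nz field_aut_nonzero[OF \<tau>] in auto)
    moreover have "qf ?v = \<tau> (qf v)"
      using y by (simp add: v field_aut_add[OF \<tau>] field_aut_mult[OF \<tau>] field_aut_power[OF \<tau>])
    ultimately have "(fst w)\<^sup>2 * \<tau> (qf v) = (\<tau> x)\<^sup>2 * qf v" using \<nu> by simp
    moreover have "\<tau> (qf v) \<noteq> 0" using \<nu> field_aut_nonzero[OF \<tau>] by simp
    ultimately have "(\<tau> x)\<^sup>2 / \<tau> (qf v) = (fst w)\<^sup>2 / qf v" using \<nu> by (simp add: frac_eq_eq)
    then show ?thesis by (simp add: v field_aut_divide[OF \<tau>] field_aut_power[OF \<tau>])
  qed
  then show ?thesis using \<tau> unfolding norm_ratio_aut_def by blast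
qed

text \<open>The lower triangular case is turned into the upper one by conjugating with
  \<open>A2 1\<close>, which only changes the sign of the first coordinate.\<close>

lemma (in pm_endomorphism) norm_ratio_aut:
  shows "\<exists>\<tau>. norm_ratio_aut \<alpha> \<tau>"
proof (cases rule: alpha_U2_one)
  case (1 y)
  then show ?thesis by (rule norm_ratio_aut_upper)
next
  case (2 y)
  let ?W = "A2 1 :: 'k ^ 2 ^ 2"
  let ?\<beta> = "\<lambda>g. ?W ** \<alpha> g ** adj2 ?W"
  have W: "?W \<in> SL2" "?W \<in> stab_pm (1, 0, 0)" using A2_mem_stab_pm[of 1] by simp_all
  have cancel: "adj2 ?W ** (?W ** g ** adj2 ?W) ** ?W = g" for g
  proof -
    have "adj2 ?W ** (?W ** g ** adj2 ?W) ** ?W = (adj2 ?W ** ?W) ** g ** (adj2 ?W ** ?W)"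
      by (simp only: matrix_mul_assoc)
    then show ?thesis by (simp only: adj2_inverse[OF W(1)] matrix_mul_lid matrix_mul_rid)
  qed
  interpret \<beta>: pm_endomorphism ?\<beta>
  proof
    fix g :: "'k ^ 2 ^ 2" assume g: "g \<in> SL2"
    then show "?\<beta> g \<in> SL2" using closed W adj2_inverse(3)[OF W(1)] by (simp add: det_mul)
    fix h :: "'k ^ 2 ^ 2" assume h: "h \<in> SL2"
    have "?\<beta> g ** ?\<beta> h = ?W ** (\<alpha> g ** (adj2 ?W ** ?W) ** \<alpha> h) ** adj2 ?W"
      by (simp only: matrix_mul_assoc)
    then have "?\<beta> g ** ?\<beta> h = ?W ** (\<alpha> g ** \<alpha> h) ** adj2 ?W"
      by (simp only: adj2_inverse[OF W(1)] matrix_mul_rid)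
    then show "pm (?\<beta> (g ** h)) (?\<beta> g ** ?\<beta> h)"
      using pm_mult[OF pm_mult[OF pm_refl hom[OF g h]] pm_refl] by simp
    assume "pm (?\<beta> g) (?\<beta> h)"
    then have "pm (adj2 ?W ** ?\<beta> g ** ?W) (adj2 ?W ** ?\<beta> h ** ?W)"
      by (rule pm_mult[OF pm_mult[OF pm_refl] pm_refl])
    then have "pm (\<alpha> g) (\<alpha> h)" unfolding cancel .
    then show "pm g h" by (rule inj[OF g h])
  next
    fix g :: "'k ^ 2 ^ 2" assume "g \<in> stab_pm (1, 0, 0)"
    then show "?\<beta> g \<in> stab_pm (1, 0, 0)" by (intro stab_pm_closed axis W(2))
  qed (rule two q5)+
  have "?W ** L2 y ** adj2 ?W = U2 (- y)" by (simp add: A2_def L2_def U2_def)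
  then have "pm (?\<beta> (U2 1)) (U2 (- y))"
    using pm_mult[OF pm_mult[OF pm_refl 2(2)] pm_refl, of ?W "adj2 ?W"] by simp
  then obtain \<tau> where \<tau>: "norm_ratio_aut ?\<beta> \<tau>" using \<beta>.norm_ratio_aut_upper[of "- y"] 2(1) by auto
  have "\<tau> ((fst v)\<^sup>2 / qf v) = (fst w)\<^sup>2 / qf v"
    if \<nu>: "qf w = qf v" "qf v \<notin> nzsq" "qf v \<noteq> 0" and st: "\<alpha> ` stab v \<subseteq> stab_pm w" for v w
  proof -
    have "?\<beta> ` stab v \<subseteq> stab_pm (ad ?W w)"
    proof
      fix h assume "h \<in> ?\<beta> ` stab v"
      then obtain g where g: "g \<in> stab v" "h = ?\<beta> g" by blast
      have a: "\<alpha> g \<in> stab_pm w" using st g by blast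
      have "h \<in> SL2" using a W adj2_inverse(3)[OF W(1)] by (simp add: g stab_pm_def det_mul)
      moreover have "ad h (ad ?W w) = ad ?W (ad (\<alpha> g) w)"
        by (simp only: g ad_mult ad_adj2(1)[OF W(1)])
      ultimately show "h \<in> stab_pm (ad ?W w)" using a by (auto simp: stab_pm_def ad_tneg)
    qed
    moreover have "qf (ad ?W w) = qf v" using \<nu> W by simp
    ultimately have "\<tau> ((fst v)\<^sup>2 / qf v) = (fst (ad ?W w))\<^sup>2 / qf v"
      using \<tau> \<nu> unfolding norm_ratio_aut_def by blast
    moreover have "(fst (ad ?W w))\<^sup>2 = (fst w)\<^sup>2" by (cases w) (simp add: A2_def)
    ultimately show ?thesis by simp
  qed
  then show ?thesis using \<tau> unfolding norm_ratio_aut_def by blast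
qed

section \<open>Vectors up to sign as coordinates for points and blocks\<close>

locale line_orbit = SL2_action act \<Omega>
  for act :: "'k::{field,finite} ^ 2 ^ 2 \<Rightarrow> 'b \<Rightarrow> 'b" and \<Omega> :: "'b set" +
  fixes \<omega>0 :: 'b and v0 :: "'k triple"
  assumes fin: "finite \<Omega>" and base: "\<omega>0 \<in> \<Omega>"
    and stab: "{g \<in> SL2. act g \<omega>0 = \<omega>0} = stab_pm v0"
    and trans: "qf w = qf v0 \<Longrightarrow> \<exists>g\<in>SL2. ad g v0 = w"
    and card: "card (SL2 :: ('k ^ 2 ^ 2) set) = card (stab_pm v0) * card \<Omega>"
begin

text \<open>The choice of \<open>g\<close> is harmless: two candidates differ by an element of
  \<open>stab v0\<close>, and this fixes \<open>\<omega>0\<close>.\<close>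

definition coord :: "'k triple \<Rightarrow> 'b" where
  "coord v = act (SOME g. g \<in> SL2 \<and> ad g v0 = v) \<omega>0"

lemma act_base_eq_iff:
  assumes g: "g \<in> SL2" and h: "h \<in> SL2"
  shows "act g \<omega>0 = act h \<omega>0 \<longleftrightarrow> ad g v0 = ad h v0 \<or> ad g v0 = tneg (ad h v0)"
proof -
  have m: "adj2 h ** g \<in> SL2" using SL2_mult[OF adj2_inverse(3)[OF h] g] .
  have "ad (adj2 h) u = w \<longleftrightarrow> u = ad h w" for u w using ad_adj2[OF h] by metis
  then have "adj2 h ** g \<in> stab_pm v0 \<longleftrightarrow> ad g v0 = ad h v0 \<or> ad g v0 = tneg (ad h v0)"
    using m by (simp add: stab_pm_def ad_mult ad_tneg)
  then show ?thesis using act_eq_iff[OF g h base] m unfolding stab[symmetric] by blast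
qed

lemma coord_ad_base:
  assumes g: "g \<in> SL2"
  shows "coord (ad g v0) = act g \<omega>0"
proof -
  have "\<exists>h. h \<in> SL2 \<and> ad h v0 = ad g v0" using g by blast
  from someI_ex[OF this] show ?thesis using act_base_eq_iff g by (simp add: coord_def)
qed

lemma transE:
  assumes "qf v = qf v0"
  obtains h where "h \<in> SL2" "v = ad h v0"
  using trans[OF assms] by blast

lemma coord_mem: "qf v = qf v0 \<Longrightarrow> coord v \<in> \<Omega>"
  by (erule transE) (simp add: coord_ad_base closed base)

lemma coord_ad:
  assumes g: "g \<in> SL2" and v: "qf v = qf v0"
  shows "coord (ad g v) = act g (coord v)"
proof -
  obtain h where h: "h \<in> SL2" "v = ad h v0" using v by (rule transE)
  then show ?thesis
    using coord_ad_base[OF SL2_mult[OF g h(1)]] coord_ad_base[OF h(1)] mult[OF g h(1) base]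
    by (simp add: ad_mult)
qed

lemma coord_eq_iff:
  assumes "qf v = qf v0" "qf w = qf v0"
  shows "coord v = coord w \<longleftrightarrow> v = w \<or> v = tneg w"
proof -
  obtain g h where "g \<in> SL2" "v = ad g v0" "h \<in> SL2" "w = ad h v0" using assms by (metis transE)
  then show ?thesis by (simp add: coord_ad_base act_base_eq_iff)
qed

text \<open>The assumption \<open>card\<close> together with orbit counting makes the orbit of
  \<open>\<omega>0\<close> as large as \<open>\<Omega>\<close>.\<close>

lemma coord_surj:
  assumes "\<omega> \<in> \<Omega>"
  shows "\<exists>v. qf v = qf v0 \<and> coord v = \<omega>"
proof -
  have "card (stab_pm v0) * card \<Omega> = card (stab_pm v0) * card ((\<lambda>g. act g \<omega>0) ` SL2)"
    using card_orbit[OF base] unfolding stab card .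
  moreover have "stab_pm v0 \<noteq> {}" using stab_pm_one by blast
  ultimately have "card ((\<lambda>g. act g \<omega>0) ` SL2) = card \<Omega>" by simp
  then have "(\<lambda>g. act g \<omega>0) ` SL2 = \<Omega>"
    using closed base by (intro card_subset_eq[OF fin]) auto
  then obtain g where "g \<in> SL2" "\<omega> = act g \<omega>0" using assms by blast
  then have "qf (ad g v0) = qf v0 \<and> coord (ad g v0) = \<omega>" by (simp add: coord_ad_base)
  then show ?thesis by blast
qed

end

section \<open>The design in coordinates\<close>

lemma bil_self: "(2::'k::field) \<noteq> 0 \<Longrightarrow> bil v v = qf (v :: 'k triple)"
  by (cases v) (simp add: power2_eq_square mult.commute flip: mult_2)

text \<open>\<open>\<rho>\<close> is the action of \<open>T\<close> pulled back to
  \<open>SL(2, q)\<close>, so \<open>faithful\<close> and \<open>kernel\<close> say that exactly the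
  signs act trivially. In \<open>flag\<close>, \<phi> is an element of \<open>G\<close> fixing the
  block; it normalises the image of \<open>\<rho>\<close>.\<close>

locale psl_design =
  fixes P :: "'a set" and Bs :: "'a set set" and \<rho> :: "'k::{field,finite} ^ 2 ^ 2 \<Rightarrow> 'a \<Rightarrow> 'a"
    and x0 :: 'a and B0 :: "'a set" and v0 w0 :: "'k triple"
  assumes two: "(2::'k) \<noteq> 0" and q5: "CARD('k) > 5"
    and fin: "finite P" and card_P: "2 * card P = CARD('k) * (CARD('k) - 1)"
    and block: "B \<in> Bs \<Longrightarrow> B \<subseteq> P \<and> card B = CARD('k) - 1"
    and card_Bs: "2 * card Bs = CARD('k) * (CARD('k) + 1)"
    and lambda: "x \<in> P \<Longrightarrow> y \<in> P \<Longrightarrow> x \<noteq> y \<Longrightarrow> card {B \<in> Bs. x \<in> B \<and> y \<in> B} = 2"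
    and closed: "g \<in> SL2 \<Longrightarrow> x \<in> P \<Longrightarrow> \<rho> g x \<in> P"
    and mult: "g \<in> SL2 \<Longrightarrow> h \<in> SL2 \<Longrightarrow> x \<in> P \<Longrightarrow> \<rho> (g ** h) x = \<rho> g (\<rho> h x)"
    and one: "x \<in> P \<Longrightarrow> \<rho> (mat 1) x = x"
    and faithful: "g \<in> SL2 \<Longrightarrow> h \<in> SL2 \<Longrightarrow> (\<And>x. x \<in> P \<Longrightarrow> \<rho> g x = \<rho> h x) \<Longrightarrow> pm g h"
    and kernel: "g \<in> SL2 \<Longrightarrow> h \<in> SL2 \<Longrightarrow> pm g h \<Longrightarrow> x \<in> P \<Longrightarrow> \<rho> g x = \<rho> h x"
    and blocks: "g \<in> SL2 \<Longrightarrow> B \<in> Bs \<Longrightarrow> \<rho> g ` B \<in> Bs"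
    and x0: "x0 \<in> P" "{g \<in> SL2. \<rho> g x0 = x0} = stab_pm v0"
    and v0: "qf v0 \<notin> nzsq" "qf v0 \<noteq> 0" "card (stab_pm v0) = 2 * (CARD('k) + 1)"
    and B0: "B0 \<in> Bs" "{g \<in> SL2. \<rho> g ` B0 = B0} = stab_pm w0"
    and w0: "qf w0 = 1" "card (stab_pm w0) = 2 * (CARD('k) - 1)"
    and flag: "B \<in> Bs \<Longrightarrow> x \<in> B \<Longrightarrow> y \<in> B \<Longrightarrow>
      \<exists>\<phi>. bij_betw \<phi> P P \<and> \<phi> ` B = B \<and> \<phi> x = y \<and> (\<forall>g\<in>SL2. \<exists>g'\<in>SL2. \<forall>z\<in>P. \<phi> (\<rho> g z) = \<rho> g' (\<phi> z))"
begin

lemma block_subset: "B \<in> Bs \<Longrightarrow> B \<subseteq> P"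
  using block by blast

lemma image_mult: "g \<in> SL2 \<Longrightarrow> h \<in> SL2 \<Longrightarrow> B \<subseteq> P \<Longrightarrow> \<rho> (g ** h) ` B = \<rho> g ` \<rho> h ` B"
  unfolding image_image by (intro image_cong) (auto simp: mult)

lemma image_one: "B \<subseteq> P \<Longrightarrow> \<rho> (mat 1) ` B = B"
  using one by (auto simp: image_iff subset_iff) 

lemma rho_inverse:
  assumes "g \<in> SL2" "x \<in> P"
  shows "\<rho> (adj2 g) (\<rho> g x) = x"
  using mult[OF adj2_inverse(3)[OF assms(1)] assms] one[OF assms(2)] adj2_inverse(2)[OF assms(1)] by simp

lemma inj_rho: "g \<in> SL2 \<Longrightarrow> inj_on (\<rho> g) P"
  by (rule inj_on_inverseI[of _ "\<rho> (adj2 g)"]) (rule rho_inverse)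

lemma finite_Bs: "finite Bs"
  using fin block_subset by (meson Pow_iff finite_Pow_iff finite_subset subsetI)

lemma card_SL2_eq:
  "card (SL2 :: ('k ^ 2 ^ 2) set) = card (stab_pm v0) * card P"
  "card (SL2 :: ('k ^ 2 ^ 2) set) = card (stab_pm w0) * card Bs"
proof -
  let ?q = "CARD('k)"
  have "card (SL2 :: ('k ^ 2 ^ 2) set) = (?q + 1) * (?q * (?q - 1))" unfolding card_SL2 by (simp only: mult_ac)
  also have "\<dots> = (?q + 1) * (2 * card P)" unfolding card_P ..
  finally show "card (SL2 :: ('k ^ 2 ^ 2) set) = card (stab_pm v0) * card P" unfolding v0 by (simp only: mult_ac)
  have "card (SL2 :: ('k ^ 2 ^ 2) set) = (?q - 1) * (?q * (?q + 1))" unfolding card_SL2 by (simp only: mult_ac)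
  also have "\<dots> = (?q - 1) * (2 * card Bs)" unfolding card_Bs ..
  finally show "card (SL2 :: ('k ^ 2 ^ 2) set) = card (stab_pm w0) * card Bs" unfolding w0 by (simp only: mult_ac)
qed

abbreviation nu :: 'k where "nu \<equiv> qf v0"

sublocale pts: line_orbit \<rho> P x0 v0
proof
  fix w assume "qf w = qf v0"
  then show "\<exists>g\<in>SL2. ad g v0 = w" using SL2_transitive_nonsquare[OF two v0(1,2)] by metis
qed (use fin x0 closed mult one card_SL2_eq in auto)

sublocale bks: line_orbit "\<lambda>g B. \<rho> g ` B" Bs B0 w0
proof
  fix w assume "qf w = qf w0"
  then show "\<exists>g\<in>SL2. ad g w0 = w" using SL2_transitive_one[OF two w0(1)] w0 by metis
qed (use finite_Bs B0 w0 blocks image_mult image_one block_subset card_SL2_eq in auto)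

abbreviation pt where "pt \<equiv> pts.coord"
abbreviation bk where "bk \<equiv> bks.coord"

lemmas pt_mem = pts.coord_mem and pt_ad = pts.coord_ad
  and pt_eq_iff = pts.coord_eq_iff and pt_surj = pts.coord_surj

lemmas bk_mem = bks.coord_mem[unfolded w0(1)] and bk_ad = bks.coord_ad[unfolded w0(1)]
  and bk_eq_iff = bks.coord_eq_iff[unfolded w0(1)] and bk_surj = bks.coord_surj[unfolded w0(1)]

lemma nu: "nu \<notin> nzsq" "nu \<noteq> 0"
  using v0 by simp_all

definition inc :: "'k triple \<Rightarrow> 'k triple \<Rightarrow> bool" where
  "inc v h \<longleftrightarrow> pt v \<in> bk h"

lemma inc_ad:
  assumes "g \<in> SL2" "qf v = nu" "qf h = 1"
  shows "inc (ad g v) (ad g h) \<longleftrightarrow> inc v h"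
  unfolding inc_def pt_ad[OF assms(1,2)] bk_ad[OF assms(1,3)]
  using inj_on_image_mem_iff[OF inj_rho[OF assms(1)] pt_mem[OF assms(2)] block_subset[OF bk_mem[OF assms(3)]]] .

lemma inc_tneg:
  "qf v = nu \<Longrightarrow> inc (tneg v) h \<longleftrightarrow> inc v h"
  "qf h = 1 \<Longrightarrow> inc v (tneg h) \<longleftrightarrow> inc v h"
  using pt_eq_iff[of "tneg v" v] bk_eq_iff[of "tneg h" h] by (simp_all add: inc_def)

section \<open>The block fixed by the diagonal torus\<close>

abbreviation axis :: "'k triple" where "axis \<equiv> (1, 0, 0)"

definition V :: "'k triple set" where
  "V = {v. qf v = nu \<and> inc v axis}"

lemma card_V: "card V = 2 * (CARD('k) - 1)"
proof -
  have B: "bk axis \<in> Bs" by (rule bk_mem) simp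
  have "card V = 2 * card (pt ` V)"
  proof (rule card_eq_card_fibre_times_image)
    fix y assume "y \<in> pt ` V"
    then obtain v where v: "v \<in> V" "y = pt v" by blast
    then have n: "qf v = nu" by (simp add: V_def)
    have "w \<in> V \<and> pt w = y \<longleftrightarrow> w = v \<or> w = tneg v" for w
    proof
      assume "w \<in> V \<and> pt w = y"
      then show "w = v \<or> w = tneg v" using pt_eq_iff[of w v] v(2) n by (simp add: V_def)
    next
      assume "w = v \<or> w = tneg v"
      then show "w \<in> V \<and> pt w = y"
        using v n inc_tneg(1)[OF n] pt_eq_iff[of "tneg v" v] by (elim disjE) (simp_all add: V_def)
    qed
    then have "{w \<in> V. pt w = y} = {v, tneg v}" by (simp only: insert_def) blast
    then show "card {w \<in> V. pt w = y} = 2" using tneg_neq[OF two, of v] n nu(2) by (cases "v = (0, 0, 0)") simp_all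
  qed simp
  moreover have "pt ` V = bk axis"
  proof
    show "bk axis \<subseteq> pt ` V"
    proof
      fix x assume x: "x \<in> bk axis"
      then have "x \<in> P" using block_subset[OF B] by blast
      then obtain v where "qf v = nu" "pt v = x" using pt_surj by blast
      then show "x \<in> pt ` V" using x by (auto simp: V_def inc_def)
    qed
  qed (auto simp: V_def inc_def)
  ultimately show ?thesis using block[OF B] by simp
qed

text \<open>Two common blocks, each given by a vector and its negative.\<close>

lemma card_common_blocks:
  assumes v: "qf v = nu" "qf w = nu" and ne: "v \<noteq> w" "v \<noteq> tneg w"
  shows "card {h. qf h = 1 \<and> inc v h \<and> inc w h} = 4"
proof -
  let ?H = "{h. qf h = 1 \<and> inc v h \<and> inc w h}"
  have "card ?H = 2 * card (bk ` ?H)"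
  proof (rule card_eq_card_fibre_times_image)
    fix y assume "y \<in> bk ` ?H"
    then obtain h where h: "h \<in> ?H" "y = bk h" by blast
    then have n: "qf h = 1" by simp
    have "k \<in> ?H \<and> bk k = y \<longleftrightarrow> k = h \<or> k = tneg h" for k
    proof
      assume "k \<in> ?H \<and> bk k = y"
      then show "k = h \<or> k = tneg h" using bk_eq_iff[of k h] h(2) n by simp
    next
      assume "k = h \<or> k = tneg h"
      then show "k \<in> ?H \<and> bk k = y"
        using h n inc_tneg(2)[OF n] bk_eq_iff[of "tneg h" h] by (elim disjE) simp_all
    qed
    then have "{k \<in> ?H. bk k = y} = {h, tneg h}" by (simp only: insert_def) blast
    then show "card {k \<in> ?H. bk k = y} = 2" using tneg_neq[OF two, of h] n by (cases "h = (0, 0, 0)") simp_all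
  qed simp
  moreover have "bk ` ?H = {B \<in> Bs. pt v \<in> B \<and> pt w \<in> B}"
    using bk_mem bk_surj by (fastforce simp: inc_def)
  moreover have "pt v \<noteq> pt w" using pt_eq_iff[OF v] ne by simp
  ultimately show ?thesis using lambda[OF pt_mem[OF v(1)] pt_mem[OF v(2)]] by simp
qed

lemma card_qf_bil_orbit:
  assumes v: "qf v = nu" and g: "g\<^sup>2 \<noteq> nu\<^sup>2"
  shows "card {w. qf w = nu \<and> bil v w = g} = CARD('k) + 1"
proof -
  let ?e = "(0, 1, nu)"
  have e: "qf ?e = nu" by simp
  obtain k where k: "k \<in> SL2" "ad k ?e = v"
    using SL2_transitive_nonsquare[OF two, of ?e v] nu v by auto
  have "bij_betw (ad k) {w. qf w = nu \<and> bil ?e w = g} {w. qf w = nu \<and> bil v w = g}"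
  proof (rule bij_betwI[where g = "ad (adj2 k)"])
    show "ad k \<in> {w. qf w = nu \<and> bil ?e w = g} \<rightarrow> {w. qf w = nu \<and> bil v w = g}"
      using k bil_ad[OF two k(1), of ?e] by auto
    show "ad (adj2 k) \<in> {w. qf w = nu \<and> bil v w = g} \<rightarrow> {w. qf w = nu \<and> bil ?e w = g}"
    proof
      fix w assume w: "w \<in> {w. qf w = nu \<and> bil v w = g}"
      have "bil (ad k ?e) (ad k (ad (adj2 k) w)) = bil ?e (ad (adj2 k) w)" by (rule bil_ad[OF two k(1)])
      then show "ad (adj2 k) w \<in> {w. qf w = nu \<and> bil ?e w = g}"
        using w k adj2_inverse(3)[OF k(1)] by (simp add: ad_adj2[OF k(1)])
    qed
  qed (simp_all add: ad_adj2[OF k(1)])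
  then show ?thesis using card_qf_bil[OF two nu g] by (simp add: bij_betw_same_card)
qed

lemma card_pairs_V:
  assumes g: "g\<^sup>2 \<noteq> nu\<^sup>2"
  shows "card {(v, w). v \<in> V \<and> w \<in> V \<and> bil v w = g} = 4 * (CARD('k) - 1)"
proof -
  let ?q = "CARD('k)"
  let ?H = "{h. qf h = (1::'k)}"
  let ?A = "SIGMA v:{v. qf v = nu}. {w. qf w = nu \<and> bil v w = g}"
  let ?I = "\<lambda>h. {(v, w). (v, w) \<in> ?A \<and> inc v h \<and> inc w h}"
  have orb: "card (?I h) = card (?I axis)" if h: "h \<in> ?H" for h
  proof -
    obtain k where k: "k \<in> SL2" "ad k axis = h"
      using SL2_transitive_one[OF two, of axis h] h by auto
    have ki: "adj2 k \<in> SL2" by (rule adj2_inverse[OF k(1)])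
    have kh: "ad (adj2 k) h = axis" using k ad_adj2 by blast
    have inc1: "qf v = nu \<Longrightarrow> inc (ad k v) h \<longleftrightarrow> inc v axis" for v
      using inc_ad[OF k(1), of v axis] k(2) by simp
    have "bij_betw (\<lambda>(v, w). (ad k v, ad k w)) (?I axis) (?I h)"
    proof (rule bij_betwI[where g = "\<lambda>(v, w). (ad (adj2 k) v, ad (adj2 k) w)"])
      show "(\<lambda>(v, w). (ad k v, ad k w)) \<in> ?I axis \<rightarrow> ?I h"
        using k(1) by (auto simp: inc1 bil_ad[OF two k(1)])
      have inc2: "qf v = nu \<Longrightarrow> inc (ad (adj2 k) v) axis \<longleftrightarrow> inc v h" for v
        using inc_ad[OF ki, of v h] kh h by simp
      show "(\<lambda>(v, w). (ad (adj2 k) v, ad (adj2 k) w)) \<in> ?I h \<rightarrow> ?I axis"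
        using ki by (auto simp: inc2 bil_ad[OF two ki])
    qed (auto simp: ad_adj2[OF k(1)])
    then show ?thesis by (simp add: bij_betw_same_card)
  qed
  have "(\<Sum>h\<in>?H. card (?I h)) = (\<Sum>h\<in>?H. card (?I axis))" by (rule sum.cong[OF refl orb])
  also have "\<dots> = card ?H * card (?I axis)" by (simp only: sum_constant of_nat_id)
  also have "card ?H = ?q * (?q + 1)" by (rule card_qf_one[OF two])
  finally have L: "(\<Sum>h\<in>?H. card (?I h)) = ?q * (?q + 1) * card (?I axis)" .
  have "card {h \<in> ?H. inc (fst z) h \<and> inc (snd z) h} = 4" if z: "z \<in> ?A" for z
  proof -
    obtain v w where e: "z = (v, w)" by (cases z)
    have vw: "qf v = nu" "qf w = nu" "bil v w = g" using z by (auto simp: e)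
    \<comment> \<open>Equal or opposite vectors have scalar product \<nu> or its negative; only
      these two values of \<open>g\<close> can make the points coincide.\<close>
    have "v \<noteq> w" using vw g bil_self[OF two, of v] by auto
    moreover have "v \<noteq> tneg w"
    proof
      assume "v = tneg w"
      then have "g = - nu" using vw bil_self[OF two, of w] by (simp add: bil_tneg)
      then show False using g by simp
    qed
    ultimately show ?thesis using card_common_blocks[OF vw(1,2)] by (simp add: e)
  qed
  then have "(\<Sum>z\<in>?A. card {h \<in> ?H. inc (fst z) h \<and> inc (snd z) h}) = 4 * card ?A" by simp
  also have "card ?A = (\<Sum>v\<in>{v. qf v = nu}. ?q + 1)"
    using card_qf_bil_orbit[OF _ g] by (subst card_SigmaI) simp_all
  also have "\<dots> = ?q * (?q - 1) * (?q + 1)" using card_qf_nonsquare[OF nu] by simp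
  finally have R: "(\<Sum>z\<in>?A. card {h \<in> ?H. inc (fst z) h \<and> inc (snd z) h}) = 4 * (?q * (?q - 1) * (?q + 1))" .
  have "(\<Sum>h\<in>?H. card {z \<in> ?A. inc (fst z) h \<and> inc (snd z) h}) = (\<Sum>z\<in>?A. card {h \<in> ?H. inc (fst z) h \<and> inc (snd z) h})"
    by (rule sum_multicount_gen) auto
  moreover have "{z \<in> ?A. inc (fst z) h \<and> inc (snd z) h} = ?I h" for h by auto
  ultimately have "?q * (?q + 1) * card (?I axis) = ?q * (?q + 1) * (4 * (?q - 1))"
    using L R by (simp only: mult_ac)
  then have "card (?I axis) = 4 * (?q - 1)" by (subst (asm) nat_mult_eq_cancel1) simp_all
  moreover have "?I axis = {(v, w). v \<in> V \<and> w \<in> V \<and> bil v w = g}" by (auto simp: V_def)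
  ultimately show ?thesis by simp
qed

text \<open>Conjugation by an element of \<open>G\<close> that fixes the block and moves the first
  point to the second induces a \<open>pm_endomorphism\<close>; preserving the block is what
  preserves \<open>stab_pm axis\<close>.\<close>

lemma V_transport:
  assumes "v \<in> V" "w \<in> V"
  shows "\<exists>\<tau>. field_aut \<tau> \<and> \<tau> ((fst v)\<^sup>2 / nu) = (fst w)\<^sup>2 / nu \<and>
      (\<forall>u\<in>V. \<exists>u'\<in>V. \<tau> ((fst u)\<^sup>2 / nu) = (fst u')\<^sup>2 / nu)"
proof -
  let ?B = "bk axis"
  have B: "?B \<in> Bs" by (rule bk_mem) simp
  have BP: "?B \<subseteq> P" by (rule block_subset[OF B])
  obtain \<phi> where \<phi>: "bij_betw \<phi> P P" "\<phi> ` ?B = ?B" "\<phi> (pt v) = pt w"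
    and ex: "\<forall>g\<in>SL2. \<exists>g'\<in>SL2. \<forall>z\<in>P. \<phi> (\<rho> g z) = \<rho> g' (\<phi> z)"
    using flag[OF B, of "pt v" "pt w"] assms by (auto simp: V_def inc_def)
  have \<phi>P: "z \<in> P \<Longrightarrow> \<phi> z \<in> P" for z using \<phi>(1) by (auto simp: bij_betw_def)
  obtain \<alpha> where \<alpha>: "\<And>g. g \<in> SL2 \<Longrightarrow> \<alpha> g \<in> SL2"
    and \<alpha>\<phi>: "\<And>g z. g \<in> SL2 \<Longrightarrow> z \<in> P \<Longrightarrow> \<phi> (\<rho> g z) = \<rho> (\<alpha> g) (\<phi> z)"
    using ex by metis
  interpret pm_endomorphism \<alpha>
  proof
    fix g h :: "'k ^ 2 ^ 2" assume g: "g \<in> SL2" and h: "h \<in> SL2"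
    show "pm (\<alpha> (g ** h)) (\<alpha> g ** \<alpha> h)"
    proof (rule faithful)
      show "\<alpha> (g ** h) \<in> SL2" "\<alpha> g ** \<alpha> h \<in> SL2" using \<alpha> g h SL2_mult by blast+
      fix x assume "x \<in> P"
      then obtain z where z: "z \<in> P" "x = \<phi> z" using \<phi>(1) by (auto simp: bij_betw_def)
      have "\<rho> (\<alpha> (g ** h)) x = \<phi> (\<rho> (g ** h) z)" using \<alpha>\<phi>[OF SL2_mult[OF g h] z(1)] z by simp
      also have "\<dots> = \<rho> (\<alpha> g) (\<rho> (\<alpha> h) (\<phi> z))"
        using z g h by (simp add: mult closed \<alpha>\<phi>)
      also have "\<dots> = \<rho> (\<alpha> g ** \<alpha> h) x" using mult[OF \<alpha>[OF g] \<alpha>[OF h] \<phi>P[OF z(1)]] z by simp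
      finally show "\<rho> (\<alpha> (g ** h)) x = \<rho> (\<alpha> g ** \<alpha> h) x" .
    qed
    assume pm: "pm (\<alpha> g) (\<alpha> h)"
    show "pm g h"
    proof (rule faithful[OF g h])
      fix x assume x: "x \<in> P"
      have "\<phi> (\<rho> g x) = \<phi> (\<rho> h x)"
        using \<alpha>\<phi>[OF g x] \<alpha>\<phi>[OF h x] kernel[OF \<alpha>[OF g] \<alpha>[OF h] pm \<phi>P[OF x]] by simp
      then show "\<rho> g x = \<rho> h x" using \<phi>(1) closed[OF g x] closed[OF h x] by (auto simp: bij_betw_def inj_on_def)
    qed
  next
    fix g :: "'k ^ 2 ^ 2" assume g: "g \<in> stab_pm axis"
    then have gS: "g \<in> SL2" by (simp add: stab_pm_def)
    have fixB: "h \<in> SL2 \<Longrightarrow> h \<in> stab_pm axis \<longleftrightarrow> \<rho> h ` ?B = ?B" for h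
      using bk_eq_iff[of "ad h axis" axis] bk_ad[of h axis] by (simp add: stab_pm_def)
    have "\<rho> (\<alpha> g) ` ?B = \<rho> (\<alpha> g) ` \<phi> ` ?B" using \<phi> by simp
    also have "\<dots> = \<phi> ` \<rho> g ` ?B"
      unfolding image_image using BP by (intro image_cong refl) (auto simp: \<alpha>\<phi>[OF gS, symmetric])
    also have "\<dots> = ?B" using fixB[OF gS] g \<phi> by simp
    finally show "\<alpha> g \<in> stab_pm axis" using fixB[OF \<alpha>[OF gS]] by simp
  qed (use two q5 \<alpha> in auto)
  obtain \<tau> where \<tau>: "norm_ratio_aut \<alpha> \<tau>" using norm_ratio_aut by blast
  have tr: "\<tau> ((fst u)\<^sup>2 / nu) = (fst u')\<^sup>2 / nu"
    if u: "qf u = nu" "qf u' = nu" "\<phi> (pt u) = pt u'" for u u'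
  proof -
    \<comment> \<open>Conjugation by \<phi> carries the stabiliser of \<open>pt u\<close> into that
      of \<open>pt u'\<close>.\<close>
    have "\<alpha> ` stab u \<subseteq> stab_pm u'"
    proof
      fix h assume "h \<in> \<alpha> ` stab u"
      then obtain g where g: "g \<in> SL2" "ad g u = u" "h = \<alpha> g" by (auto simp: stab_def)
      have "pt (ad h u') = \<rho> h (pt u')" using pt_ad[OF \<alpha>[OF g(1)] u(2)] g by simp
      also have "\<dots> = \<phi> (\<rho> g (pt u))" using \<alpha>\<phi>[OF g(1) pt_mem[OF u(1)]] g u by simp
      also have "\<dots> = pt u'" using pt_ad[OF g(1) u(1)] g u by simp
      finally have "ad h u' = u' \<or> ad h u' = tneg u'"
        using pt_eq_iff[of "ad h u'" u'] u \<alpha>[OF g(1)] g by simp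
      then show "h \<in> stab_pm u'" using \<alpha>[OF g(1)] g by (simp add: stab_pm_def)
    qed
    then show ?thesis using \<tau> u nu unfolding norm_ratio_aut_def by metis
  qed
  show ?thesis
  proof (intro exI[of _ \<tau>] conjI ballI)
    show "field_aut \<tau>" using \<tau> by (simp add: norm_ratio_aut_def)
    show "\<tau> ((fst v)\<^sup>2 / nu) = (fst w)\<^sup>2 / nu" using tr[of v w] \<phi> assms by (simp add: V_def)
    fix u assume u: "u \<in> V"
    then have "\<phi> (pt u) \<in> ?B" using \<phi>(2) by (auto simp: V_def inc_def)
    moreover from this obtain u' where "qf u' = nu" "pt u' = \<phi> (pt u)" using pt_surj BP by blast
    ultimately have "u' \<in> V" "\<tau> ((fst u)\<^sup>2 / nu) = (fst u')\<^sup>2 / nu"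
      using tr[of u u'] u by (simp_all add: V_def inc_def)
    then show "\<exists>u'\<in>V. \<tau> ((fst u)\<^sup>2 / nu) = (fst u')\<^sup>2 / nu" by blast
  qed
qed

theorem no_psl_design: False
proof -
  interpret block_configuration nu V
  proof
    fix x a b assume v: "(x, a, b) \<in> V"
    then show "x\<^sup>2 + a * b = nu" by (simp add: V_def)
    have n: "qf (x, a, b) = nu" and i: "inc (x, a, b) axis" using v by (simp_all only: V_def mem_Collect_eq)
    show neg: "(- x, - a, - b) \<in> V" using inc_tneg(1)[OF n] i n by (simp add: V_def)
    \<comment> \<open>\<open>A2 1\<close> negates the axis, so it fixes the block, and it transposes
      a vector up to sign.\<close>
    have "A2 1 \<in> (SL2 :: ('k ^ 2 ^ 2) set)" by simp
    moreover have "ad (A2 1) axis = tneg axis" "ad (A2 1) (x, a, b) = tneg (x, b, a)"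
      by (simp_all add: A2_def)
    moreover have m: "qf (x, b, a) = nu" using n by (simp add: mult.commute)
    ultimately have "inc (x, b, a) axis"
      using inc_ad[of "A2 1" "(x, a, b)" axis] i n inc_tneg(1)[OF m] inc_tneg(2)[of axis "tneg (x, b, a)"] by simp
    then show "(x, b, a) \<in> V" using m by (simp add: V_def)
  next
    fix x a b t assume v: "(x, a, b) \<in> V" and t: "(t::'k) \<noteq> 0"
    have n: "qf (x, a, b) = nu" and i: "inc (x, a, b) axis" using v by (simp_all only: V_def mem_Collect_eq)
    have "D2 t \<in> (SL2 :: ('k ^ 2 ^ 2) set)" using t by simp
    moreover have "ad (D2 t) axis = axis" "ad (D2 t) (x, a, b) = (x, t\<^sup>2 * a, b / t\<^sup>2)"
      using t by (simp_all add: D2_def power_divide)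
    ultimately have "inc (x, t\<^sup>2 * a, b / t\<^sup>2) axis" using inc_ad[of "D2 t" "(x, a, b)" axis] i n by simp
    moreover have "qf (x, t\<^sup>2 * a, b / t\<^sup>2) = nu" using n t by simp
    ultimately show "(x, t\<^sup>2 * a, b / t\<^sup>2) \<in> V" by (simp add: V_def)
  next
    fix g :: 'k assume "g\<^sup>2 \<noteq> nu\<^sup>2"
    then show "card {(v, w). v \<in> V \<and> w \<in> V \<and> bil v w = g} = 4 * (CARD('k) - 1)" by (rule card_pairs_V)
  next
    fix x a b y c d assume "(x, a, b) \<in> V" "(y, c, d) \<in> V"
    from V_transport[OF this] show "\<exists>\<tau>. field_aut \<tau> \<and> \<tau> (x\<^sup>2 / nu) = y\<^sup>2 / nu \<and>
      (\<forall>(z, e, f) \<in> V. \<exists>(z', e', f') \<in> V. \<tau> (z\<^sup>2 / nu) = z'\<^sup>2 / nu)"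
      by (simp add: split_beta)
  qed (use two q5 nu card_V in auto)
  show False by (rule inconsistent)
qed

end

section \<open>Lifting from PSL to SL\<close>

lemma two_neq_zero:
  assumes "odd CARD('k::{field,finite})"
  shows "(2::'k) \<noteq> 0"
proof
  assume "(2::'k) = 0"
  then have "of_nat 2 = (0::'k)" by simp
  then have "CHAR('k) dvd 2" unfolding of_nat_eq_0_iff_char_dvd .
  moreover have "CHAR('k) \<noteq> 1" by simp
  ultimately have "CHAR('k) = 2" by (metis two_is_prime_nat prime_nat_iff)
  then show False using CHAR_dvd_CARD[where 'a = 'k] assms by simp
qed

lemma centre_SL2:
  assumes two: "(2::'k::field) \<noteq> 0"
  shows "group_centre (SL :: ('k ^ 2 ^ 2) monoid) = {mat 1, - mat 1}"
proof
  show "group_centre (SL :: ('k ^ 2 ^ 2) monoid) \<subseteq> {mat 1, - mat 1}"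
  proof
    fix z :: "'k ^ 2 ^ 2" assume z: "z \<in> group_centre SL"
    then have zS: "z \<in> SL2" and U: "z ** U2 1 = U2 1 ** z" and L: "z ** L2 1 = L2 1 ** z"
      by (auto simp: group_centre_def)
    obtain p q r s where m: "z = mat2 p q r s" by (rule mat2_cases)
    have "r = 0" "s = p" using U by (auto simp: m U2_def add.commute)
    moreover have "q = 0" using L by (auto simp: m L2_def)
    ultimately have "p\<^sup>2 = 1\<^sup>2" using zS by (simp add: m power2_eq_square)
    then have "p = 1 \<or> p = -1" unfolding power2_eq_iff .
    then show "z \<in> {mat 1, - mat 1}" using \<open>r = 0\<close> \<open>s = p\<close> \<open>q = 0\<close> by (auto simp: m mat_one_eq_mat2)
  qed
  have "det (- mat 1 :: 'k ^ 2 ^ 2) = 1" by (simp add: mat_one_eq_mat2)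
  then show "{mat 1, - mat 1} \<subseteq> group_centre (SL :: ('k ^ 2 ^ 2) monoid)"
    by (auto simp: group_centre_def minus_matrix_mult)
qed

lemma centre_coset:
  assumes two: "(2::'k::field) \<noteq> 0"
  shows "group_centre SL #>\<^bsub>SL\<^esub> (g :: 'k ^ 2 ^ 2) = {g, - g}"
  by (auto simp: r_coset_def centre_SL2[OF two] minus_matrix_mult)

lemma SL_cover:
  fixes T :: "('b, 'c) monoid_scheme"
  assumes two: "(2::'k::field) \<noteq> 0" and T: "group T" and iso: "T \<cong> (PSL :: ('k ^ 2 ^ 2) set monoid)"
  obtains \<rho> :: "'k::field ^ 2 ^ 2 \<Rightarrow> 'b" where "\<rho> ` SL2 = carrier T"
    and "\<And>g h. g \<in> SL2 \<Longrightarrow> h \<in> SL2 \<Longrightarrow> \<rho> (g ** h) = \<rho> g \<otimes>\<^bsub>T\<^esub> \<rho> h"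
    and "\<And>g h. g \<in> SL2 \<Longrightarrow> h \<in> SL2 \<Longrightarrow> \<rho> g = \<rho> h \<longleftrightarrow> pm g h"
proof -
  let ?Z = "group_centre (SL :: ('k ^ 2 ^ 2) monoid)"
  let ?c = "\<lambda>g. ?Z #>\<^bsub>SL\<^esub> g"
  have N: "?Z \<lhd> SL" by (rule group.group_centre_normal[OF group_SL])
  obtain h where h: "h \<in> iso T (PSL :: ('k ^ 2 ^ 2) set monoid)" using iso by (auto simp: is_iso_def)
  let ?k = "inv_into (carrier T) h"
  have k: "?k \<in> iso PSL T" by (rule group.iso_set_sym[OF T h])
  have c_car: "?c ` SL2 = carrier PSL"
    by (auto simp: PSL_def FactGroup_def RCOSETS_def)
  have c_mult: "?c (g ** g') = ?c g \<otimes>\<^bsub>PSL\<^esub> ?c g'" if "g \<in> SL2" "g' \<in> SL2" for g g'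
    using normal.rcos_sum[OF N, of g g'] that by (simp add: PSL_def FactGroup_def)
  show ?thesis
  proof (rule that[of "\<lambda>g. ?k (?c g)"])
    show "(\<lambda>g. ?k (?c g)) ` SL2 = carrier T"
    proof -
      have "?k ` carrier PSL = carrier T" using k by (simp add: iso_def bij_betw_def)
      then show ?thesis unfolding c_car[symmetric] image_image .
    qed
    fix g g' :: "'k ^ 2 ^ 2" assume g: "g \<in> SL2" "g' \<in> SL2"
    then have cg: "?c g \<in> carrier PSL" "?c g' \<in> carrier PSL" using c_car by blast+
    show "?k (?c (g ** g')) = ?k (?c g) \<otimes>\<^bsub>T\<^esub> ?k (?c g')"
      using k cg unfolding c_mult[OF g] iso_def hom_def by blast
    have "inj_on ?k (carrier PSL)" using k by (simp add: iso_def bij_betw_def)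
    from inj_on_eq_iff[OF this cg] have "?k (?c g) = ?k (?c g') \<longleftrightarrow> ?c g = ?c g'" .
    also have "\<dots> \<longleftrightarrow> pm g g'" unfolding centre_coset[OF two] pm_def by (auto simp: doubleton_eq_iff)
    finally show "?k (?c g) = ?k (?c g') \<longleftrightarrow> pm g g'" .
  qed
qed

text \<open>Lets the vector of a block, whose norm is a square, be rescaled to norm one.\<close>

lemma stab_pm_scale:
  assumes c: "c \<noteq> 0"
  shows "stab_pm (c * x, c * a, c * b) = stab_pm (x, a, b :: 'k::field)"
proof -
  have ad: "ad g (c * x, c * a, c * b) = (case ad g (x, a, b) of (x, a, b) \<Rightarrow> (c * x, c * a, c * b))" for g
    by (cases g rule: mat2_cases) (simp add: algebra_simps)
  have "ad g (c * x, c * a, c * b) = (c * x', c * a', c * b') \<longleftrightarrow> ad g (x, a, b) = (x', a', b')" for g x' a' b'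
    unfolding ad using c by (cases "ad g (x, a, b)") simp
  from this[of _ x a b] this[of _ "- x" "- a" "- b"] show ?thesis by (simp add: stab_pm_def)
qed

text \<open>The generating set, a union of normal subgroups, is closed under conjugation.\<close>

lemma socle_normal:
  assumes "group G"
  shows "socle G \<lhd> G"
  unfolding socle_def
proof (rule group.normal_generateI[OF assms])
  have sub: "N \<subseteq> carrier G" if "minimal_normal N G" for N
    using that subgroup.subset[of N G] by (simp add: minimal_normal_def normal_imp_subgroup)
  then show "\<Union> {N. minimal_normal N G} \<subseteq> carrier G" by blast
  fix h g assume h: "h \<in> \<Union> {N. minimal_normal N G}" and g: "g \<in> carrier G"
  then obtain N where N: "minimal_normal N G" "h \<in> N" by blast
  then have "g \<otimes>\<^bsub>G\<^esub> h \<otimes>\<^bsub>G\<^esub> inv\<^bsub>G\<^esub> g \<in> N"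
    using g by (auto simp: minimal_normal_def intro: normal.inv_op_closed2)
  then show "g \<otimes>\<^bsub>G\<^esub> h \<otimes>\<^bsub>G\<^esub> inv\<^bsub>G\<^esub> g \<in> \<Union> {N. minimal_normal N G}" using N by blast
qed

lemma subgroup_stabilizer:
  assumes G: "group G" and one: "\<phi> \<one>\<^bsub>G\<^esub> w = w"
    and mult: "\<And>s t. s \<in> carrier G \<Longrightarrow> t \<in> carrier G \<Longrightarrow> \<phi> (s \<otimes>\<^bsub>G\<^esub> t) w = \<phi> s (\<phi> t w)"
  shows "subgroup (stabilizer G \<phi> w) G"
proof -
  interpret group G by (rule G)
  show ?thesis
  proof (rule subgroupI)
    have "\<one>\<^bsub>G\<^esub> \<in> stabilizer G \<phi> w" by (simp add: stabilizer_def one)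
    then show "stabilizer G \<phi> w \<noteq> {}" by blast
    fix s assume "s \<in> stabilizer G \<phi> w"
    then have s: "s \<in> carrier G" "\<phi> s w = w" by (simp_all add: stabilizer_def)
    then have "\<phi> (inv\<^bsub>G\<^esub> s) w = \<phi> (inv\<^bsub>G\<^esub> s \<otimes>\<^bsub>G\<^esub> s) w" using mult[of "inv\<^bsub>G\<^esub> s" s] by simp
    then show "inv\<^bsub>G\<^esub> s \<in> stabilizer G \<phi> w" using s by (simp add: stabilizer_def one)
  qed (auto simp: stabilizer_def mult)
qed

text \<open>The stabiliser is pulled back to \<open>SL(2, q)\<close>, where the two signs double its
  order.\<close>

lemma dihedral_stabiliser:
  fixes \<rho> :: "'k::{field,finite} ^ 2 ^ 2 \<Rightarrow> 'b" and T :: "('b, 'c) monoid_scheme"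
  assumes two: "(2::'k) \<noteq> 0" and n: "even n" "n \<ge> 4" and T: "group T"
    and \<rho>: "\<rho> ` SL2 = carrier T"
      "\<And>g h. g \<in> SL2 \<Longrightarrow> h \<in> SL2 \<Longrightarrow> \<rho> (g ** h) = \<rho> g \<otimes>\<^bsub>T\<^esub> \<rho> h"
      "\<And>g h. g \<in> SL2 \<Longrightarrow> h \<in> SL2 \<Longrightarrow> \<rho> g = \<rho> h \<longleftrightarrow> pm g h"
    and Y: "subgroup Y T" and iso: "T\<lparr>carrier := Y\<rparr> \<cong> dihedral n"
  shows "subgroup {g \<in> SL2. \<rho> g \<in> Y} SL" "card {g \<in> SL2. \<rho> g \<in> Y} = 2 * n"
    "\<exists>v. v \<noteq> (0, 0, 0) \<and> {g \<in> SL2. \<rho> g \<in> Y} \<subseteq> stab_pm v"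
proof -
  let ?S = "{g \<in> SL2. \<rho> g \<in> Y}"
  obtain i where i: "i \<in> iso (T\<lparr>carrier := Y\<rparr>) (dihedral n)" using iso by (auto simp: is_iso_def)
  have \<rho>hom: "group_hom SL T \<rho>"
    using \<rho> by (auto simp: group_hom_def group_hom_axioms_def group_SL T hom_def)
  show S: "subgroup ?S SL"
  proof (rule group.subgroupI[OF group_SL])
    show "?S \<subseteq> carrier SL" by auto
    have "\<rho> (mat 1) = \<one>\<^bsub>T\<^esub>" using group_hom.hom_one[OF \<rho>hom] by simp
    then have "mat 1 \<in> ?S" using subgroup.one_closed[OF Y] by simp
    then show "?S \<noteq> {}" by blast
    fix g h assume g: "g \<in> ?S" and h: "h \<in> ?S"
    then show "g \<otimes>\<^bsub>SL\<^esub> h \<in> ?S" using \<rho>(2) SL2_mult subgroup.m_closed[OF Y] by auto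
    have "\<rho> (inv\<^bsub>SL\<^esub> g) = inv\<^bsub>T\<^esub> (\<rho> g)" using group_hom.hom_inv[OF \<rho>hom] g by simp
    then show "inv\<^bsub>SL\<^esub> g \<in> ?S"
      using g subgroup.m_inv_closed[OF Y] SL_inv[of g] adj2_inverse(3)[of g] by simp
  qed
  have \<rho>S: "\<rho> ` ?S = Y"
  proof
    show "Y \<subseteq> \<rho> ` ?S"
    proof
      fix y assume y: "y \<in> Y"
      then have "y \<in> \<rho> ` SL2" using \<rho>(1) subgroup.subset[OF Y] by blast
      then obtain g where "g \<in> SL2" "y = \<rho> g" by (rule imageE)
      then show "y \<in> \<rho> ` ?S" using y by blast
    qed
  qed auto
  let ?\<theta> = "\<lambda>g. i (\<rho> g)"
  have surj: "?\<theta> ` ?S = carrier (dihedral n)"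
  proof -
    have "i ` Y = carrier (dihedral n)" using i by (simp add: iso_def bij_betw_def)
    then have "i ` \<rho> ` ?S = carrier (dihedral n)" unfolding \<rho>S .
    then show ?thesis unfolding image_image .
  qed
  have hom: "?\<theta> (g ** h) = ?\<theta> g \<otimes>\<^bsub>dihedral n\<^esub> ?\<theta> h" if "g \<in> ?S" "h \<in> ?S" for g h
  proof -
    have "\<forall>x\<in>Y. \<forall>y\<in>Y. i (x \<otimes>\<^bsub>T\<^esub> y) = i x \<otimes>\<^bsub>dihedral n\<^esub> i y" using i by (simp add: iso_def hom_def)
    moreover have "\<rho> g \<in> Y" "\<rho> h \<in> Y" using that by simp_all
    moreover have "\<rho> (g ** h) = \<rho> g \<otimes>\<^bsub>T\<^esub> \<rho> h" using that by (intro \<rho>(2)) simp_all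
    ultimately show ?thesis by metis
  qed
  have ker: "?\<theta> g = ?\<theta> h \<longleftrightarrow> pm g h" if "g \<in> ?S" "h \<in> ?S" for g h
  proof -
    have "inj_on i Y" using i by (simp add: iso_def bij_betw_def)
    then have "?\<theta> g = ?\<theta> h \<longleftrightarrow> \<rho> g = \<rho> h" using that by (simp add: inj_on_eq_iff)
    then show ?thesis using \<rho>(3) that by simp
  qed
  have neg: "- g \<in> ?S" if g: "g \<in> ?S" for g
  proof -
    have "- g \<in> SL2" using g SL2_uminus by blast
    then have "\<rho> (- g) = \<rho> g" using \<rho>(3)[of "- g" g] g by simp
    then show ?thesis using g \<open>- g \<in> SL2\<close> by simp
  qed
  show "card ?S = 2 * n" "\<exists>v. v \<noteq> (0, 0, 0) \<and> ?S \<subseteq> stab_pm v"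
    using dihedral_preimage[OF two n S surj hom ker neg] by blast+
qed

theorem theorem2p4:
  fixes p f q :: nat
  assumes "prime p" and "odd p" and "q = p ^ f" and "q > 5"
    and "CARD('k :: {field, finite}) = q"
  shows "\<not> (\<exists>(P :: 'a set) Bs G T x B.
           nontrivial_two_design P Bs (q * (q - 1) div 2) (q - 1) 2 \<and>
           card Bs = q * (q + 1) div 2 \<and>
           (\<forall>y\<in>P. card {C \<in> Bs. y \<in> C} = q + 1) \<and>
           subgroup G (design_aut P Bs) \<and>
           flag_transitive G P Bs \<and>
           T = (design_aut P Bs)\<lparr>carrier := socle ((design_aut P Bs)\<lparr>carrier := G\<rparr>)\<rparr> \<and>
           T \<cong> (PSL :: ('k ^ 2 ^ 2) set monoid) \<and>
           x \<in> P \<and> B \<in> Bs \<and>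
           T\<lparr>carrier := stabilizer T (\<lambda>g. g) x\<rparr> \<cong> dihedral (q + 1) \<and>
           T\<lparr>carrier := stabilizer T (\<lambda>g C. g ` C) B\<rparr> \<cong> dihedral (q - 1))"
proof (rule notI, elim exE conjE)
  fix P :: "'a set" and Bs G T x B
  assume design: "nontrivial_two_design P Bs (q * (q - 1) div 2) (q - 1) 2"
    and card_Bs: "card Bs = q * (q + 1) div 2"
    and G: "subgroup G (design_aut P Bs)" and flagtrans: "flag_transitive G P Bs"
    and T: "T = (design_aut P Bs)\<lparr>carrier := socle ((design_aut P Bs)\<lparr>carrier := G\<rparr>)\<rparr>"
    and iso: "T \<cong> (PSL :: ('k ^ 2 ^ 2) set monoid)"
    and x: "x \<in> P" and B: "B \<in> Bs"
    and isox: "T\<lparr>carrier := stabilizer T (\<lambda>g. g) x\<rparr> \<cong> dihedral (q + 1)"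
    and isoB: "T\<lparr>carrier := stabilizer T (\<lambda>g C. g ` C) B\<rparr> \<cong> dihedral (q - 1)"
  have odd_q: "odd q" using assms(2,3) by simp
  then have two: "(2::'k) \<noteq> 0" using two_neq_zero assms(5) by metis
  have q7: "q \<ge> 7" using odd_q assms(4) by presburger
  have tp: "two_design P Bs (q * (q - 1) div 2) (q - 1) 2" using design by (simp add: nontrivial_two_design_def)
  have fin: "finite P" and card_P: "card P = q * (q - 1) div 2"
    and blk: "\<And>C. C \<in> Bs \<Longrightarrow> C \<subseteq> P \<and> card C = q - 1"
    and lam: "\<And>y z. y \<in> P \<Longrightarrow> z \<in> P \<Longrightarrow> y \<noteq> z \<Longrightarrow> card {C \<in> Bs. y \<in> C \<and> z \<in> C} = 2"
    using tp by (auto simp: two_design_def)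
  let ?A = "design_aut P Bs"
  let ?G = "?A\<lparr>carrier := G\<rparr>"
  have A: "group ?A" by (rule group_design_aut) (use blk in blast)
  have gG: "group ?G" by (rule group.subgroup_imp_group[OF A G])
  have soc: "socle ?G \<lhd> ?G" by (rule socle_normal[OF gG])
  have socG: "socle ?G \<subseteq> G" using subgroup.subset[OF normal_imp_subgroup[OF soc]] by simp
  have socA: "subgroup (socle ?G) ?A"
    by (rule group.incl_subgroup[OF A G normal_imp_subgroup[OF soc]])
  have gT: "group T" unfolding T by (rule group.subgroup_imp_group[OF A socA])
  have car: "g \<in> carrier ?A \<longleftrightarrow> g \<in> Bij P \<and> (\<lambda>C. g ` C) ` Bs = Bs" for g
    by (simp add: design_aut_def)
  have multA: "g \<otimes>\<^bsub>?A\<^esub> h = compose P g h" if "g \<in> Bij P" "h \<in> Bij P" for g h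
    using that by (simp add: design_aut_def BijGroup_def)
  have carT: "carrier T = socle ?G" by (simp add: T)
  have TG: "t \<in> carrier T \<Longrightarrow> t \<in> carrier ?A" for t
    using socG subgroup.subset[OF G] by (auto simp: carT)
  have TB: "t \<in> carrier T \<Longrightarrow> t \<in> Bij P" and TBs: "t \<in> carrier T \<Longrightarrow> (\<lambda>C. t ` C) ` Bs = Bs" for t
    using TG car by blast+
  have multT: "s \<otimes>\<^bsub>T\<^esub> t = compose P s t" if "s \<in> carrier T" "t \<in> carrier T" for s t
    using multA[OF TB[OF that(1)] TB[OF that(2)]] by (simp add: T)
  have oneT: "\<one>\<^bsub>T\<^esub> = (\<lambda>y\<in>P. y)" by (simp add: T design_aut_def BijGroup_def)
  obtain \<rho> :: "'k ^ 2 ^ 2 \<Rightarrow> 'a \<Rightarrow> 'a" where \<rho>_car: "\<rho> ` SL2 = carrier T"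
    and \<rho>_mult: "\<And>g h. g \<in> SL2 \<Longrightarrow> h \<in> SL2 \<Longrightarrow> \<rho> (g ** h) = \<rho> g \<otimes>\<^bsub>T\<^esub> \<rho> h"
    and \<rho>_eq: "\<And>g h. g \<in> SL2 \<Longrightarrow> h \<in> SL2 \<Longrightarrow> \<rho> g = \<rho> h \<longleftrightarrow> pm g h"
    using SL_cover[OF two gT iso] by metis
  have \<rho>T: "g \<in> SL2 \<Longrightarrow> \<rho> g \<in> carrier T" for g using \<rho>_car by blast
  have bij: "bij_betw t P P" and ext: "t \<in> extensional P" if "t \<in> carrier T" for t
    using TB[OF that] by (simp_all add: Bij_def)
  have imgP: "t y \<in> P" if "t \<in> carrier T" "y \<in> P" for t y
    using bij[OF that(1)] that(2) by (auto simp: bij_betw_def)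
  have Yx: "subgroup (stabilizer T (\<lambda>g. g) x) T"
    by (rule subgroup_stabilizer[OF gT]) (use x multT in \<open>simp_all add: oneT compose_eq\<close>)
  have BP: "B \<subseteq> P" using blk[OF B] by blast
  have YB: "subgroup (stabilizer T (\<lambda>g C. g ` C) B) T"
  proof (rule subgroup_stabilizer[OF gT])
    show "\<one>\<^bsub>T\<^esub> ` B = B"
      using image_cong[of B B "\<lambda>y\<in>P. y" "\<lambda>y. y"] BP by (simp add: oneT subset_iff)
    show "(s \<otimes>\<^bsub>T\<^esub> t) ` B = s ` t ` B" if "s \<in> carrier T" "t \<in> carrier T" for s t
      unfolding multT[OF that] image_image using BP by (intro image_cong) (auto simp: compose_eq)
  qed
  have q5: "CARD('k) > 5" using assms by simp
  let ?Sx = "{g \<in> SL2. \<rho> g \<in> stabilizer T (\<lambda>g. g) x}"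
  let ?SB = "{g \<in> SL2. \<rho> g \<in> stabilizer T (\<lambda>g C. g ` C) B}"
  have nx: "even (q + 1)" "q + 1 \<ge> 4" and nB: "even (q - 1)" "q - 1 \<ge> 4" using odd_q q7 by simp_all
  note Sx = dihedral_stabiliser[OF two nx gT \<rho>_car \<rho>_mult \<rho>_eq Yx isox]
  note SB = dihedral_stabiliser[OF two nB gT \<rho>_car \<rho>_mult \<rho>_eq YB isoB]
  obtain v0 where v0: "v0 \<noteq> (0, 0, 0)" "?Sx \<subseteq> stab_pm v0" using Sx(3) by blast
  have cx: "card ?Sx = 2 * (CARD('k) + 1)" using Sx(2) assms(5) by simp
  note typex = stab_pm_type_nonsquare[OF two q5 v0(1) Sx(1) v0(2) cx]
  obtain w where w: "w \<noteq> (0, 0, 0)" "?SB \<subseteq> stab_pm w" using SB(3) by blast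
  have cB: "card ?SB = 2 * (CARD('k) - 1)" using SB(2) assms(5) by simp
  note typeB = stab_pm_type_square[OF two q5 w(1) SB(1) w(2) cB]
  obtain d where d: "qf w = d\<^sup>2" "d \<noteq> 0" using typeB(1) by (auto simp: nzsq_def)
  obtain w1 w2 w3 where ww: "w = (w1, w2, w3)" by (cases w)
  define w0 where "w0 = (1 / d * w1, 1 / d * w2, 1 / d * w3)"
  have "stab_pm w0 = stab_pm w" unfolding w0_def ww using d by (intro stab_pm_scale) simp
  then have sw: "stab_pm w0 = ?SB" using typeB(2) by (rule trans[OF _ sym])
  have "qf w0 = (1 / d)\<^sup>2 * qf w" by (simp only: w0_def ww qf.simps) (simp add: algebra_simps power2_eq_square)
  then have qw: "qf w0 = 1" using d by (simp add: power_divide)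
  have "psl_design P Bs \<rho> x B v0 w0"
  proof
    show "2 * card P = CARD('k) * (CARD('k) - 1)" unfolding assms(5) card_P using odd_q by simp
    show "2 * card Bs = CARD('k) * (CARD('k) + 1)" unfolding assms(5) card_Bs using odd_q by simp
    show "C \<subseteq> P \<and> card C = CARD('k) - 1" if "C \<in> Bs" for C using blk[OF that] assms(5) by simp
    show "card {C \<in> Bs. y \<in> C \<and> z \<in> C} = 2" if "y \<in> P" "z \<in> P" "y \<noteq> z" for y z using lam[OF that] .
    show "\<rho> g y \<in> P" if "g \<in> SL2" "y \<in> P" for g y using imgP[OF \<rho>T[OF that(1)] that(2)] .
    show "\<rho> (g ** h) y = \<rho> g (\<rho> h y)" if "g \<in> SL2" "h \<in> SL2" "y \<in> P" for g h y
      using that by (simp add: \<rho>_mult multT \<rho>T compose_eq)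
    show "\<rho> (mat 1) y = y" if "y \<in> P" for y
    proof -
      have "\<rho> (mat 1) = \<rho> (mat 1) \<otimes>\<^bsub>T\<^esub> \<rho> (mat 1)" using \<rho>_mult[of "mat 1" "mat 1"] by simp
      then have "\<rho> (mat 1) = \<one>\<^bsub>T\<^esub>" using group.l_cancel_one'[OF gT \<rho>T \<rho>T, of "mat 1" "mat 1"] by simp
      then show ?thesis using that by (simp add: oneT)
    qed
    show "pm g h" if g: "g \<in> SL2" "h \<in> SL2" and eq: "\<And>y. y \<in> P \<Longrightarrow> \<rho> g y = \<rho> h y" for g h
    proof -
      \<comment> \<open>Elements of \<open>BijGroup P\<close> are extensional, so agreement on
        \<open>P\<close> is equality.\<close>
      have "\<rho> g = \<rho> h" using extensionalityI[OF ext[OF \<rho>T[OF g(1)]] ext[OF \<rho>T[OF g(2)]]] eq by blast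
      then show ?thesis using \<rho>_eq[OF g] by simp
    qed
    show "\<rho> g y = \<rho> h y" if "g \<in> SL2" "h \<in> SL2" "pm g h" for g h y
      using \<rho>_eq[OF that(1,2)] that(3) by simp
    show "\<rho> g ` C \<in> Bs" if "g \<in> SL2" "C \<in> Bs" for g C using TBs[OF \<rho>T[OF that(1)]] that(2) by blast
    show "{g \<in> SL2. \<rho> g x = x} = stab_pm v0"
      by (rule trans[OF _ typex(3)]) (use \<rho>T in \<open>auto simp: stabilizer_def\<close>)
    show "{g \<in> SL2. \<rho> g ` B = B} = stab_pm w0" unfolding sw using \<rho>T by (auto simp: stabilizer_def)
    show "card (stab_pm v0) = 2 * (CARD('k) + 1)" using cx typex(3) by simp
    show "card (stab_pm w0) = 2 * (CARD('k) - 1)" using cB sw by simp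
    fix C y z assume C: "C \<in> Bs" "y \<in> C" "z \<in> C"
    then have "(y, C) \<in> flags P Bs" "(z, C) \<in> flags P Bs" using blk by (auto simp: flags_def)
    then obtain \<phi> where \<phi>: "\<phi> \<in> G" "\<phi> y = z" "\<phi> ` C = C"
      using bspec[OF bspec[OF flagtrans[unfolded flag_transitive_def], of "(y, C)", unfolded prod.case]] by fastforce
    have \<phi>A: "\<phi> \<in> carrier ?A" using \<phi>(1) subgroup.subset[OF G] by blast
    then have \<phi>B: "\<phi> \<in> Bij P" using car by blast
    show "\<exists>\<phi>. bij_betw \<phi> P P \<and> \<phi> ` C = C \<and> \<phi> y = z \<and> (\<forall>g\<in>SL2. \<exists>g'\<in>SL2. \<forall>z\<in>P. \<phi> (\<rho> g z) = \<rho> g' (\<phi> z))"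
    proof (intro exI[of _ \<phi>] conjI ballI)
      show "bij_betw \<phi> P P" using \<phi>B by (simp add: Bij_def)
      show "\<phi> ` C = C" "\<phi> y = z" by (rule \<phi>)+
      fix g :: "'k ^ 2 ^ 2" assume g: "g \<in> SL2"
      have gA: "\<rho> g \<in> carrier ?A" using TG[OF \<rho>T[OF g]] .
      \<comment> \<open>The socle is normal in \<open>G\<close>, so the conjugate of
        \<open>\<rho> g\<close> by \<phi> stays in \<open>T\<close> and comes from some
        \<open>g'\<close>.\<close>
      have "\<phi> \<otimes>\<^bsub>?G\<^esub> \<rho> g \<otimes>\<^bsub>?G\<^esub> inv\<^bsub>?G\<^esub> \<phi> \<in> socle ?G"
        by (rule normal.inv_op_closed2[OF soc]) (use \<phi>(1) \<rho>T[OF g] carT in simp_all)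
      then have mem: "\<phi> \<otimes>\<^bsub>?A\<^esub> \<rho> g \<otimes>\<^bsub>?A\<^esub> inv\<^bsub>?A\<^esub> \<phi> \<in> carrier T"
        unfolding carT using group.m_inv_consistent[OF A G \<phi>(1)] by simp
      then obtain g' where g': "g' \<in> SL2" "\<phi> \<otimes>\<^bsub>?A\<^esub> \<rho> g \<otimes>\<^bsub>?A\<^esub> inv\<^bsub>?A\<^esub> \<phi> = \<rho> g'"
        unfolding \<rho>_car[symmetric] by blast
      have "\<rho> g' \<otimes>\<^bsub>?A\<^esub> \<phi> = \<phi> \<otimes>\<^bsub>?A\<^esub> \<rho> g"
        using group.inv_solve_right[OF A TG[OF \<rho>T[OF g'(1)]]
            monoid.m_closed[OF group.is_monoid[OF A] \<phi>A gA] \<phi>A] g'(2) by metis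
      then have "compose P (\<rho> g') \<phi> = compose P \<phi> (\<rho> g)"
        using multA[OF TB[OF \<rho>T[OF g'(1)]] \<phi>B] multA[OF \<phi>B TB[OF \<rho>T[OF g]]] by simp
      then have "\<forall>z\<in>P. \<phi> (\<rho> g z) = \<rho> g' (\<phi> z)" by (metis compose_eq)
      then show "\<exists>g'\<in>SL2. \<forall>z\<in>P. \<phi> (\<rho> g z) = \<rho> g' (\<phi> z)" using g'(1) by blast
    qed
  qed (use two q5 fin x B typex(1,2) qw in simp_all)
  then show False by (rule psl_design.no_psl_design)
qed

end
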